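(* Let $\mathbf{X}\sim\mathcal{LMN}_{p,n;q}(\boldsymbol{\mu},\boldsymbol{\Sigma},\mathbf{B};f_{\boldsymbol{\nu}})$ with $p<n-1$ and $\boldsymbol{\Sigma}$ positive definite, and let $p=p(n)$ satisfy $p/n=c+o(n^{-1/2})$ with $c\in[0,1)$ as $n\to\infty$. Let $\mathbf{l}$ be a non-zero $p$-dimensional vector of constants. Assume that there are constants $m_1,M_1,M_2$, not depending on $p$, such that, with $(\lambda_i,\mathbf{u}_i)$, $i=1,\dots,p$, the eigenvalues and (orthonormal) eigenvectors of $\boldsymbol{\Sigma}$: (i) $0<m_1\le\lambda_1\le\lambda_2\le\dots\le\lambda_p\le M_1<\infty$ uniformly in $p$; (ii) $M_2<\infty$ and $|\mathbf{u}_i^\top\boldsymbol{\mu}|\le M_2$, $|\mathbf{u}_i^\top\mathbf{b}_j|\le M_2$ for all $i=1,\dots,p$, $j=1,\dots,q$, uniformly in $p$, where $\mathbf{b}_1,\dots,\mathbf{b}_q$ are the columns of $\mathbf{B}$; (iii) $|\mathbf{u}_i^\top\mathbf{l}|\le M_2$ for all $i=1,\dots,p$, uniformly in $p$. Then, as $n\to\infty$, $$\sqrt{n}\,\tilde{\sigma}_{\boldsymbol{\nu}}^{-1}\left(\mathbf{l}^\top\mathbf{S}^{-1}\overline{\mathbf{x}}-\frac{1}{1-c}\,\mathbf{l}^\top\boldsymbol{\Sigma}^{-1}\boldsymbol{\mu}_{\boldsymbol{\nu}}\right)\overset{\mathcal{D}}{\longrightarrow}\mathcal{N}(0,1),$$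 where $\boldsymbol{\mu}_{\boldsymbol{\nu}}=\boldsymbol{\mu}+\mathbf{B}\boldsymbol{\nu}$ and $$\tilde{\sigma}_{\boldsymbol{\nu}}^2=\frac{1}{(1-c)^3}\left(\left(\mathbf{l}^\top\boldsymbol{\Sigma}^{-1}\boldsymbol{\mu}_{\boldsymbol{\nu}}\right)^2+\mathbf{l}^\top\boldsymbol{\Sigma}^{-1}\mathbf{l}\,\left(1+\boldsymbol{\mu}_{\boldsymbol{\nu}}^\top\boldsymbol{\Sigma}^{-1}\boldsymbol{\mu}_{\boldsymbol{\nu}}\right)\right).$$
   Context: $\mathbf{X}=(\mathbf{x}_1,\dots,\mathbf{x}_n)\sim\mathcal{LMN}_{p,n;q}(\boldsymbol{\mu},\boldsymbol{\Sigma},\mathbf{B};f_{\boldsymbol{\nu}})$ (matrix-variate location mixture of normal distributions) means that the $p\times n$ random matrix $\mathbf{X}$ has the stochastic representation $\mathbf{X}\stackrel{d}{=}\mathbf{Y}+\mathbf{B}\boldsymbol{\nu}\mathbf{1}_n^\top$, where $\mathbf{Y}\sim\mathcal{N}_{p,n}(\boldsymbol{\mu}\mathbf{1}_n^\top,\boldsymbol{\Sigma}\otimes\mathbf{I}_n)$ (i.e. the columns of $\mathbf{Y}$ are i.i.d. $\mathcal{N}_p(\boldsymbol{\mu},\boldsymbol{\Sigma})$), $\boldsymbol{\nu}$ is a $q$-dimensional random vector with continuous density function $f_{\boldsymbol{\nu}}$, $\mathbf{B}$ is a $p\times q$ matrix of constants, $\mathbf{Y}$ and $\boldsymbol{\nu}$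 are independent, and $\mathbf{1}_n$ is the $n$-vector of ones. The vector $\boldsymbol{\nu}$ in the claim is the one in this representation (so one takes $\mathbf{X}=\mathbf{Y}+\mathbf{B}\boldsymbol{\nu}\mathbf{1}_n^\top$). The sample mean and sample covariance matrix are $\overline{\mathbf{x}}=\frac1n\sum_{i=1}^n\mathbf{x}_i$ and $\mathbf{S}=\frac{1}{n-1}\sum_{i=1}^n(\mathbf{x}_i-\overline{\mathbf{x}})(\mathbf{x}_i-\overline{\mathbf{x}})^\top$. The dimension $q$ and the density $f_{\boldsymbol{\nu}}$ are fixed, independent of $p$ and $n$; $\boldsymbol{\mu},\boldsymbol{\Sigma},\mathbf{B},\mathbf{l}$ depend on $p$. *)

theory Defs
  imports
    "HOL-Probability.Probability"
    "HOL-Library.Landau_Symbols"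
    "Jordan_Normal_Form.Determinant"
    "Jordan_Normal_Form.Char_Poly"
    "Jordan_Normal_Form.Gauss_Jordan_Elimination"
begin

unbundle no vec_syntax
unbundle no inner_syntax

text \<open>
  The dimensions \<open>p\<close> and \<open>n\<close> vary inside the statement, so vectors and matrices are those of
  \<^theory>\<open>Jordan_Normal_Form.Matrix\<close>, with indices starting at \<open>0\<close>. These types carry no
  topology and no measurable structure; probabilistic notions go through the coordinates,
  which live in finite product spaces over the index sets \<open>{..<d}\<close> and \<open>{..<p} \<times> {..<n}\<close>.
\<close>

definition vec_coords :: "nat \<Rightarrow> real Matrix.vec \<Rightarrow> nat \<Rightarrow> real" where
  "vec_coords d v = (\<lambda>i\<in>{..<d}. v $ i)"

definition mat_coords :: "nat \<Rightarrow> nat \<Rightarrow> real Matrix.mat \<Rightarrow> nat \<times> nat \<Rightarrow> real" where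
  "mat_coords p n A = (\<lambda>ij\<in>{..<p} \<times> {..<n}. A $$ ij)"

definition has_vec_density ::
    "'w measure \<Rightarrow> nat \<Rightarrow> ('w \<Rightarrow> real Matrix.vec) \<Rightarrow> (real Matrix.vec \<Rightarrow> real) \<Rightarrow> bool" where
  "has_vec_density M d V f \<longleftrightarrow>
     (\<forall>\<omega>\<in>space M. V \<omega> \<in> carrier_vec d) \<and>
     (\<forall>v\<in>carrier_vec d. 0 \<le> f v) \<and>
     distributed M (Pi\<^sub>M {..<d} (\<lambda>_. lborel)) (\<lambda>\<omega>. vec_coords d (V \<omega>))
       (\<lambda>x. ennreal (f (Matrix.vec d x)))"

text \<open>
  Continuity on \<open>\<real>\<^sup>d\<close>: the subspace of extensional functions of the product
  space \<^typ>\<open>nat \<Rightarrow> real\<close> is homeomorphic to \<open>\<real>\<^sup>d\<close>.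
\<close>

definition vec_continuous :: "nat \<Rightarrow> (real Matrix.vec \<Rightarrow> real) \<Rightarrow> bool" where
  "vec_continuous d f \<longleftrightarrow> continuous_on ({..<d} \<rightarrow>\<^sub>E UNIV) (\<lambda>x. f (Matrix.vec d x))"

definition pos_def_mat :: "nat \<Rightarrow> real Matrix.mat \<Rightarrow> bool" where
  "pos_def_mat d A \<longleftrightarrow> A \<in> carrier_mat d d \<and> transpose_mat A = A \<and>
     (\<forall>v\<in>carrier_vec d. v \<noteq> 0\<^sub>v d \<longrightarrow> 0 < v \<bullet> (A *\<^sub>v v))"

text \<open>
  The inverse as a total function; for a singular matrix the value is the zero matrix
  (the sample covariance matrix below is singular only on a null set).
\<close>

definition inv_mat :: "real Matrix.mat \<Rightarrow> real Matrix.mat" where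
  "inv_mat A = (case mat_inverse A of Some B \<Rightarrow> B | None \<Rightarrow> 0\<^sub>m (dim_row A) (dim_col A))"

definition mvn_density ::
    "nat \<Rightarrow> real Matrix.vec \<Rightarrow> real Matrix.mat \<Rightarrow> real Matrix.vec \<Rightarrow> real" where
  "mvn_density d \<mu> \<Sigma> x =
     exp (- ((x - \<mu>) \<bullet> (inv_mat \<Sigma> *\<^sub>v (x - \<mu>))) / 2) / sqrt ((2 * pi) ^ d * Determinant.det \<Sigma>)"

text \<open>
  \<open>\<N>\<^sub>p\<^sub>,\<^sub>n(\<mu> 1\<^sub>n\<^sup>T, \<Sigma> \<otimes> I\<^sub>n)\<close> for positive definite \<open>\<Sigma>\<close>: the \<open>n\<close> columns are independent with
  law \<open>\<N>\<^sub>p(\<mu>, \<Sigma>)\<close>.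
\<close>

definition normal_columns ::
    "'w measure \<Rightarrow> nat \<Rightarrow> nat \<Rightarrow> real Matrix.vec \<Rightarrow> real Matrix.mat \<Rightarrow> ('w \<Rightarrow> real Matrix.mat) \<Rightarrow> bool"
  where
  "normal_columns M p n \<mu> \<Sigma> Y \<longleftrightarrow>
     (\<forall>\<omega>\<in>space M. Y \<omega> \<in> carrier_mat p n) \<and>
     (\<forall>j<n. has_vec_density M p (\<lambda>\<omega>. col (Y \<omega>) j) (mvn_density p \<mu> \<Sigma>)) \<and>
     prob_space.indep_vars M (\<lambda>_. Pi\<^sub>M {..<p} (\<lambda>_. borel))
       (\<lambda>j \<omega>. vec_coords p (col (Y \<omega>) j)) {..<n}"

text \<open>The rank-one matrix \<open>v 1\<^sub>n\<^sup>T\<close>, all of whose \<open>n\<close> columns equal \<open>v\<close>.\<close>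

definition repeat_col :: "nat \<Rightarrow> real Matrix.vec \<Rightarrow> real Matrix.mat" where
  "repeat_col n v = Matrix.mat (dim_vec v) n (\<lambda>(i, j). v $ i)"

text \<open>
  \<open>X \<sim> \<L>\<M>\<N>\<^sub>p\<^sub>,\<^sub>n\<^sub>;\<^sub>q(\<mu>, \<Sigma>, B; f)\<close>, realised on \<open>M\<close> with mixing vector \<open>\<nu>\<close>. The vector \<open>\<nu>\<close> is an
  argument because it also enters the centring and the scaling of the limit theorem; this
  is why the representation is an equality of random matrices and not only of laws.
  Independence of \<open>Y\<close> and \<open>\<nu>\<close> is that of the generated sigma-algebras, since \<open>indep_var\<close>
  requires both random elements to have values in the same type.
\<close>

definition LMN ::
    "'w measure \<Rightarrow> nat \<Rightarrow> nat \<Rightarrow> nat \<Rightarrow> real Matrix.vec \<Rightarrow> real Matrix.mat \<Rightarrow> real Matrix.mat \<Rightarrow>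
     (real Matrix.vec \<Rightarrow> real) \<Rightarrow> ('w \<Rightarrow> real Matrix.vec) \<Rightarrow> ('w \<Rightarrow> real Matrix.mat) \<Rightarrow> bool" where
  "LMN M p n q \<mu> \<Sigma> B f \<nu> X \<longleftrightarrow>
     prob_space M \<and> \<mu> \<in> carrier_vec p \<and> \<Sigma> \<in> carrier_mat p p \<and> B \<in> carrier_mat p q \<and>
     vec_continuous q f \<and> has_vec_density M q \<nu> f \<and>
     (\<exists>Y. normal_columns M p n \<mu> \<Sigma> Y \<and>
        prob_space.indep_set M
          (sets (vimage_algebra (space M) (\<lambda>\<omega>. mat_coords p n (Y \<omega>))
             (Pi\<^sub>M ({..<p} \<times> {..<n}) (\<lambda>_. borel))))
          (sets (vimage_algebra (space M) (\<lambda>\<omega>. vec_coords q (\<nu> \<omega>))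
             (Pi\<^sub>M {..<q} (\<lambda>_. borel)))) \<and>
        (\<forall>\<omega>\<in>space M. X \<omega> = Y \<omega> + repeat_col n (B *\<^sub>v \<nu> \<omega>)))"

definition sample_mean :: "real Matrix.mat \<Rightarrow> real Matrix.vec" where
  "sample_mean X = Matrix.vec (dim_row X) (\<lambda>i. (\<Sum>j<dim_col X. X $$ (i, j)) / real (dim_col X))"

definition sample_cov :: "real Matrix.mat \<Rightarrow> real Matrix.mat" where
  "sample_cov X = Matrix.mat (dim_row X) (dim_row X) (\<lambda>(i, k).
     (\<Sum>j<dim_col X. (X $$ (i, j) - sample_mean X $ i) * (X $$ (k, j) - sample_mean X $ k))
       / (real (dim_col X) - 1))"

definition sorted_eigensystem ::
    "nat \<Rightarrow> real Matrix.mat \<Rightarrow> (nat \<Rightarrow> real) \<Rightarrow> (nat \<Rightarrow> real Matrix.vec) \<Rightarrow> bool" where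
  "sorted_eigensystem d A lam u \<longleftrightarrow>
     (\<forall>i<d. eigenvector A (u i) (lam i)) \<and>
     (\<forall>i<d. \<forall>j<d. u i \<bullet> u j = (if i = j then 1 else 0)) \<and>
     (\<forall>i j. i \<le> j \<longrightarrow> j < d \<longrightarrow> lam i \<le> lam j)"

definition sigma_tilde ::
    "real \<Rightarrow> real Matrix.mat \<Rightarrow> real Matrix.vec \<Rightarrow> real Matrix.vec \<Rightarrow> real" where
  "sigma_tilde c \<Sigma> l m = sqrt (1 / (1 - c) ^ 3 *
     ((l \<bullet> (inv_mat \<Sigma> *\<^sub>v m))\<^sup>2 + (l \<bullet> (inv_mat \<Sigma> *\<^sub>v l)) * (1 + m \<bullet> (inv_mat \<Sigma> *\<^sub>v m))))"

end

theory Submission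
  imports Defs
begin

text \<open>
  Condition on \<open>\<nu>\<close> and whiten with a matrix \<open>P\<close> such that \<open>P \<Sigma> P\<^sup>T = 1\<close>. With \<open>a = P l\<close> and
  \<open>v = P \<mu>\<^sub>\<nu>\<close> the statistic becomes \<open>(n - 1) a\<^sup>T W\<^sup>-\<^sup>1 y\<close> with \<open>y = v + z / sqrt n\<close>, where \<open>z\<close> is standard
  normal and \<open>W\<close> is the Gram matrix of an independent \<open>p \<times> (n - 1)\<close> standard normal matrix. Removing
  the rows of that matrix one by one with Householder reflections shows that \<open>a\<^sup>T W\<^sup>-\<^sup>1 y\<close> has the law of
  \<open>(a \<bullet> y - sqrt (|a|\<^sup>2 |y|\<^sup>2 - (a \<bullet> y)\<^sup>2) s / sqrt \<zeta>) / \<xi>\<close> with independent \<open>s\<close>, \<open>\<zeta>\<close>, \<open>\<xi>\<close> that are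
  standard normal, chi-squared with \<open>n - p + 1\<close> and chi-squared with \<open>n - p\<close> degrees of freedom.
  After centring and scaling, this is \<open>\<alpha> g + \<beta> z\<^sub>1 + \<gamma> s\<close> with \<open>\<alpha>\<^sup>2 + \<beta>\<^sup>2 + \<gamma>\<^sup>2 = 1\<close>, where \<open>g\<close> is the
  normalised \<open>\<xi>\<close> and \<open>z\<^sub>1 = a \<bullet> z / |a|\<close>, up to an error that is small with high probability,
  uniformly in \<open>a\<close> and \<open>v\<close>. Hence the conditional characteristic functions converge uniformly, their
  average over \<open>\<nu>\<close> converges as well, and Levy's continuity theorem applies.
\<close>

section \<open>Inverse matrices and Householder reflections\<close>

text \<open>The obstacle is uniformity. The vector \<open>\<nu>\<close> can be arbitrarily large, so
  after conditioning v is an arbitrary vector of growing dimension. It enters the estimates only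
  through \<theta> and V = |v|^2, tied by Cauchy-Schwarz, \<open>\<theta>\<^sup>2 \<le> V\<close>,
  and the scaling sqrt (1 + \<theta>^2 + V) dominates every coefficient in which they occur. With
  \<kappa> = 1 - c, the squares of the limiting coefficients are 2 \<theta>^2 (from 1/\<xi>),
  \<kappa> (from the mean along a) and V - \<theta>^2 + 1 - \<kappa> (from the part of y orthogonal
  to a), each over 1 + \<theta>^2 + V; this is why they add up to one. The degrees of freedom come
  from the reflections: removing a row also uses up one column, so the excess of columns over rows
  is kept until a matrix with 2 rows and n - p + 1 columns is left. The default value of
  \<open>inv_mat\<close> at singular matrices is compatible with all congruences used, so the
  algebraic identities hold at every sample point. Rotation invariance and whitening are derived
  from translation invariance of Lebesgue measure on finite products, because the dimension is a
  variable.\<close>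

lemma smult_smult_mat: "a \<cdot>\<^sub>m (b \<cdot>\<^sub>m A) = (a * b :: 'a :: semigroup_mult) \<cdot>\<^sub>m A"
  by (rule eq_matI) (auto simp: mult.assoc)

text \<open>Replaces the elimination behind \<open>mat_inverse\<close> by a rational formula in the
  entries, from which measurability can be read off. For a singular matrix the convention inverse 0
  = 0 reproduces the default value zero.\<close>

lemma inv_mat_eq_adj_mat:
  assumes A: "A \<in> carrier_mat n n"
  shows "inv_mat A = inverse (Determinant.det A) \<cdot>\<^sub>m adj_mat A"
proof (cases "mat_inverse A")
  case None
  have "Determinant.det A = 0"
    using mat_inverse(1)[OF A None, of undefined] det_non_zero_imp_unit[OF A, of undefined] by blast
  then show ?thesis
    using A None adj_mat(1)[OF A] by (intro eq_matI) (auto simp: inv_mat_def)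
next
  case (Some C)
  have C: "A * C = 1\<^sub>m n" "C * A = 1\<^sub>m n" "C \<in> carrier_mat n n"
    using mat_inverse(2)[OF A Some] by auto
  have d: "Determinant.det A * Determinant.det C = 1"
    using det_mult[OF A C(3)] C(1) by simp
  have "Determinant.det A \<cdot>\<^sub>m C = (adj_mat A * A) * C"
    using adj_mat[OF A] C by (simp add: mult_smult_assoc_mat[of _ n n])
  also have "\<dots> = adj_mat A * (A * C)" by (rule assoc_mult_mat[OF adj_mat(1)[OF A] A C(3)])
  also have "\<dots> = adj_mat A" using adj_mat(1)[OF A] C by simp
  finally have "adj_mat A = Determinant.det A \<cdot>\<^sub>m C" by simp
  moreover have "inverse (Determinant.det A) * Determinant.det A = 1"
    using d by (metis left_inverse mult_zero_left zero_neq_one)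
  ultimately have "inverse (Determinant.det A) \<cdot>\<^sub>m adj_mat A = C"
    by (intro eq_matI) (auto simp: mult.assoc[symmetric])
  then show ?thesis using Some by (simp add: inv_mat_def)
qed

lemma inv_mat_carrier [simp]: "A \<in> carrier_mat n n \<Longrightarrow> inv_mat A \<in> carrier_mat n n"
  using inv_mat_eq_adj_mat adj_mat(1) by (metis smult_carrier_mat)

lemma inv_mat_unique:
  assumes A: "A \<in> carrier_mat n n" and C: "C \<in> carrier_mat n n" and AC: "A * C = 1\<^sub>m n"
  shows "inv_mat A = C"
proof -
  have CA: "C * A = 1\<^sub>m n" using mat_mult_left_right_inverse[OF A C AC] .
  have d: "Determinant.det A \<noteq> 0" using det_mult[OF A C] AC by auto
  have "inv_mat A = inv_mat A * (A * C)" using inv_mat_carrier[OF A] AC by simp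
  also have "\<dots> = inv_mat A * A * C" using assoc_mult_mat[OF inv_mat_carrier[OF A] A C] by simp
  also have "inv_mat A * A = 1\<^sub>m n"
    using inv_mat_eq_adj_mat[OF A] adj_mat[OF A] A d
    by (simp add: mult_smult_assoc_mat[OF adj_mat(1)[OF A] A] smult_smult_mat)
       (intro eq_matI, auto)
  finally show ?thesis using C by simp
qed

lemma inv_mat_singular:
  assumes "A \<in> carrier_mat n n" and "Determinant.det A = 0"
  shows "inv_mat A = 0\<^sub>m n n"
  using inv_mat_eq_adj_mat[OF assms(1)] adj_mat(1)[OF assms(1)] assms(2) by (intro eq_matI) auto

lemma inv_mat_right:
  assumes A: "A \<in> carrier_mat n n" and d: "Determinant.det A \<noteq> 0"
  shows "A * inv_mat A = 1\<^sub>m n"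
  using adj_mat[OF A] A d
  by (simp add: inv_mat_eq_adj_mat[OF A] mult_smult_distrib[OF A adj_mat(1)[OF A]] smult_smult_mat)
     (intro eq_matI, auto)

text \<open>Congruence by an invertible P preserves singularity, and if A is singular both sides are
  the zero matrix. Covering that case makes the later identities hold everywhere, without discarding
  the null set of singular Gram matrices.\<close>

lemma inv_mat_congruence:
  assumes A: "A \<in> carrier_mat n n" and P: "P \<in> carrier_mat n n" and d: "Determinant.det P \<noteq> 0"
  shows "inv_mat A = transpose_mat P * inv_mat (P * A * transpose_mat P) * P"
proof (cases "Determinant.det A = 0")
  case True
  have "Determinant.det (P * A * transpose_mat P) = 0"
    using True A P by (simp add: det_mult[of _ n])
  then show ?thesis
    using inv_mat_singular[of "P * A * transpose_mat P" n] inv_mat_singular[OF A True] A P by simp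
next
  case False
  let ?C = "P * A * transpose_mat P"
  have C: "?C \<in> carrier_mat n n" and PT: "transpose_mat P \<in> carrier_mat n n" using A P by auto
  have "Determinant.det ?C \<noteq> 0"
    using False d A P by (simp add: det_mult[of _ n] det_transpose)
  from inv_mat_right[OF C this] have CI: "?C * inv_mat ?C = 1\<^sub>m n" .
  have I: "inv_mat ?C \<in> carrier_mat n n" using C by simp
  let ?D = "A * (transpose_mat P * inv_mat ?C)"
  have D: "?D \<in> carrier_mat n n" using A PT I by auto
  have "P * ?D = 1\<^sub>m n"
    using CI A P PT I by (simp add: assoc_mult_mat[of _ n n _ n _ n])
  then have "?D * P = 1\<^sub>m n" using mat_mult_left_right_inverse[OF P D] by simp
  then have "A * (transpose_mat P * inv_mat ?C * P) = 1\<^sub>m n"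
    using A P PT I by (simp add: assoc_mult_mat[of _ n n _ n _ n])
  then show ?thesis
    using inv_mat_unique[OF A] P PT I by simp
qed

lemma scalar_prod_mult_mat_vec_transpose:
  fixes H :: "'a :: comm_semiring_0 mat"
  assumes "H \<in> carrier_mat n m" and "x \<in> carrier_vec m" and "y \<in> carrier_vec n"
  shows "(H *\<^sub>v x) \<bullet> y = x \<bullet> (transpose_mat H *\<^sub>v y)"
proof -
  have "(H *\<^sub>v x) \<bullet> y = y \<bullet> (H *\<^sub>v x)"
    by (rule comm_scalar_prod[of _ n]) (use assms in auto)
  also have "\<dots> = (transpose_mat H *\<^sub>v y) \<bullet> x" by (rule transpose_vec_mult_scalar[OF assms, symmetric])
  also have "\<dots> = x \<bullet> (transpose_mat H *\<^sub>v y)"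
    by (rule comm_scalar_prod[of _ m]) (use assms in auto)
  finally show ?thesis .
qed

lemma scalar_prod_inv_mat_congruence:
  assumes A: "A \<in> carrier_mat n n" and P: "P \<in> carrier_mat n n" and d: "Determinant.det P \<noteq> 0"
    and x: "x \<in> carrier_vec n" and y: "y \<in> carrier_vec n"
  shows "x \<bullet> (inv_mat A *\<^sub>v y) =
    (P *\<^sub>v x) \<bullet> (inv_mat (P * A * transpose_mat P) *\<^sub>v (P *\<^sub>v y))"
proof -
  let ?C = "inv_mat (P * A * transpose_mat P)"
  have C: "?C \<in> carrier_mat n n" using A P by simp
  have PT: "transpose_mat P \<in> carrier_mat n n" using P by simp
  have "inv_mat A *\<^sub>v y = transpose_mat P *\<^sub>v (?C *\<^sub>v (P *\<^sub>v y))"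
    unfolding inv_mat_congruence[OF A P d]
    using C P PT y by (simp add: assoc_mult_mat_vec[of _ n n _ n])
  then show ?thesis
    using scalar_prod_mult_mat_vec_transpose[OF P x, of "?C *\<^sub>v (P *\<^sub>v y)"] C P y by simp
qed

lemma inv_mat_smult:
  assumes A: "A \<in> carrier_mat n n" and c: "c \<noteq> 0"
  shows "inv_mat (c \<cdot>\<^sub>m A) = inverse c \<cdot>\<^sub>m inv_mat A"
proof (cases "Determinant.det A = 0")
  case True
  then show ?thesis
    using inv_mat_singular[of "c \<cdot>\<^sub>m A" n] inv_mat_singular[OF A True] A
    by simp
next
  case False
  have "(c \<cdot>\<^sub>m A) * (inverse c \<cdot>\<^sub>m inv_mat A) = 1\<^sub>m n"
    using inv_mat_right[OF A False] A c inv_mat_carrier[OF A]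
    by (simp add: mult_smult_assoc_mat[of _ n n _ n] mult_smult_distrib[of _ n n _ n] smult_smult_mat)
       (intro eq_matI, auto)
  then show ?thesis using inv_mat_unique[of "c \<cdot>\<^sub>m A" n] A by simp
qed

lemma inv_mat_one [simp]: "inv_mat (1\<^sub>m n) = 1\<^sub>m n"
  by (rule inv_mat_unique) auto

text \<open>The reflection in the hyperplane orthogonal to x - y. Equality of norms makes x + y
  orthogonal to x - y, so the component of x along x - y is (x - y) / 2 and reflecting x subtracts x
  - y. The last clause is needed to compose two reflections without spoiling the effect of the
  first.\<close>

lemma householder_exists:
  fixes x y :: "real Matrix.vec"
  assumes x: "x \<in> carrier_vec n" and y: "y \<in> carrier_vec n" and xy: "x \<bullet> x = y \<bullet> y"
  shows "\<exists>H \<in> carrier_mat n n. transpose_mat H = H \<and> H * H = 1\<^sub>m n \<and> H *\<^sub>v x = y \<and>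
    (\<forall>w \<in> carrier_vec n. w \<bullet> (x - y) = 0 \<longrightarrow> H *\<^sub>v w = w)"
proof -
  define v where "v = x - y"
  \<comment> \<open>If x = y then v = 0 and division by zero gives k = 0, so H is the identity;
    \<open>kv\<close> holds in both cases.\<close>
  define k where "k = 2 / (v \<bullet> v)"
  define H where "H = Matrix.mat n n (\<lambda>(i, j). (if i = j then 1 else 0) - k * v $ i * v $ j)"
  have v: "v \<in> carrier_vec n" and dv: "dim_vec v = n" using x y by (auto simp: v_def)
  have vv: "v \<bullet> v = (\<Sum>i<n. v $ i * v $ i)" by (simp add: scalar_prod_def dv lessThan_atLeast0)
  have kv: "k * (v \<bullet> v) * v $ i = 2 * v $ i" if "i < n" for i
  proof (cases "v \<bullet> v = 0")
    case True
    then have "v $ i = 0" using that unfolding vv by (simp add: sum_nonneg_eq_0_iff)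
    then show ?thesis by simp
  qed (simp add: k_def)
  have H: "H \<in> carrier_mat n n" by (simp add: H_def)
  have Hw: "(H *\<^sub>v w) $ i = w $ i - k * (v \<bullet> w) * v $ i" if w: "w \<in> carrier_vec n" and i: "i < n" for w i
  proof -
    have "(H *\<^sub>v w) $ i = (\<Sum>j<n. ((if i = j then 1 else 0) - k * v $ i * v $ j) * w $ j)"
      using w i by (simp add: H_def scalar_prod_def lessThan_atLeast0)
    also have "\<dots> = (\<Sum>j<n. (if j = i then w $ j else 0)) - (\<Sum>j<n. k * v $ i * (v $ j * w $ j))"
      unfolding sum_subtractf[symmetric] by (intro sum.cong) (auto simp: algebra_simps)
    also have "\<dots> = w $ i - k * v $ i * (v \<bullet> w)"
      using w i by (simp add: sum_distrib_left scalar_prod_def lessThan_atLeast0)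
    finally show ?thesis by (simp add: ac_simps)
  qed
  have "transpose_mat H = H" by (rule eq_matI) (auto simp: H_def)
  moreover have "H * H = 1\<^sub>m n"
  proof (rule eq_matI)
    fix i j assume "i < dim_row (1\<^sub>m n :: real mat)" "j < dim_col (1\<^sub>m n :: real mat)"
    then have ij: "i < n" "j < n" by auto
    have cj: "Matrix.col H j \<in> carrier_vec n" using ij H by auto
    have cji: "Matrix.col H j $ m = (if m = j then 1 else 0) - k * v $ m * v $ j" if "m < n" for m
      using that ij by (simp add: H_def)
    have vc: "v \<bullet> Matrix.col H j = v $ j - k * (v \<bullet> v) * v $ j"
    proof -
      have "v \<bullet> Matrix.col H j = (\<Sum>m<n. v $ m * ((if m = j then 1 else 0) - k * v $ m * v $ j))"
        unfolding scalar_prod_def using cj H cji by (intro sum.cong) auto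
      also have "\<dots> = (\<Sum>m<n. (if m = j then v $ m else 0)) - (\<Sum>m<n. k * v $ j * (v $ m * v $ m))"
        unfolding sum_subtractf[symmetric] by (intro sum.cong) (auto simp: algebra_simps)
      finally show ?thesis using ij by (simp add: vv sum_distrib_left sum_distrib_right ac_simps)
    qed
    have "(H * H) $$ (i, j) = (H *\<^sub>v Matrix.col H j) $ i"
      using H ij by simp
    also have "\<dots> = 1\<^sub>m n $$ (i, j)"
      unfolding Hw[OF cj ij(1)] vc kv[OF ij(2)] cji[OF ij(1)] using ij by simp
    finally show "(H * H) $$ (i, j) = 1\<^sub>m n $$ (i, j)" .
  qed (use H in auto)
  moreover have "H *\<^sub>v x = y"
  proof (rule eq_vecI)
    fix i assume "i < dim_vec y"
    then have i: "i < n" using y by simp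
    have "x \<bullet> y = y \<bullet> x" by (rule comm_scalar_prod[OF x y])
    then have vx: "v \<bullet> x = (v \<bullet> v) / 2"
      using xy x y by (simp add: v_def minus_scalar_prod_distrib[of _ n] scalar_prod_minus_distrib[of _ n])
    then have kvx: "k * (v \<bullet> x) * v $ i = v $ i"
      unfolding vx using kv[OF i] by simp
    have "v $ i = x $ i - y $ i" using i x y by (simp add: v_def)
    then show "(H *\<^sub>v x) $ i = y $ i" unfolding Hw[OF x i] kvx by simp
  qed (use H y in auto)
  moreover have "H *\<^sub>v w = w" if w: "w \<in> carrier_vec n" and wv: "w \<bullet> (x - y) = 0" for w
  proof (rule eq_vecI)
    fix i assume "i < dim_vec w"
    moreover have "v \<bullet> w = 0" using wv comm_scalar_prod[OF w v] by (simp add: v_def)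
    ultimately show "(H *\<^sub>v w) $ i = w $ i" using Hw[OF w] w by simp
  qed (use H w in auto)
  ultimately show ?thesis using H by blast
qed

section \<open>Inverse Gram matrices of a matrix bordered by one row and one column\<close>

lemma inv_mat_block_one:
  assumes V: "V \<in> carrier_mat p p" and d: "Determinant.det V \<noteq> 0"
  shows "inv_mat (four_block_mat V (0\<^sub>m p 1) (0\<^sub>m 1 p) (1\<^sub>m 1)) =
    four_block_mat (inv_mat V) (0\<^sub>m p 1) (0\<^sub>m 1 p) (1\<^sub>m 1)"
proof (rule inv_mat_unique[where n = "p + 1"])
  have I: "inv_mat V \<in> carrier_mat p p" using V by simp
  show "four_block_mat V (0\<^sub>m p 1) (0\<^sub>m 1 p) (1\<^sub>m 1) *
      four_block_mat (inv_mat V) (0\<^sub>m p 1) (0\<^sub>m 1 p) (1\<^sub>m 1) = 1\<^sub>m (p + 1)"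
    using V I inv_mat_right[OF V d]
    by (subst mult_four_block_mat[of _ p p _ 1 _ 1 _ _ p _ 1])
       (auto simp: left_mult_zero_mat[of _ p p] right_mult_zero_mat[of _ p p])
qed (rule four_block_carrier_mat; use V in simp)+

text \<open>The row operation P is the inverse of the block matrix with rows (1, S) and (0, r); it
  turns Z into the block diagonal matrix of A and 1. Conjugating the block diagonal inverse back
  with P shows that the upper left block sees neither S nor r, while the last column is linear in S.
  If A A^T is singular, so is Z Z^T, and all entries in question are zero.\<close>

lemma inv_gram_bordered:
  fixes A S :: "real Matrix.mat"
  assumes A: "A \<in> carrier_mat p N" and S: "S \<in> carrier_mat p 1" and r: "r \<noteq> 0"
  defines "Z \<equiv> four_block_mat A S (0\<^sub>m 1 N) (r \<cdot>\<^sub>m 1\<^sub>m 1)"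
  shows "i < p \<Longrightarrow> j < p \<Longrightarrow>
      inv_mat (Z * transpose_mat Z) $$ (i, j) = inv_mat (A * transpose_mat A) $$ (i, j)" (is "_ \<Longrightarrow> _ \<Longrightarrow> ?T1")
    and "i < p \<Longrightarrow> inv_mat (Z * transpose_mat Z) $$ (i, p) =
      - (\<Sum>k<p. inv_mat (A * transpose_mat A) $$ (i, k) * S $$ (k, 0)) / r" (is "_ \<Longrightarrow> ?T2")
proof -
  define V where "V = A * transpose_mat A"
  define P where "P = four_block_mat (1\<^sub>m p) ((- 1 / r) \<cdot>\<^sub>m S) (0\<^sub>m 1 p) ((1 / r) \<cdot>\<^sub>m 1\<^sub>m 1)"
  define E where "E = four_block_mat V (0\<^sub>m p 1) (0\<^sub>m 1 p) (1\<^sub>m 1)"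
  have V: "V \<in> carrier_mat p p" using A by (simp add: V_def)
  have Z: "Z \<in> carrier_mat (p + 1) (N + 1)"
    unfolding Z_def by (rule four_block_carrier_mat[OF A]) simp
  have P: "P \<in> carrier_mat (p + 1) (p + 1)"
    unfolding P_def by (rule four_block_carrier_mat) simp_all
  have E: "E \<in> carrier_mat (p + 1) (p + 1)"
    unfolding E_def by (rule four_block_carrier_mat[OF V]) simp
  have dP: "Determinant.det P \<noteq> 0"
    unfolding P_def using S r by (subst det_four_block_mat_lower_left_zero[of _ p _ 1]) (auto simp: det_smult)
  have PZ: "P * Z = four_block_mat A (0\<^sub>m p 1) (0\<^sub>m 1 N) (1\<^sub>m 1)"
    unfolding P_def Z_def using A S r
    by (subst mult_four_block_mat[of _ p p _ 1 _ 1 _ _ N _ 1])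
       (auto intro!: cong_four_block_mat eq_matI simp: mult_smult_distrib[of _ p 1 _ 1])
  have "P * (Z * transpose_mat Z) * transpose_mat P = (P * Z) * transpose_mat (P * Z)"
    using P Z by (simp add: transpose_mult[of _ "p+1" "p+1" _ "N+1"]
      assoc_mult_mat[of _ "p+1" "p+1" _ "N+1" _ "p+1"] assoc_mult_mat[of _ "p+1" "N+1" _ "p+1" _ "p+1"]
      assoc_mult_mat[of _ "p+1" "p+1" _ "p+1" _ "p+1"])
  also have "\<dots> = E"
    unfolding PZ E_def V_def using A
    by (subst transpose_four_block_mat[of _ p N _ 1 _ 1], simp_all)
       (subst mult_four_block_mat[of _ p N _ 1 _ 1 _ _ p _ 1], auto)
  finally have PE: "P * (Z * transpose_mat Z) * transpose_mat P = E" .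
  have inv: "inv_mat (Z * transpose_mat Z) = transpose_mat P * inv_mat E * P"
    using inv_mat_congruence[OF _ P dP, of "Z * transpose_mat Z"] Z PE by simp
  have block: "transpose_mat P * inv_mat E * P = four_block_mat (inv_mat V) (inv_mat V * ((- 1 / r) \<cdot>\<^sub>m S))
      (transpose_mat ((- 1 / r) \<cdot>\<^sub>m S) * inv_mat V)
      (transpose_mat ((- 1 / r) \<cdot>\<^sub>m S) * inv_mat V * ((- 1 / r) \<cdot>\<^sub>m S) +
        transpose_mat ((1 / r) \<cdot>\<^sub>m 1\<^sub>m 1) * ((1 / r) \<cdot>\<^sub>m 1\<^sub>m 1))" if "Determinant.det V \<noteq> 0"
  proof -
    have I: "inv_mat V \<in> carrier_mat p p" using V by simp
    have "transpose_mat ((- 1 / r) \<cdot>\<^sub>m S) * inv_mat V \<in> carrier_mat 1 p" using I S by auto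
    then have z: "transpose_mat ((- 1 / r) \<cdot>\<^sub>m S) * inv_mat V + 0\<^sub>m 1 p = transpose_mat ((- 1 / r) \<cdot>\<^sub>m S) * inv_mat V"
      by simp
    show ?thesis
      unfolding E_def inv_mat_block_one[OF V that] P_def using I S z
      by (subst transpose_four_block_mat[of _ p p _ 1 _ 1], simp_all)
         (subst mult_four_block_mat[of _ p p _ 1 _ 1 _ _ p _ 1], simp_all,
          subst mult_four_block_mat[of _ p p _ 1 _ 1 _ _ p _ 1], auto)
  qed
  show "?T1" if "i < p" "j < p"
  proof (cases "Determinant.det V = 0")
    case True
    have "Determinant.det E = 0"
      unfolding E_def using V True by (subst det_four_block_mat_lower_left_zero[of _ p _ 1]) auto
    then show ?thesis
      using that inv inv_mat_singular[OF E] inv_mat_singular[OF V True] P by (simp add: V_def)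
  next
    case False
    have I: "inv_mat V \<in> carrier_mat p p" using V by simp
    show ?thesis
      unfolding inv block[OF False] V_def[symmetric] using that I S
      by (subst index_mat_four_block) auto
  qed
  show "?T2" if "i < p"
  proof (cases "Determinant.det V = 0")
    case True
    have "Determinant.det E = 0"
      unfolding E_def using V True by (subst det_four_block_mat_lower_left_zero[of _ p _ 1]) auto
    then show ?thesis
      using that inv inv_mat_singular[OF E] inv_mat_singular[OF V True] P by (simp add: V_def)
  next
    case False
    have I: "inv_mat V \<in> carrier_mat p p" using V by simp
    have "(transpose_mat P * inv_mat E * P) $$ (i, p) = (inv_mat V * ((- 1 / r) \<cdot>\<^sub>m S)) $$ (i, 0)"
      unfolding block[OF False] using that I S by (subst index_mat_four_block) auto
    also have "\<dots> = - (\<Sum>k<p. inv_mat V $$ (i, k) * S $$ (k, 0)) / r"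
      using that I S
      by (simp add: scalar_prod_def lessThan_atLeast0 sum_divide_distrib sum_negf[symmetric])
    finally show ?thesis using inv by (simp add: V_def)
  qed
qed

section \<open>Standard normal families and linear maps\<close>

text \<open>With arbitrary index sets, a matrix, one of its rows and one of its columns are families
  of the same kind, and splitting a matrix is splitting an index set into disjoint parts.\<close>

definition gauss :: "'i set \<Rightarrow> ('i \<Rightarrow> real) measure" where
  "gauss K = Pi\<^sub>M K (\<lambda>_. std_normal_distribution)"

interpretation std_normal: prob_space std_normal_distribution
  by (rule prob_space_normal_density) simp

interpretation std_normal_prod: product_sigma_finite "\<lambda>_. std_normal_distribution"
  by unfold_locales

interpretation lborel_prod: product_sigma_finite "\<lambda>_. lborel :: real measure"
  by unfold_locales

lemma sets_gauss [measurable_cong]: "sets (gauss K) = sets (Pi\<^sub>M K (\<lambda>_. borel))"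
  unfolding gauss_def by (rule sets_PiM_cong) auto

lemma space_gauss: "space (gauss K) = K \<rightarrow>\<^sub>E UNIV"
  by (simp add: gauss_def space_PiM)

lemma sets_lborel_prod: "sets (Pi\<^sub>M K (\<lambda>_. lborel)) = sets (Pi\<^sub>M K (\<lambda>_. borel :: real measure))"
  by (rule sets_PiM_cong) auto

lemma prob_space_gauss: "prob_space (gauss K)"
  unfolding gauss_def by (rule prob_space_PiM) unfold_locales

text \<open>Passing to Lebesgue measure makes translation invariance available, which the Gaussian
  product lacks.\<close>

lemma gauss_eq_density:
  assumes K: "finite K"
  shows "gauss K = density (Pi\<^sub>M K (\<lambda>_. lborel)) (\<lambda>x. \<Prod>i\<in>K. ennreal (std_normal_density (x i)))"
  unfolding gauss_def
proof (rule std_normal_prod.PiM_eqI[OF K, symmetric])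
  show "sets (density (Pi\<^sub>M K (\<lambda>_. lborel)) (\<lambda>x. \<Prod>i\<in>K. ennreal (std_normal_density (x i)))) =
      sets (Pi\<^sub>M K (\<lambda>_. std_normal_distribution))"
    by (simp add: sets_lborel_prod sets_gauss[unfolded gauss_def])
  fix A :: "'a \<Rightarrow> real set" assume A: "\<And>i. i \<in> K \<Longrightarrow> A i \<in> sets std_normal_distribution"
  then have B: "\<And>i. i \<in> K \<Longrightarrow> A i \<in> sets lborel" by simp
  have "emeasure (density (Pi\<^sub>M K (\<lambda>_. lborel)) (\<lambda>x. \<Prod>i\<in>K. ennreal (std_normal_density (x i)))) (Pi\<^sub>E K A)
      = (\<integral>\<^sup>+x. (\<Prod>i\<in>K. ennreal (std_normal_density (x i))) * indicator (Pi\<^sub>E K A) x \<partial>Pi\<^sub>M K (\<lambda>_. lborel))"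
    using K B by (intro emeasure_density) (auto intro!: sets_PiM_I_finite)
  also have "\<dots> = (\<integral>\<^sup>+x. (\<Prod>i\<in>K. ennreal (std_normal_density (x i)) * indicator (A i) (x i)) \<partial>Pi\<^sub>M K (\<lambda>_. lborel))"
  proof (rule nn_integral_cong)
    fix x assume x: "x \<in> space (Pi\<^sub>M K (\<lambda>_. lborel :: real measure))"
    have "indicator (Pi\<^sub>E K A) x = (\<Prod>i\<in>K. indicator (A i) (x i) :: ennreal)"
      using x K by (auto simp: indicator_def space_PiM PiE_iff prod_zero_iff)
    then show "(\<Prod>i\<in>K. ennreal (std_normal_density (x i))) * indicator (Pi\<^sub>E K A) x =
        (\<Prod>i\<in>K. ennreal (std_normal_density (x i)) * indicator (A i) (x i))"
      by (simp add: prod.distrib)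
  qed
  also have "\<dots> = (\<Prod>i\<in>K. \<integral>\<^sup>+y. ennreal (std_normal_density y) * indicator (A i) y \<partial>lborel)"
    using K B by (intro lborel_prod.product_nn_integral_prod) auto
  also have "\<dots> = (\<Prod>i\<in>K. emeasure std_normal_distribution (A i))"
    using B by (intro prod.cong refl, subst emeasure_density) auto
  finally show "emeasure (density (Pi\<^sub>M K (\<lambda>_. lborel)) (\<lambda>x. \<Prod>i\<in>K. ennreal (std_normal_density (x i)))) (Pi\<^sub>E K A)
     = (\<Prod>i\<in>K. emeasure std_normal_distribution (A i))" .
qed

lemma nn_integral_gauss_density:
  assumes K: "finite K"
  shows "(\<integral>\<^sup>+x. (\<Prod>i\<in>K. ennreal (std_normal_density (x i))) \<partial>Pi\<^sub>M K (\<lambda>_. lborel)) = 1"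
proof -
  let ?L = "Pi\<^sub>M K (\<lambda>_. lborel :: real measure)"
  let ?d = "\<lambda>x. \<Prod>i\<in>K. ennreal (std_normal_density (x i))"
  have "emeasure (density ?L ?d) (space ?L) = 1"
    using prob_space.emeasure_space_1[OF prob_space_gauss[of K]] unfolding gauss_eq_density[OF K] by simp
  moreover have "emeasure (density ?L ?d) (space ?L) = (\<integral>\<^sup>+x. ?d x * indicator (space ?L) x \<partial>?L)"
    by (rule emeasure_density) auto
  moreover have "\<dots> = (\<integral>\<^sup>+x. ?d x \<partial>?L)" by (intro nn_integral_cong) auto
  ultimately show ?thesis by simp
qed

lemma prod_std_normal_density:
  "finite K \<Longrightarrow> (\<Prod>i\<in>K. ennreal (std_normal_density (x i))) =
    ennreal ((1 / sqrt (2 * pi)) ^ card K * exp (- (\<Sum>i\<in>K. (x i)\<^sup>2) / 2))"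
  by (simp add: prod_ennreal std_normal_density_def prod.distrib exp_sum[symmetric]
      sum_negf sum_divide_distrib prod_dividef power_divide)

text \<open>Translations (s = 1) and point reflections (s = -1) are the only substitutions that the
  Haar uniqueness argument below makes; coordinatewise each preserves one-dimensional Lebesgue
  measure.\<close>

lemma distr_lborel_prod_affine:
  fixes c :: "'i \<Rightarrow> real"
  assumes K: "finite K" and s: "\<bar>s\<bar> = 1"
  shows "distr (Pi\<^sub>M K (\<lambda>_. lborel)) (Pi\<^sub>M K (\<lambda>_. lborel)) (\<lambda>x. \<lambda>i\<in>K. c i + s * x i) = Pi\<^sub>M K (\<lambda>_. lborel)"
proof (rule lborel_prod.PiM_eqI[OF K])
  fix A :: "'i \<Rightarrow> real set" assume A: "\<And>i. i \<in> K \<Longrightarrow> A i \<in> sets lborel"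
  have one: "emeasure lborel ((\<lambda>y. c i + s * y) -` A i) = emeasure lborel (A i)" if "i \<in> K" for i
  proof -
    have "lborel = density (distr lborel borel (\<lambda>x. c i + s * x)) (\<lambda>_. ennreal \<bar>s\<bar>)"
      by (rule lborel_real_affine) (use s in auto)
    also have "\<dots> = distr lborel borel (\<lambda>x. c i + s * x)"
      using s by (simp add: density_1)
    finally have "emeasure lborel (A i) = emeasure (distr lborel borel (\<lambda>x. c i + s * x)) (A i)"
      by simp
    then show ?thesis using A[OF that] by (simp add: emeasure_distr)
  qed
  have vi: "(\<lambda>y. c i + s * y) -` A i \<in> sets lborel" if "i \<in> K" for i
    using measurable_sets[of "\<lambda>y. c i + s * y" lborel borel "A i"] A[OF that] by simp
  have "emeasure (distr (Pi\<^sub>M K (\<lambda>_. lborel)) (Pi\<^sub>M K (\<lambda>_. lborel)) (\<lambda>x. \<lambda>i\<in>K. c i + s * x i)) (Pi\<^sub>E K A)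
    = emeasure (Pi\<^sub>M K (\<lambda>_. lborel)) ((\<lambda>x. \<lambda>i\<in>K. c i + s * x i) -` (Pi\<^sub>E K A) \<inter> space (Pi\<^sub>M K (\<lambda>_. lborel)))"
    using A K by (intro emeasure_distr) (auto intro!: sets_PiM_I_finite measurable_restrict)
  also have "(\<lambda>x. \<lambda>i\<in>K. c i + s * x i) -` (Pi\<^sub>E K A) \<inter> space (Pi\<^sub>M K (\<lambda>_. lborel)) =
      Pi\<^sub>E K (\<lambda>i. (\<lambda>y. c i + s * y) -` A i)"
    by (auto simp: space_PiM PiE_iff)
  also have "emeasure (Pi\<^sub>M K (\<lambda>_. lborel)) \<dots> = (\<Prod>i\<in>K. emeasure lborel ((\<lambda>y. c i + s * y) -` A i))"
    using K vi by (intro lborel_prod.emeasure_PiM) auto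
  also have "\<dots> = (\<Prod>i\<in>K. emeasure lborel (A i))" using one by simp
  finally show "emeasure (distr (Pi\<^sub>M K (\<lambda>_. lborel)) (Pi\<^sub>M K (\<lambda>_. lborel)) (\<lambda>x. \<lambda>i\<in>K. c i + s * x i)) (Pi\<^sub>E K A)
      = (\<Prod>i\<in>K. emeasure lborel (A i))" .
qed simp

lemma nn_integral_lborel_prod_affine:
  assumes K: "finite K" and s: "\<bar>s\<bar> = 1" and f: "f \<in> borel_measurable (Pi\<^sub>M K (\<lambda>_. lborel))"
  shows "(\<integral>\<^sup>+x. f (\<lambda>i\<in>K. c i + s * x i) \<partial>Pi\<^sub>M K (\<lambda>_. lborel)) = (\<integral>\<^sup>+x. f x \<partial>Pi\<^sub>M K (\<lambda>_. lborel :: real measure))"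
  by (subst (2) distr_lborel_prod_affine[OF K s, symmetric, of c], subst nn_integral_distr)
     (use f in \<open>auto intro!: measurable_restrict\<close>)

text \<open>
  Uniqueness of Haar measure for the pullback of Lebesgue measure under a linear bijection;
  the determinant is never computed.
\<close>

lemma nn_integral_linear_swap:
  fixes A A' :: "('i \<Rightarrow> real) \<Rightarrow> 'i \<Rightarrow> real"
  defines "L K \<equiv> Pi\<^sub>M K (\<lambda>_. lborel :: real measure)"
  assumes K: "finite K"
    and A [measurable]: "A \<in> L K \<rightarrow>\<^sub>M L K" and A' [measurable]: "A' \<in> L K \<rightarrow>\<^sub>M L K"
    and add: "\<And>x y. x \<in> space (L K) \<Longrightarrow> y \<in> space (L K) \<Longrightarrow>
      A (\<lambda>i\<in>K. x i + y i) = (\<lambda>i\<in>K. A x i + A y i)"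
    and inv: "\<And>x. x \<in> space (L K) \<Longrightarrow> A (A' x) = x"
    and f [measurable]: "f \<in> borel_measurable (L K)" and g [measurable]: "g \<in> borel_measurable (L K)"
  shows "(\<integral>\<^sup>+x. f x \<partial>L K) * (\<integral>\<^sup>+y. g (A y) \<partial>L K) = (\<integral>\<^sup>+x. g x \<partial>L K) * (\<integral>\<^sup>+y. f (A y) \<partial>L K)"
proof -
  interpret sigma_finite_measure "L K" unfolding L_def by (rule lborel_prod.sigma_finite[OF K])
  interpret P: pair_sigma_finite "L K" "L K" ..
  have sp: "space (L K) = K \<rightarrow>\<^sub>E UNIV" by (simp add: L_def space_PiM)
  have Asp: "A x \<in> space (L K)" if "x \<in> space (L K)" for x using measurable_space[OF A that] .
  have A'sp: "A' x \<in> space (L K)" if "x \<in> space (L K)" for x using measurable_space[OF A' that] .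
  have comp: "(\<lambda>x. x i) \<in> borel_measurable (L K)" if "i \<in> K" for i
    using that unfolding L_def by measurable
  have M1 [measurable]: "(\<lambda>z. \<lambda>i\<in>K. F z i) \<in> N \<rightarrow>\<^sub>M L K"
    if "\<And>i. i \<in> K \<Longrightarrow> (\<lambda>z. F z i) \<in> borel_measurable N" for F and N :: "'b measure"
    unfolding L_def using that by (intro measurable_restrict) auto
  have Ai: "(\<lambda>z. A (G z) i) \<in> borel_measurable N" if "i \<in> K" "G \<in> N \<rightarrow>\<^sub>M L K" for i G and N :: "'b measure"
    using measurable_compose[OF measurable_compose[OF that(2) A] comp[OF that(1)]] .
  have Gi: "(\<lambda>z. G z i) \<in> borel_measurable N" if "i \<in> K" "G \<in> N \<rightarrow>\<^sub>M L K" for i G and N :: "'b measure"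
    using measurable_compose[OF that(2) comp[OF that(1)]] .
  have shift: "(\<integral>\<^sup>+x. h (\<lambda>i\<in>K. c i + s * x i) \<partial>L K) = (\<integral>\<^sup>+x. h x \<partial>L K)"
    if "h \<in> borel_measurable (L K)" "\<bar>s\<bar> = 1" for h c s
    using nn_integral_lborel_prod_affine[OF K that(2)] that(1) unfolding L_def by blast
  have mS [measurable]: "(\<lambda>(x, y). \<lambda>i\<in>K. A y i + x i) \<in> (L K \<Otimes>\<^sub>M L K) \<rightarrow>\<^sub>M L K"
    "(\<lambda>(x, y). \<lambda>i\<in>K. x i - A y i) \<in> (L K \<Otimes>\<^sub>M L K) \<rightarrow>\<^sub>M L K"
    unfolding split_beta' by (intro M1 borel_measurable_add borel_measurable_diff Ai Gi; simp)+
  \<comment> \<open>Three substitutions exchange the roles of f and g. Shifting y by A' x turns A y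
    into A y + x; after exchanging the integrals, x is shifted by A y; finally y is replaced by A' x
    - y, which turns x - A y into A y.\<close>
  have "(\<integral>\<^sup>+x. f x \<partial>L K) * (\<integral>\<^sup>+y. g (A y) \<partial>L K) = (\<integral>\<^sup>+x. f x * (\<integral>\<^sup>+y. g (A y) \<partial>L K) \<partial>L K)"
    by (simp add: nn_integral_multc)
  also have "\<dots> = (\<integral>\<^sup>+x. (\<integral>\<^sup>+y. f x * g (\<lambda>i\<in>K. A y i + x i) \<partial>L K) \<partial>L K)"
  proof (intro nn_integral_cong)
    fix x assume x: "x \<in> space (L K)"
    have "(\<integral>\<^sup>+y. g (A y) \<partial>L K) = (\<integral>\<^sup>+y. g (A (\<lambda>i\<in>K. A' x i + 1 * y i)) \<partial>L K)"
      by (rule shift[symmetric]) auto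
    also have "\<dots> = (\<integral>\<^sup>+y. g (\<lambda>i\<in>K. A y i + x i) \<partial>L K)"
      by (intro nn_integral_cong) (simp add: add A'sp x inv add.commute)
    finally show "f x * (\<integral>\<^sup>+y. g (A y) \<partial>L K) = (\<integral>\<^sup>+y. f x * g (\<lambda>i\<in>K. A y i + x i) \<partial>L K)"
      using x by (subst nn_integral_cmult) (auto intro!: measurable_compose[OF _ g] M1 borel_measurable_add Ai)
  qed
  also have "\<dots> = (\<integral>\<^sup>+y. (\<integral>\<^sup>+x. f x * g (\<lambda>i\<in>K. A y i + x i) \<partial>L K) \<partial>L K)"
    using measurable_compose[OF mS(1) g] by (intro P.Fubini'[symmetric]) (simp add: split_beta')
  also have "\<dots> = (\<integral>\<^sup>+y. (\<integral>\<^sup>+x. f (\<lambda>i\<in>K. x i - A y i) * g x \<partial>L K) \<partial>L K)"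
  proof (rule nn_integral_cong)
    fix y assume y: "y \<in> space (L K)"
    have "(\<integral>\<^sup>+x. f (\<lambda>i\<in>K. x i - A y i) * g x \<partial>L K) =
      (\<integral>\<^sup>+x. f (\<lambda>i\<in>K. (\<lambda>i\<in>K. A y i + 1 * x i) i - A y i) * g (\<lambda>i\<in>K. A y i + 1 * x i) \<partial>L K)"
      by (rule shift[symmetric])
         (use y in \<open>auto intro!: borel_measurable_times_ennreal g measurable_compose[OF _ f] M1
            borel_measurable_diff comp\<close>)
    also have "\<dots> = (\<integral>\<^sup>+x. f x * g (\<lambda>i\<in>K. A y i + x i) \<partial>L K)"
      by (intro nn_integral_cong arg_cong2[where f = times] arg_cong[where f = f])
         (auto simp: sp PiE_iff extensional_def fun_eq_iff)
    finally show "(\<integral>\<^sup>+x. f x * g (\<lambda>i\<in>K. A y i + x i) \<partial>L K) = (\<integral>\<^sup>+x. f (\<lambda>i\<in>K. x i - A y i) * g x \<partial>L K)" ..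
  qed
  also have "\<dots> = (\<integral>\<^sup>+x. (\<integral>\<^sup>+y. f (\<lambda>i\<in>K. x i - A y i) * g x \<partial>L K) \<partial>L K)"
    using measurable_compose[OF mS(2) f] by (intro P.Fubini') (simp add: split_beta')
  also have "\<dots> = (\<integral>\<^sup>+x. g x * (\<integral>\<^sup>+y. f (A y) \<partial>L K) \<partial>L K)"
  proof (intro nn_integral_cong)
    fix x assume x: "x \<in> space (L K)"
    have eq: "(\<lambda>i\<in>K. x i - A y i) = A (\<lambda>i\<in>K. A' x i + (-1) * y i)" if y: "y \<in> space (L K)" for y
    proof -
      let ?u = "\<lambda>i\<in>K. A' x i + (-1) * y i"
      have u: "?u \<in> space (L K)" by (simp add: sp)
      have "A (\<lambda>i\<in>K. ?u i + y i) = (\<lambda>i\<in>K. A ?u i + A y i)" by (rule add[OF u y])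
      moreover have "(\<lambda>i\<in>K. ?u i + y i) = A' x" using A'sp[OF x] by (auto simp: sp PiE_iff extensional_def)
      ultimately have xe: "x = (\<lambda>i\<in>K. A ?u i + A y i)" using inv[OF x] by simp
      have "x i = A ?u i + A y i" if "i \<in> K" for i by (subst xe) (simp add: that)
      moreover have "A ?u \<in> space (L K)" using Asp[OF u] .
      ultimately show ?thesis by (auto simp: sp PiE_iff extensional_def fun_eq_iff)
    qed
    have "(\<integral>\<^sup>+y. f (\<lambda>i\<in>K. x i - A y i) * g x \<partial>L K) = (\<integral>\<^sup>+y. f (A (\<lambda>i\<in>K. A' x i + (-1) * y i)) * g x \<partial>L K)"
      by (intro nn_integral_cong) (simp only: eq)
    also have "\<dots> = (\<integral>\<^sup>+y. f (A y) * g x \<partial>L K)"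
      by (rule shift) auto
    also have "\<dots> = g x * (\<integral>\<^sup>+y. f (A y) \<partial>L K)"
      by (subst mult.commute) (simp add: nn_integral_cmult)
    finally show "(\<integral>\<^sup>+y. f (\<lambda>i\<in>K. x i - A y i) * g x \<partial>L K) = g x * (\<integral>\<^sup>+y. f (A y) \<partial>L K)" .
  qed
  also have "\<dots> = (\<integral>\<^sup>+x. g x \<partial>L K) * (\<integral>\<^sup>+y. f (A y) \<partial>L K)"
    by (simp add: nn_integral_multc)
  finally show ?thesis .
qed

text \<open>The factor by which A scales Lebesgue measure can be read off from any one test
  function. The Gaussian density is invariant under the isometry A and has integral one, so the
  factor is one, and the same density cancels on both sides.\<close>

lemma gauss_linear_isometry:
  fixes A A' :: "('i \<Rightarrow> real) \<Rightarrow> 'i \<Rightarrow> real"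
  assumes K: "finite K"
    and A: "A \<in> gauss K \<rightarrow>\<^sub>M gauss K" and A': "A' \<in> gauss K \<rightarrow>\<^sub>M gauss K"
    and add: "\<And>x y. x \<in> space (gauss K) \<Longrightarrow> y \<in> space (gauss K) \<Longrightarrow>
      A (\<lambda>i\<in>K. x i + y i) = (\<lambda>i\<in>K. A x i + A y i)"
    and inv: "\<And>x. x \<in> space (gauss K) \<Longrightarrow> A (A' x) = x"
    and iso: "\<And>x. x \<in> space (gauss K) \<Longrightarrow> (\<Sum>i\<in>K. (A x i)\<^sup>2) = (\<Sum>i\<in>K. (x i)\<^sup>2)"
    and h: "h \<in> borel_measurable (gauss K)"
  shows "(\<integral>\<^sup>+x. h (A x) \<partial>gauss K) = (\<integral>\<^sup>+x. h x \<partial>gauss K)"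
proof -
  define L where "L = (\<lambda>K. Pi\<^sub>M (K :: 'i set) (\<lambda>_. lborel :: real measure))"
  define \<phi> where "\<phi> = (\<lambda>x. \<Prod>i\<in>K. ennreal (std_normal_density (x i)))"
  have st: "sets (gauss K) = sets (L K)" by (simp add: L_def sets_gauss sets_lborel_prod)
  have sp: "space (gauss K) = space (L K)" by (rule sets_eq_imp_space_eq[OF st])
  have A2: "A \<in> L K \<rightarrow>\<^sub>M L K" "A' \<in> L K \<rightarrow>\<^sub>M L K" "h \<in> borel_measurable (L K)"
    using A A' unfolding measurable_cong_sets[OF st st]
    by (simp_all add: h[unfolded measurable_cong_sets[OF st refl]])
  have \<phi>: "\<phi> \<in> borel_measurable (L K)" unfolding \<phi>_def L_def by measurable
  have g: "gauss K = density (L K) \<phi>" unfolding L_def \<phi>_def by (rule gauss_eq_density[OF K])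
  have \<phi>A: "\<phi> (A x) = \<phi> x" if "x \<in> space (L K)" for x
    using that iso[of x] sp K by (simp add: \<phi>_def prod_std_normal_density)
  have one: "(\<integral>\<^sup>+x. \<phi> x \<partial>L K) = 1"
    unfolding \<phi>_def L_def by (rule nn_integral_gauss_density[OF K])
  have "(\<integral>\<^sup>+x. h (A x) \<partial>gauss K) = (\<integral>\<^sup>+x. \<phi> x * h (A x) \<partial>L K)"
    unfolding g using \<phi> A2 measurable_compose[OF A2(1) A2(3)] by (simp add: nn_integral_density)
  also have "\<dots> = (\<integral>\<^sup>+x. \<phi> x \<partial>L K) * (\<integral>\<^sup>+x. \<phi> (A x) * h (A x) \<partial>L K)"
    unfolding one using \<phi>A by (simp cong: nn_integral_cong)
  also have "\<dots> = (\<integral>\<^sup>+x. \<phi> x * h x \<partial>L K) * (\<integral>\<^sup>+x. \<phi> (A x) \<partial>L K)"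
    unfolding L_def
    by (rule nn_integral_linear_swap[of K A A' \<phi> "\<lambda>x. \<phi> x * h x"])
       (use A2 \<phi> add inv K sp in \<open>auto simp: L_def\<close>)
  also have "\<dots> = (\<integral>\<^sup>+x. \<phi> x * h x \<partial>L K)"
    using \<phi>A one by (simp cong: nn_integral_cong)
  also have "\<dots> = (\<integral>\<^sup>+x. h x \<partial>gauss K)"
    unfolding g using \<phi> A2 by (simp add: nn_integral_density)
  finally show ?thesis .
qed

text \<open>The density of Y is a multiple of the Gaussian density evaluated at A (x - b). Its
  constant and the scaling factor of A occur only as a product, and the test function h = 1 shows
  that this product is one, because both laws have total mass one. Hence no determinant has to be
  evaluated.\<close>

lemma whitening:
  fixes A A' :: "('i \<Rightarrow> real) \<Rightarrow> 'i \<Rightarrow> real" and Y :: "'w \<Rightarrow> 'i \<Rightarrow> real"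
  assumes K: "finite K" and M: "prob_space M"
    and A: "A \<in> gauss K \<rightarrow>\<^sub>M gauss K" and A': "A' \<in> gauss K \<rightarrow>\<^sub>M gauss K"
    and add: "\<And>x y. x \<in> space (gauss K) \<Longrightarrow> y \<in> space (gauss K) \<Longrightarrow>
      A (\<lambda>i\<in>K. x i + y i) = (\<lambda>i\<in>K. A x i + A y i)"
    and inv: "\<And>x. x \<in> space (gauss K) \<Longrightarrow> A (A' x) = x"
    and Y: "distributed M (Pi\<^sub>M K (\<lambda>_. lborel)) Y (\<lambda>x. ennreal (g x))"
    and g: "\<And>x. x \<in> space (gauss K) \<Longrightarrow> g x = C * exp (- (\<Sum>i\<in>K. (A (\<lambda>i\<in>K. x i - b i) i)\<^sup>2) / 2)"
  shows "distr M (gauss K) (\<lambda>\<omega>. A (\<lambda>i\<in>K. Y \<omega> i - b i)) = gauss K"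
proof -
  define L where "L = (\<lambda>K. Pi\<^sub>M (K :: 'i set) (\<lambda>_. lborel :: real measure))"
  define \<phi> where "\<phi> = (\<lambda>x. \<Prod>i\<in>K. ennreal (std_normal_density (x i)))"
  define c where "c = (1 / sqrt (2 * pi)) ^ card K"
  have c0: "c > 0" by (simp add: c_def)
  have st: "sets (gauss K) = sets (L K)" by (simp add: L_def sets_gauss sets_lborel_prod)
  have sp: "space (gauss K) = space (L K)" by (rule sets_eq_imp_space_eq[OF st])
  have A2 [measurable]: "A \<in> L K \<rightarrow>\<^sub>M L K" "A' \<in> L K \<rightarrow>\<^sub>M L K"
    using A A' unfolding measurable_cong_sets[OF st st] by auto
  have \<phi> [measurable]: "\<phi> \<in> borel_measurable (L K)" unfolding \<phi>_def L_def by measurable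
  have gd: "gauss K = density (L K) \<phi>" unfolding L_def \<phi>_def by (rule gauss_eq_density[OF K])
  have one: "(\<integral>\<^sup>+x. \<phi> x \<partial>L K) = 1"
    unfolding \<phi>_def L_def by (rule nn_integral_gauss_density[OF K])
  have Ym: "Y \<in> M \<rightarrow>\<^sub>M L K" using distributed_measurable[OF Y] by (simp add: L_def)
  have gm: "(\<lambda>x. ennreal (g x)) \<in> borel_measurable (L K)"
    using distributed_borel_measurable[OF Y] by (simp add: L_def)
  have LK: "Pi\<^sub>M K (\<lambda>_. lborel) = L K" by (simp add: L_def)
  define S where "S = (\<lambda>x. \<lambda>i\<in>K. x i - b i)"
  have S [measurable]: "S \<in> L K \<rightarrow>\<^sub>M L K"
    unfolding S_def L_def by measurable
  have gx: "ennreal (g x) = ennreal (C / c) * \<phi> (A (S x))" if "x \<in> space (L K)" for x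
  proof (cases "C \<ge> 0")
    case True
    then show ?thesis
      using g[of x] that c0 K by (simp add: \<phi>_def S_def prod_std_normal_density sp c_def ennreal_mult'[symmetric])
  next
    case False
    then have "C / c \<le> 0" "g x \<le> 0" using g[of x] that c0 sp
      by (auto simp: divide_nonpos_pos mult_nonpos_nonneg)
    then show ?thesis by (simp add: ennreal_neg)
  qed
  have key: "(\<integral>\<^sup>+\<omega>. h (A (S (Y \<omega>))) \<partial>M) =
      (\<integral>\<^sup>+x. h x \<partial>gauss K) * (ennreal (C / c) * (\<integral>\<^sup>+y. \<phi> (A y) \<partial>L K))"
    if h [measurable]: "h \<in> borel_measurable (L K)" for h :: "('i \<Rightarrow> real) \<Rightarrow> ennreal"
  proof -
    have "(\<integral>\<^sup>+\<omega>. h (A (S (Y \<omega>))) \<partial>M) = (\<integral>\<^sup>+x. ennreal (g x) * h (A (S x)) \<partial>L K)"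
      using distributed_nn_integral[OF Y, of "\<lambda>x. h (A (S x))"] unfolding LK by simp
    also have "\<dots> = (\<integral>\<^sup>+x. ennreal (C / c) * (\<phi> (A (S x)) * h (A (S x))) \<partial>L K)"
      by (intro nn_integral_cong) (simp add: gx mult.assoc)
    also have "\<dots> = ennreal (C / c) * (\<integral>\<^sup>+x. \<phi> (A (S x)) * h (A (S x)) \<partial>L K)"
      by (rule nn_integral_cmult) measurable
    also have "(\<integral>\<^sup>+x. \<phi> (A (S x)) * h (A (S x)) \<partial>L K) = (\<integral>\<^sup>+x. \<phi> (A x) * h (A x) \<partial>L K)"
    proof -
      have "(\<integral>\<^sup>+x. \<phi> (A (\<lambda>i\<in>K. - b i + 1 * x i)) * h (A (\<lambda>i\<in>K. - b i + 1 * x i)) \<partial>L K) = (\<integral>\<^sup>+x. \<phi> (A x) * h (A x) \<partial>L K)"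
        unfolding L_def
        by (rule nn_integral_lborel_prod_affine[OF K, of 1 "\<lambda>x. \<phi> (A x) * h (A x)"])
           (simp_all add: LK)
      then show ?thesis by (simp add: S_def)
    qed
    also have "\<dots> = (\<integral>\<^sup>+x. \<phi> x \<partial>L K) * (\<integral>\<^sup>+x. \<phi> (A x) * h (A x) \<partial>L K)" by (simp add: one)
    also have "\<dots> = (\<integral>\<^sup>+x. \<phi> x * h x \<partial>L K) * (\<integral>\<^sup>+x. \<phi> (A x) \<partial>L K)"
      unfolding L_def
      by (rule nn_integral_linear_swap[of K A A' \<phi> "\<lambda>x. \<phi> x * h x"])
         (use A2 \<phi> h add inv K sp in \<open>auto simp: L_def\<close>)
    also have "(\<integral>\<^sup>+x. \<phi> x * h x \<partial>L K) = (\<integral>\<^sup>+x. h x \<partial>gauss K)"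
      unfolding gd using \<phi> h by (simp add: nn_integral_density)
    finally show ?thesis by (simp add: ac_simps)
  qed
  have k1: "ennreal (C / c) * (\<integral>\<^sup>+y. \<phi> (A y) \<partial>L K) = 1"
    using key[of "\<lambda>_. 1"] prob_space.emeasure_space_1[OF M]
      prob_space.emeasure_space_1[OF prob_space_gauss[of K]] by simp
  have m: "(\<lambda>\<omega>. A (S (Y \<omega>))) \<in> M \<rightarrow>\<^sub>M L K" using Ym by measurable
  show ?thesis
  proof (rule measure_eqI)
    fix E assume "E \<in> sets (distr M (gauss K) (\<lambda>\<omega>. A (\<lambda>i\<in>K. Y \<omega> i - b i)))"
    then have E: "E \<in> sets (L K)" by (simp add: st)
    have "emeasure (distr M (gauss K) (\<lambda>\<omega>. A (S (Y \<omega>)))) E = (\<integral>\<^sup>+x. indicator E x \<partial>distr M (gauss K) (\<lambda>\<omega>. A (S (Y \<omega>))))"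
      using E st by simp
    also have "\<dots> = (\<integral>\<^sup>+\<omega>. indicator E (A (S (Y \<omega>))) \<partial>M)"
      using m E st by (subst nn_integral_distr) (auto simp: measurable_cong_sets[OF refl st] intro!: borel_measurable_indicator)
    also have "\<dots> = emeasure (gauss K) E" using key[of "indicator E"] E st by (simp add: k1)
    finally show "emeasure (distr M (gauss K) (\<lambda>\<omega>. A (\<lambda>i\<in>K. Y \<omega> i - b i))) E = emeasure (gauss K) E"
      by (simp add: S_def)
  qed simp
qed

lemma nn_integral_gauss_Un:
  assumes "K \<inter> J = {}" and "finite K" and "finite J" and f: "f \<in> borel_measurable (gauss (K \<union> J))"
  shows "(\<integral>\<^sup>+x. f x \<partial>gauss (K \<union> J)) = (\<integral>\<^sup>+x. (\<integral>\<^sup>+y. f (merge K J (x, y)) \<partial>gauss J) \<partial>gauss K)"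
  using assms unfolding gauss_def by (rule std_normal_prod.product_nn_integral_fold)

section \<open>Standard normal matrices\<close>

definition mat_measurable :: "nat \<Rightarrow> nat \<Rightarrow> 'a measure \<Rightarrow> ('a \<Rightarrow> real Matrix.mat) \<Rightarrow> bool" where
  "mat_measurable n m N A \<longleftrightarrow> (\<forall>x\<in>space N. A x \<in> carrier_mat n m) \<and>
    (\<forall>i<n. \<forall>j<m. (\<lambda>x. A x $$ (i, j)) \<in> borel_measurable N)"

lemma mat_measurable_const: "A \<in> carrier_mat n m \<Longrightarrow> mat_measurable n m N (\<lambda>_. A)"
  by (auto simp: mat_measurable_def)

lemma mat_measurable_mult:
  assumes A: "mat_measurable n m N A" and B: "mat_measurable m k N B"
  shows "mat_measurable n k N (\<lambda>x. A x * B x)"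
  unfolding mat_measurable_def
proof (intro conjI ballI allI impI)
  show "A x * B x \<in> carrier_mat n k" if "x \<in> space N" for x
    using that A B by (auto simp: mat_measurable_def)
  fix i j assume ij: "i < n" "j < k"
  have "(A x * B x) $$ (i, j) = (\<Sum>l<m. A x $$ (i, l) * B x $$ (l, j))" if "x \<in> space N" for x
  proof -
    have "A x \<in> carrier_mat n m" "B x \<in> carrier_mat m k" using that A B by (auto simp: mat_measurable_def)
    then show ?thesis using ij by (simp add: scalar_prod_def lessThan_atLeast0)
  qed
  moreover have "(\<lambda>x. \<Sum>l<m. A x $$ (i, l) * B x $$ (l, j)) \<in> borel_measurable N"
    using A B ij by (intro borel_measurable_sum borel_measurable_times) (auto simp: mat_measurable_def)
  ultimately show "(\<lambda>x. (A x * B x) $$ (i, j)) \<in> borel_measurable N"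
    by (subst measurable_cong[where g = "\<lambda>x. \<Sum>l<m. A x $$ (i, l) * B x $$ (l, j)"]) auto
qed

lemma mat_measurable_transpose:
  assumes A: "mat_measurable n m N A"
  shows "mat_measurable m n N (\<lambda>x. transpose_mat (A x))"
  unfolding mat_measurable_def
proof (intro conjI ballI allI impI)
  show "transpose_mat (A x) \<in> carrier_mat m n" if "x \<in> space N" for x
    using that A by (auto simp: mat_measurable_def)
  fix i j assume ij: "i < m" "j < n"
  have "transpose_mat (A x) $$ (i, j) = A x $$ (j, i)" if "x \<in> space N" for x
    using that A ij by (auto simp: mat_measurable_def)
  then show "(\<lambda>x. transpose_mat (A x) $$ (i, j)) \<in> borel_measurable N"
    using A ij by (subst measurable_cong[where g = "\<lambda>x. A x $$ (j, i)"]) (auto simp: mat_measurable_def)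
qed

lemma mat_measurable_mat:
  "(\<And>i j. i < n \<Longrightarrow> j < m \<Longrightarrow> (\<lambda>x. f x (i, j)) \<in> borel_measurable N) \<Longrightarrow>
    mat_measurable n m N (\<lambda>x. Matrix.mat n m (f x))"
  by (simp add: mat_measurable_def)

lemma mat_measurable_det:
  assumes A: "mat_measurable n n N A"
  shows "(\<lambda>x. Determinant.det (A x)) \<in> borel_measurable N"
proof -
  have "(\<lambda>x. \<Sum>p\<in>{p. p permutes {0..<n}}. signof p * (\<Prod>i=0..<n. A x $$ (i, p i))) \<in> borel_measurable N"
  proof (intro borel_measurable_sum borel_measurable_times borel_measurable_prod borel_measurable_const)
    fix p i assume "p \<in> {p. p permutes {0..<n}}" "i \<in> {0..<n}"
    then have "i < n" "p i < n" using permutes_in_image[of p "{0..<n}" i] by auto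
    then show "(\<lambda>x. A x $$ (i, p i)) \<in> borel_measurable N" using A by (auto simp: mat_measurable_def)
  qed
  moreover have "Determinant.det (A x) = (\<Sum>p\<in>{p. p permutes {0..<n}}. signof p * (\<Prod>i=0..<n. A x $$ (i, p i)))"
    if "x \<in> space N" for x
    by (rule det_def') (use that A in \<open>auto simp: mat_measurable_def\<close>)
  ultimately show ?thesis by (subst measurable_cong) auto
qed

text \<open>By the adjugate formula each entry is a determinant of a minor times the inverse of a
  determinant, which is Borel on the whole space, singular matrices included.\<close>

lemma mat_measurable_inv_mat:
  assumes A: "mat_measurable n n N A"
  shows "mat_measurable n n N (\<lambda>x. inv_mat (A x))"
  unfolding mat_measurable_def
proof (intro conjI ballI allI impI)
  have c: "A x \<in> carrier_mat n n" if "x \<in> space N" for x using that A by (auto simp: mat_measurable_def)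
  then show "inv_mat (A x) \<in> carrier_mat n n" if "x \<in> space N" for x using that by simp
  fix i j assume ij: "i < n" "j < n"
  have del: "mat_measurable (n - 1) (n - 1) N (\<lambda>x. mat_delete (A x) j i)"
    unfolding mat_measurable_def
  proof (intro conjI ballI allI impI)
    show "mat_delete (A x) j i \<in> carrier_mat (n - 1) (n - 1)" if "x \<in> space N" for x
      using c[OF that] by (simp add: mat_delete_def)
    fix k l assume kl: "k < n - 1" "l < n - 1"
    let ?k = "if k < j then k else Suc k" and ?l = "if l < i then l else Suc l"
    have "mat_delete (A x) j i $$ (k, l) = A x $$ (?k, ?l)" if "x \<in> space N" for x
      using c[OF that] kl by (simp add: mat_delete_def)
    moreover have "(\<lambda>x. A x $$ (?k, ?l)) \<in> borel_measurable N"
    proof -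
      have "?k < n" "?l < n" using kl by auto
      then show ?thesis using A unfolding mat_measurable_def by blast
    qed
    ultimately show "(\<lambda>x. mat_delete (A x) j i $$ (k, l)) \<in> borel_measurable N"
      by (subst measurable_cong) auto
  qed
  have "inv_mat (A x) $$ (i, j) =
      inverse (Determinant.det (A x)) * ((-1) ^ (j + i) * Determinant.det (mat_delete (A x) j i))"
    if "x \<in> space N" for x
    using c[OF that] ij by (simp add: inv_mat_eq_adj_mat adj_mat_def cofactor_def)
  moreover have "(\<lambda>x. inverse (Determinant.det (A x)) * ((-1) ^ (j + i) * Determinant.det (mat_delete (A x) j i)))
      \<in> borel_measurable N"
    using mat_measurable_det[OF A] mat_measurable_det[OF del] by measurable
  ultimately show "(\<lambda>x. inv_mat (A x) $$ (i, j)) \<in> borel_measurable N"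
    by (subst measurable_cong) auto
qed

lemma mat_measurable_gauss:
  "{..<p} \<times> {..<N} \<subseteq> K \<Longrightarrow> mat_measurable p N (gauss K) (\<lambda>z. Matrix.mat p N z)"
  by (rule mat_measurable_mat) (auto simp: measurable_cong_sets[OF sets_gauss refl] intro!: measurable_component_singleton)

text \<open>The square of the Frobenius norm, without the root: it is the sum of squares in the
  exponent of the Gaussian density of a matrix.\<close>

definition frob :: "real Matrix.mat \<Rightarrow> real" where
  "frob A = (\<Sum>i<dim_row A. \<Sum>j<dim_col A. (A $$ (i, j))\<^sup>2)"

lemma frob_transpose: "frob (transpose_mat A) = frob A"
  unfolding frob_def by (simp, subst sum.swap) (auto intro!: sum.cong)

lemma frob_left_orthogonal:
  assumes B: "B \<in> carrier_mat p N" and H: "H \<in> carrier_mat p p" "transpose_mat H * H = 1\<^sub>m p"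
  shows "frob (H * B) = frob B"
proof -
  have fr: "frob D = (\<Sum>j<N. Matrix.col D j \<bullet> Matrix.col D j)" if D: "D \<in> carrier_mat p N" for D
    unfolding frob_def using D
    by (simp, subst sum.swap) (auto intro!: sum.cong simp: scalar_prod_def power2_eq_square lessThan_atLeast0)
  have "Matrix.col (H * B) j \<bullet> Matrix.col (H * B) j = Matrix.col B j \<bullet> Matrix.col B j" if j: "j < N" for j
  proof -
    have c: "Matrix.col B j \<in> carrier_vec p" using B j by auto
    have "Matrix.col (H * B) j = H *\<^sub>v Matrix.col B j"
      using B H j by (intro eq_vecI) auto
    moreover have "transpose_mat H *\<^sub>v (H *\<^sub>v Matrix.col B j) = Matrix.col B j"
      using H c by (simp add: assoc_mult_mat_vec[symmetric, of _ p p _ p])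
    ultimately show ?thesis
      using scalar_prod_mult_mat_vec_transpose[OF H(1) c, of "H *\<^sub>v Matrix.col B j"] H c by simp
  qed
  then show ?thesis using fr[of B] fr[of "H * B"] B H by simp
qed

lemma mat_of_mat_coords: "A \<in> carrier_mat p N \<Longrightarrow> Matrix.mat p N (mat_coords p N A) = A"
  by (rule eq_matI) (auto simp: mat_coords_def)

lemma mat_coords_of_mat: "z \<in> space (gauss ({..<p} \<times> {..<N})) \<Longrightarrow> mat_coords p N (Matrix.mat p N z) = z"
  by (auto simp: mat_coords_def space_gauss PiE_iff extensional_def fun_eq_iff)

lemma sum_mat_coords:
  assumes "A \<in> carrier_mat p N"
  shows "(\<Sum>i\<in>{..<p} \<times> {..<N}. (mat_coords p N A i)\<^sup>2) = frob A"
  using assms unfolding frob_def by (auto simp: sum.cartesian_product mat_coords_def intro!: sum.cong)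

lemma mat_coords_measurable:
  assumes "mat_measurable p N M A"
  shows "(\<lambda>x. mat_coords p N (A x)) \<in> M \<rightarrow>\<^sub>M gauss ({..<p} \<times> {..<N})"
  unfolding mat_coords_def measurable_cong_sets[OF refl sets_gauss]
  using assms by (intro measurable_restrict) (auto simp: mat_measurable_def)

text \<open>Multiplication by orthogonal matrices from both sides preserves the sum of the squares
  of the entries, and multiplication by their transposes undoes it. The invariance is stated for
  integrals of a functional \<Psi> instead of laws, because the matrix type carries no
  sigma-algebra.\<close>

lemma gauss_mat_orthogonal:
  assumes L: "L \<in> carrier_mat p p" "transpose_mat L * L = 1\<^sub>m p"
    and R: "R \<in> carrier_mat N N" "transpose_mat R * R = 1\<^sub>m N"
    and h: "(\<lambda>z. \<Psi> (Matrix.mat p N z)) \<in> borel_measurable (gauss ({..<p} \<times> {..<N}))"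
  shows "(\<integral>\<^sup>+z. \<Psi> (L * Matrix.mat p N z * R) \<partial>gauss ({..<p} \<times> {..<N})) =
    (\<integral>\<^sup>+z. \<Psi> (Matrix.mat p N z) \<partial>gauss ({..<p} \<times> {..<N}))"
proof -
  let ?K = "{..<p} \<times> {..<N}"
  define A where "A = (\<lambda>z. mat_coords p N (L * Matrix.mat p N z * R))"
  define A' where "A' = (\<lambda>z. mat_coords p N (transpose_mat L * Matrix.mat p N z * transpose_mat R))"
  have LT: "L * transpose_mat L = 1\<^sub>m p" "transpose_mat L \<in> carrier_mat p p"
    using mat_mult_left_right_inverse[of "transpose_mat L" p L] L by auto
  have RT: "R * transpose_mat R = 1\<^sub>m N" "transpose_mat R \<in> carrier_mat N N"
    using mat_mult_left_right_inverse[of "transpose_mat R" N R] R by auto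
  have c: "L * Matrix.mat p N z * R \<in> carrier_mat p N" for z
    by (rule mult_carrier_mat[OF mult_carrier_mat[OF L(1) mat_carrier] R(1)])
  have "(\<integral>\<^sup>+z. \<Psi> (Matrix.mat p N (A z)) \<partial>gauss ?K) = (\<integral>\<^sup>+z. \<Psi> (Matrix.mat p N z) \<partial>gauss ?K)"
  proof (rule gauss_linear_isometry[where A' = A'])
    show "A \<in> gauss ?K \<rightarrow>\<^sub>M gauss ?K" "A' \<in> gauss ?K \<rightarrow>\<^sub>M gauss ?K"
      unfolding A_def A'_def using L R
      by (intro mat_coords_measurable mat_measurable_mult[of p N _ _ N] mat_measurable_mult[of p p _ _ N]
          mat_measurable_const mat_measurable_gauss; simp)+
    fix x y :: "nat \<times> nat \<Rightarrow> real"
    assume x: "x \<in> space (gauss ?K)"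
    show "A (\<lambda>i\<in>?K. x i + y i) = (\<lambda>i\<in>?K. A x i + A y i)"
    proof -
      have "Matrix.mat p N (\<lambda>i\<in>?K. x i + y i) = Matrix.mat p N x + Matrix.mat p N y"
        by (rule eq_matI) auto
      then have "L * Matrix.mat p N (\<lambda>i\<in>?K. x i + y i) * R = L * Matrix.mat p N x * R + L * Matrix.mat p N y * R"
        using L R by (simp add: mult_add_distrib_mat[of _ p p _ N] add_mult_distrib_mat[of _ p N _ _ N])
      then show ?thesis using L R unfolding A_def by (auto simp: mat_coords_def fun_eq_iff)
    qed
    have c': "transpose_mat L * Matrix.mat p N x * transpose_mat R \<in> carrier_mat p N"
      by (rule mult_carrier_mat[OF mult_carrier_mat[OF LT(2) mat_carrier] RT(2)])
    have "L * (transpose_mat L * Matrix.mat p N x * transpose_mat R) =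
        L * (transpose_mat L * Matrix.mat p N x) * transpose_mat R"
      by (rule assoc_mult_mat[symmetric, of _ p p _ N _ N]) (use L LT RT in auto)
    also have "L * (transpose_mat L * Matrix.mat p N x) = Matrix.mat p N x"
      using assoc_mult_mat[OF L(1) LT(2), of "Matrix.mat p N x" N] LT(1) by simp
    finally have "L * (transpose_mat L * Matrix.mat p N x * transpose_mat R) * R = Matrix.mat p N x"
      using assoc_mult_mat[of "Matrix.mat p N x" p N "transpose_mat R" N R N] R by simp
    then show "A (A' x) = x"
      unfolding A_def A'_def using mat_of_mat_coords[OF c'] mat_coords_of_mat[OF x] by simp
    have "frob (L * Matrix.mat p N x * R) = frob (transpose_mat R * transpose_mat (L * Matrix.mat p N x))"
      using L R by (subst frob_transpose[symmetric]) (simp add: transpose_mult[of _ p N _ N])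
    also have "\<dots> = frob (transpose_mat (L * Matrix.mat p N x))"
      using L R RT by (intro frob_left_orthogonal[of _ N p]) auto
    also have "\<dots> = frob (Matrix.mat p N x)"
      unfolding frob_transpose using L by (intro frob_left_orthogonal[of _ p N]) auto
    finally have "frob (L * Matrix.mat p N x * R) = frob (Matrix.mat p N x)" .
    then show "(\<Sum>i\<in>?K. (A x i)\<^sup>2) = (\<Sum>i\<in>?K. (x i)\<^sup>2)"
      using sum_mat_coords[OF c, of x] sum_mat_coords[of "Matrix.mat p N x" p N] mat_coords_of_mat[OF x]
      by (simp add: A_def)
  qed (use h in auto)
  then show ?thesis using c by (simp add: A_def mat_of_mat_coords)
qed

section \<open>Inverse Gram matrices of standard normal matrices\<close>

definition row_append :: "nat \<Rightarrow> nat \<Rightarrow> real Matrix.mat \<Rightarrow> real Matrix.vec \<Rightarrow> real Matrix.mat" where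
  "row_append p N A r = Matrix.mat (Suc p) N (\<lambda>(i, j). if i < p then A $$ (i, j) else r $ j)"

lemma row_append_mult:
  assumes A: "A \<in> carrier_mat p N" and r: "r \<in> carrier_vec N" and H: "H \<in> carrier_mat N N"
    and sym: "transpose_mat H = H"
  shows "row_append p N A r * H = row_append p N (A * H) (H *\<^sub>v r)"
proof (rule eq_matI)
  fix i j assume "i < dim_row (row_append p N (A * H) (H *\<^sub>v r))" "j < dim_col (row_append p N (A * H) (H *\<^sub>v r))"
  then have ij: "i < Suc p" "j < N" by (auto simp: row_append_def)
  have hs: "H $$ (k, j) = H $$ (j, k)" if "k < N" for k
    using H ij that sym index_transpose_mat(1)[of k H j] by auto
  show "(row_append p N A r * H) $$ (i, j) = row_append p N (A * H) (H *\<^sub>v r) $$ (i, j)"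
    using A r H ij hs
    by (cases "i < p") (auto simp: row_append_def scalar_prod_def mult.commute intro!: sum.cong)
qed (use H in \<open>auto simp: row_append_def\<close>)

text \<open>Once the last row is \<rho> times the last basis vector, the matrix has the shape to
  which \<open>inv_gram_bordered\<close> applies.\<close>

lemma row_append_block:
  "row_append p (Suc N) (Matrix.mat p (Suc N) z) (Matrix.vec (Suc N) (\<lambda>j. if j = N then \<rho> else 0)) =
   four_block_mat (Matrix.mat p N z) (Matrix.mat p 1 (\<lambda>(i, _). z (i, N))) (0\<^sub>m 1 N) (\<rho> \<cdot>\<^sub>m 1\<^sub>m 1)"
  by (rule eq_matI) (auto simp: row_append_def less_Suc_eq)

lemma gram_right_orthogonal:
  fixes Z H :: "real Matrix.mat"
  assumes Z: "Z \<in> carrier_mat p N" and H: "H \<in> carrier_mat N N" "H * transpose_mat H = 1\<^sub>m N"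
  shows "(Z * H) * transpose_mat (Z * H) = Z * transpose_mat Z"
proof -
  have "(Z * H) * transpose_mat (Z * H) = (Z * H) * (transpose_mat H * transpose_mat Z)"
    by (simp only: transpose_mult[OF Z H(1)])
  also have "\<dots> = Z * (H * (transpose_mat H * transpose_mat Z))"
    by (rule assoc_mult_mat[OF Z H(1)]) (use Z H(1) in auto)
  also have "H * (transpose_mat H * transpose_mat Z) = H * transpose_mat H * transpose_mat Z"
    by (rule assoc_mult_mat[symmetric, OF H(1)]) (use Z H(1) in auto)
  finally show ?thesis using Z H(2) by simp
qed

text \<open>
  Conditioning on the last row \<open>r\<close> and applying the reflection that maps \<open>r\<close> to \<open>|r| e\<^sub>N\<close>
  to all rows leaves the remaining rows standard normal.
\<close>

lemma gram_remove_row: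
  fixes \<Phi> :: "real Matrix.mat \<Rightarrow> ennreal" and p N :: nat
  assumes \<Phi>: "\<And>(M :: (nat \<times> nat \<Rightarrow> real) measure) A. mat_measurable (Suc p) (Suc p) M A \<Longrightarrow> (\<lambda>x. \<Phi> (A x)) \<in> borel_measurable M"
  defines "Q \<rho> z \<equiv> four_block_mat (Matrix.mat p N z) (Matrix.mat p 1 (\<lambda>(i, _). z (i, N))) (0\<^sub>m 1 N) (\<rho> \<cdot>\<^sub>m 1\<^sub>m 1)"
  shows "(\<integral>\<^sup>+z. \<Phi> (Matrix.mat (Suc p) (Suc N) z * transpose_mat (Matrix.mat (Suc p) (Suc N) z))
       \<partial>gauss ({..<Suc p} \<times> {..<Suc N})) =
    (\<integral>\<^sup>+r. (\<integral>\<^sup>+z. \<Phi> (Q (sqrt (\<Sum>j<Suc N. (r (p, j))\<^sup>2)) z * transpose_mat (Q (sqrt (\<Sum>j<Suc N. (r (p, j))\<^sup>2)) z))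
       \<partial>gauss ({..<p} \<times> {..<Suc N})) \<partial>gauss ({p} \<times> {..<Suc N}))"
proof -
  let ?K = "{p} \<times> {..<Suc N}" and ?J = "{..<p} \<times> {..<Suc N}"
  let ?G = "\<lambda>Z :: real Matrix.mat. Z * transpose_mat Z"
  have KJ: "{..<Suc p} \<times> {..<Suc N} = ?K \<union> ?J" by auto
  have gm: "mat_measurable n n M (\<lambda>x. ?G (Z x))" if "mat_measurable n m M Z" for n m and M :: "(nat \<times> nat \<Rightarrow> real) measure" and Z
    by (rule mat_measurable_mult[OF that mat_measurable_transpose[OF that]])
  have "(\<integral>\<^sup>+z. \<Phi> (?G (Matrix.mat (Suc p) (Suc N) z)) \<partial>gauss ({..<Suc p} \<times> {..<Suc N})) =
      (\<integral>\<^sup>+r. (\<integral>\<^sup>+z. \<Phi> (?G (Matrix.mat (Suc p) (Suc N) (merge ?K ?J (r, z)))) \<partial>gauss ?J) \<partial>gauss ?K)"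
    unfolding KJ
    by (rule nn_integral_gauss_Un) (auto intro!: \<Phi> gm mat_measurable_gauss)
  also have "\<dots> = (\<integral>\<^sup>+r. (\<integral>\<^sup>+z. \<Phi> (?G (Q (sqrt (\<Sum>j<Suc N. (r (p, j))\<^sup>2)) z)) \<partial>gauss ?J) \<partial>gauss ?K)"
  proof (rule nn_integral_cong)
    fix r :: "nat \<times> nat \<Rightarrow> real"
    define R where "R = Matrix.vec (Suc N) (\<lambda>j. r (p, j))"
    define \<rho> where "\<rho> = sqrt (\<Sum>j<Suc N. (r (p, j))\<^sup>2)"
    define E where "E = Matrix.vec (Suc N) (\<lambda>j. if j = N then \<rho> else 0)"
    have RE: "R \<in> carrier_vec (Suc N)" "E \<in> carrier_vec (Suc N)" by (auto simp: R_def E_def)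
    have "R \<bullet> R = (\<Sum>j<Suc N. (r (p, j))\<^sup>2)"
      by (simp add: R_def scalar_prod_def power2_eq_square lessThan_atLeast0 del: sum.lessThan_Suc sum.op_ivl_Suc)
    moreover have "E \<bullet> E = \<rho>\<^sup>2"
      by (simp add: E_def scalar_prod_def power2_eq_square)
    moreover have "\<rho>\<^sup>2 = (\<Sum>j<Suc N. (r (p, j))\<^sup>2)"
      unfolding \<rho>_def by (rule real_sqrt_pow2) (rule sum_nonneg, simp)
    ultimately obtain H where H: "H \<in> carrier_mat (Suc N) (Suc N)" "transpose_mat H = H" "H * H = 1\<^sub>m (Suc N)"
      "H *\<^sub>v R = E"
      using householder_exists[OF RE] by metis
    define F where "F = (\<lambda>A. \<Phi> (?G (row_append p (Suc N) A E)))"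
    have "Matrix.mat (Suc p) (Suc N) (merge ?K ?J (r, z)) = row_append p (Suc N) (Matrix.mat p (Suc N) z) R" for z
      by (rule eq_matI) (auto simp: row_append_def R_def merge_def less_Suc_eq)
    moreover have "?G (row_append p (Suc N) (Matrix.mat p (Suc N) z) R) =
        ?G (row_append p (Suc N) (Matrix.mat p (Suc N) z * H) E)" for z
    proof -
      have "?G (row_append p (Suc N) (Matrix.mat p (Suc N) z) R) = ?G (row_append p (Suc N) (Matrix.mat p (Suc N) z) R * H)"
        by (rule gram_right_orthogonal[symmetric, of _ "Suc p"]) (use H in \<open>auto simp: row_append_def\<close>)
      also have "row_append p (Suc N) (Matrix.mat p (Suc N) z) R * H = row_append p (Suc N) (Matrix.mat p (Suc N) z * H) E"
        using row_append_mult[of "Matrix.mat p (Suc N) z" p "Suc N" R H] H RE by simp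
      finally show ?thesis .
    qed
    ultimately have "(\<integral>\<^sup>+z. \<Phi> (?G (Matrix.mat (Suc p) (Suc N) (merge ?K ?J (r, z)))) \<partial>gauss ?J) =
        (\<integral>\<^sup>+z. F (1\<^sub>m p * Matrix.mat p (Suc N) z * H) \<partial>gauss ?J)"
      by (simp add: F_def)
    \<comment> \<open>H depends on r only, which the outer integral holds fixed, so on the
      independent rows z it acts as a constant orthogonal matrix.\<close>
    also have "\<dots> = (\<integral>\<^sup>+z. F (Matrix.mat p (Suc N) z) \<partial>gauss ?J)"
    proof (rule gauss_mat_orthogonal)
      have "mat_measurable (Suc p) (Suc N) (gauss ?J) (\<lambda>z. row_append p (Suc N) (Matrix.mat p (Suc N) z) E)"
        unfolding row_append_def
      proof (rule mat_measurable_mat)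
        fix i j assume ij: "i < Suc p" "j < Suc N"
        show "(\<lambda>x. case (i, j) of (i, j) \<Rightarrow> if i < p then Matrix.mat p (Suc N) x $$ (i, j) else E $ j) \<in> borel_measurable (gauss ?J)"
          using mat_measurable_gauss[of p "Suc N" ?J] ij unfolding mat_measurable_def by (cases "i < p") auto
      qed
      then show "(\<lambda>z. F (Matrix.mat p (Suc N) z)) \<in> borel_measurable (gauss ?J)"
        unfolding F_def by (intro \<Phi> gm)
    qed (use H in auto)
    finally show "(\<integral>\<^sup>+z. \<Phi> (?G (Matrix.mat (Suc p) (Suc N) (merge ?K ?J (r, z)))) \<partial>gauss ?J) =
        (\<integral>\<^sup>+z. \<Phi> (?G (Q (sqrt (\<Sum>j<Suc N. (r (p, j))\<^sup>2)) z)) \<partial>gauss ?J)"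
      unfolding F_def E_def row_append_block Q_def \<rho>_def .
  qed
  finally show ?thesis .
qed

text \<open>These two entries determine \<open>a \<bullet> (inv_mat V *\<^sub>v y)\<close> once a is
  a multiple of the first basis vector and y lies in the span of the first two.\<close>

definition inv_gram2 :: "real Matrix.mat \<Rightarrow> real \<times> real" where
  "inv_gram2 V = (inv_mat V $$ (0, 0), inv_mat V $$ (0, 1))"

lemma inv_gram2_measurable:
  assumes "mat_measurable p p M A" and "2 \<le> p" and h: "h \<in> borel_measurable borel"
  shows "(\<lambda>x. h (inv_gram2 (A x))) \<in> borel_measurable M"
proof -
  have "(\<lambda>x. inv_gram2 (A x)) \<in> borel_measurable M"
    using mat_measurable_inv_mat[OF assms(1)] assms(2) unfolding inv_gram2_def
    by (intro borel_measurable_Pair) (auto simp: mat_measurable_def)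
  then show ?thesis by (rule measurable_compose[OF _ h])
qed

lemma nn_integral_gauss_restrict:
  assumes K: "finite K" and J: "J \<subseteq> K" and f: "f \<in> borel_measurable (gauss J)"
  shows "(\<integral>\<^sup>+z. f (restrict z J) \<partial>gauss K) = (\<integral>\<^sup>+z. f z \<partial>gauss J)"
proof -
  have fin: "finite J" "finite (K - J)" using K J finite_subset by auto
  have U: "K = J \<union> (K - J)" using J by auto
  have "(\<integral>\<^sup>+z. f (restrict z J) \<partial>gauss K) =
      (\<integral>\<^sup>+x. (\<integral>\<^sup>+y. f (restrict (merge J (K - J) (x, y)) J) \<partial>gauss (K - J)) \<partial>gauss J)"
    by (subst (1) U, rule nn_integral_gauss_Un)
       (use fin J U in \<open>auto intro!: measurable_compose[OF _ f] simp: gauss_def intro!: measurable_restrict_subset\<close>)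
  also have "\<dots> = (\<integral>\<^sup>+x. (\<integral>\<^sup>+y. f x \<partial>gauss (K - J)) \<partial>gauss J)"
  proof (intro nn_integral_cong arg_cong[where f = f])
    fix x y :: "'a \<Rightarrow> real" assume "x \<in> space (gauss J)"
    then show "restrict (merge J (K - J) (x, y)) J = x"
      by (auto simp: merge_def space_gauss PiE_iff extensional_def fun_eq_iff)
  qed
  also have "\<dots> = (\<integral>\<^sup>+x. f x \<partial>gauss J)"
    by (simp add: prob_space.emeasure_space_1[OF prob_space_gauss])
  finally show ?thesis .
qed

lemma AE_gauss_nonzero:
  assumes "i \<in> K"
  shows "AE x in gauss K. x i \<noteq> 0"
  unfolding gauss_def
proof (rule AE_PiM_component)
  show "AE x in std_normal_distribution. x \<noteq> 0"
    by (subst AE_density) (auto intro: AE_mp[OF AE_lborel_singleton[of 0]])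
qed (use assms in \<open>auto intro: std_normal.prob_space_axioms\<close>)

text \<open>Excludes the zero row, for which the bordered formula would divide by zero.\<close>

lemma AE_gauss_row_norm:
  "AE r in gauss ({p} \<times> {..<Suc N}). sqrt (\<Sum>j<Suc N. (r (p, j))\<^sup>2) \<noteq> 0"
proof -
  have "(p, 0) \<in> {p} \<times> {..<Suc N}" by auto
  then have "AE r in gauss ({p} \<times> {..<Suc N}). r (p, 0) \<noteq> 0" by (rule AE_gauss_nonzero)
  then show ?thesis
  proof eventually_elim
    case (elim r)
    have "0 < (r (p, 0))\<^sup>2" using elim by simp
    also have "\<dots> \<le> (\<Sum>j<Suc N. (r (p, j))\<^sup>2)" by (rule member_le_sum) auto
    finally show ?case by simp
  qed
qed

text \<open>By \<open>inv_gram_bordered\<close> the two entries depend neither on the removed row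
  nor on the last column of the remaining rows. So the numbers of rows and columns drop together and
  their difference is kept. The condition \<open>2 \<le> p\<close> keeps both entries inside the
  upper left block.\<close>

lemma inv_gram2_step:
  fixes h :: "real \<times> real \<Rightarrow> ennreal"
  assumes p: "2 \<le> p" and h: "h \<in> borel_measurable borel"
  shows "(\<integral>\<^sup>+z. h (inv_gram2 (Matrix.mat (Suc p) (Suc N) z * transpose_mat (Matrix.mat (Suc p) (Suc N) z)))
       \<partial>gauss ({..<Suc p} \<times> {..<Suc N})) =
    (\<integral>\<^sup>+z. h (inv_gram2 (Matrix.mat p N z * transpose_mat (Matrix.mat p N z))) \<partial>gauss ({..<p} \<times> {..<N}))"
proof -
  let ?f = "\<lambda>z. h (inv_gram2 (Matrix.mat p N z * transpose_mat (Matrix.mat p N z)))"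
  let ?Q = "\<lambda>r z. four_block_mat (Matrix.mat p N z) (Matrix.mat p 1 (\<lambda>(i, _). z (i, N))) (0\<^sub>m 1 N)
     (sqrt (\<Sum>j<Suc N. (r (p, j))\<^sup>2) \<cdot>\<^sub>m 1\<^sub>m 1)"
  have "(\<integral>\<^sup>+z. h (inv_gram2 (Matrix.mat (Suc p) (Suc N) z * transpose_mat (Matrix.mat (Suc p) (Suc N) z)))
       \<partial>gauss ({..<Suc p} \<times> {..<Suc N})) =
    (\<integral>\<^sup>+r. (\<integral>\<^sup>+z. h (inv_gram2 (?Q r z * transpose_mat (?Q r z))) \<partial>gauss ({..<p} \<times> {..<Suc N})) \<partial>gauss ({p} \<times> {..<Suc N}))"
    by (rule gram_remove_row) (use p in \<open>auto intro: inv_gram2_measurable h\<close>)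
  also have "\<dots> = (\<integral>\<^sup>+r. (\<integral>\<^sup>+z. ?f z \<partial>gauss ({..<p} \<times> {..<N})) \<partial>gauss ({p} \<times> {..<Suc N}))"
  proof (rule nn_integral_cong_AE)
    show "AE r in gauss ({p} \<times> {..<Suc N}). (\<integral>\<^sup>+z. h (inv_gram2 (?Q r z * transpose_mat (?Q r z))) \<partial>gauss ({..<p} \<times> {..<Suc N}))
        = (\<integral>\<^sup>+z. ?f z \<partial>gauss ({..<p} \<times> {..<N}))"
      using AE_gauss_row_norm
    proof eventually_elim
      case (elim r)
      have "inv_gram2 (?Q r z * transpose_mat (?Q r z)) = inv_gram2 (Matrix.mat p N z * transpose_mat (Matrix.mat p N z))" for z
        using p inv_gram_bordered(1)[of "Matrix.mat p N z" p N "Matrix.mat p 1 (\<lambda>(i, _). z (i, N))", OF _ _ elim]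
        unfolding inv_gram2_def by simp
      moreover have "Matrix.mat p N z = Matrix.mat p N (restrict z ({..<p} \<times> {..<N}))" for z :: "nat \<times> nat \<Rightarrow> real"
        by (rule eq_matI) auto
      ultimately have "(\<integral>\<^sup>+z. h (inv_gram2 (?Q r z * transpose_mat (?Q r z))) \<partial>gauss ({..<p} \<times> {..<Suc N})) =
          (\<integral>\<^sup>+z. ?f (restrict z ({..<p} \<times> {..<N})) \<partial>gauss ({..<p} \<times> {..<Suc N}))"
        by simp
      also have "\<dots> = (\<integral>\<^sup>+z. ?f z \<partial>gauss ({..<p} \<times> {..<N}))"
        by (rule nn_integral_gauss_restrict)
           (auto intro!: inv_gram2_measurable[OF _ p h] mat_measurable_mult[of _ N] mat_measurable_transpose mat_measurable_gauss)
      finally show ?case .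
    qed
  qed
  also have "\<dots> = (\<integral>\<^sup>+z. ?f z \<partial>gauss ({..<p} \<times> {..<N}))"
    by (simp add: prob_space.emeasure_space_1[OF prob_space_gauss])
  finally show ?thesis .
qed

lemma inv_gram2_reduce:
  fixes h :: "real \<times> real \<Rightarrow> ennreal"
  assumes h: "h \<in> borel_measurable borel"
  shows "(\<integral>\<^sup>+z. h (inv_gram2 (Matrix.mat (2 + d) (N + d) z * transpose_mat (Matrix.mat (2 + d) (N + d) z)))
       \<partial>gauss ({..<2 + d} \<times> {..<N + d})) =
    (\<integral>\<^sup>+z. h (inv_gram2 (Matrix.mat 2 N z * transpose_mat (Matrix.mat 2 N z))) \<partial>gauss ({..<2} \<times> {..<N}))"
proof (induction d)
  case (Suc d)
  then show ?case using inv_gram2_step[of "2 + d" h "N + d", OF _ h] by simp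
qed simp

lemma inv_mat_single:
  assumes V: "V \<in> carrier_mat 1 1"
  shows "inv_mat V $$ (0, 0) = inverse (V $$ (0, 0))"
proof (cases "V $$ (0, 0) = 0")
  case True
  have "Determinant.det V = 0" using True V by (subst det_single) auto
  then show ?thesis using inv_mat_singular[OF V] True by simp
next
  case False
  have "V * (inverse (V $$ (0, 0)) \<cdot>\<^sub>m 1\<^sub>m 1) = 1\<^sub>m 1"
    using False V by (intro eq_matI) (auto simp: scalar_prod_def)
  then have "inv_mat V = inverse (V $$ (0, 0)) \<cdot>\<^sub>m 1\<^sub>m 1"
    using V by (intro inv_mat_unique) auto
  then show ?thesis by simp
qed

lemma inv_gram_one:
  "inv_mat (Matrix.mat 1 N z * transpose_mat (Matrix.mat 1 N z)) $$ (0, 0) = inverse (\<Sum>j<N. (z (0, j))\<^sup>2)"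
proof -
  let ?V = "Matrix.mat 1 N z * transpose_mat (Matrix.mat 1 N z)"
  have V: "?V \<in> carrier_mat 1 1" by (rule mult_carrier_mat[of _ 1 N]) auto
  have e: "?V $$ (0, 0) = (\<Sum>j<N. (z (0, j))\<^sup>2)"
    by (simp add: scalar_prod_def power2_eq_square lessThan_atLeast0)
  show ?thesis using inv_mat_single[OF V] e by simp
qed

text \<open>The last removal takes away row 1, so index 1 is now the bordered one and the entry (0,
  1) comes from the second part of \<open>inv_gram_bordered\<close>. What remains of the Gram matrix
  is the sum of squares of the first N entries k of row 0; the last entry s of that row enters
  linearly, and the removed row r contributes only its norm.\<close>

lemma inv_gram2_two:
  fixes h :: "real \<times> real \<Rightarrow> ennreal"
  assumes h: "h \<in> borel_measurable borel"
  shows "(\<integral>\<^sup>+z. h (inv_gram2 (Matrix.mat 2 (Suc N) z * transpose_mat (Matrix.mat 2 (Suc N) z)))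
       \<partial>gauss ({..<2} \<times> {..<Suc N})) =
    (\<integral>\<^sup>+r. (\<integral>\<^sup>+k. (\<integral>\<^sup>+s. h (inverse (\<Sum>j<N. (k (0, j))\<^sup>2),
        - (inverse (\<Sum>j<N. (k (0, j))\<^sup>2) * s (0, N)) / sqrt (\<Sum>j<Suc N. (r (1, j))\<^sup>2))
      \<partial>gauss ({0 :: nat} \<times> {N})) \<partial>gauss ({0 :: nat} \<times> {..<N})) \<partial>gauss ({1 :: nat} \<times> {..<Suc N}))"
proof -
  let ?Q = "\<lambda>r z. four_block_mat (Matrix.mat 1 N z) (Matrix.mat 1 1 (\<lambda>(i, _). z (i, N))) (0\<^sub>m 1 N)
     (sqrt (\<Sum>j<Suc N. (r (1, j))\<^sup>2) \<cdot>\<^sub>m 1\<^sub>m 1)"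
  let ?g = "\<lambda>r z. h (inverse (\<Sum>j<N. (z (0, j))\<^sup>2),
        - (inverse (\<Sum>j<N. (z (0, j))\<^sup>2) * z (0, N)) / sqrt (\<Sum>j<Suc N. (r (1, j))\<^sup>2))"
  have two: "Suc 1 = 2" by simp
  have one: "{..<1} = {0 :: nat}" by auto
  have "(\<integral>\<^sup>+z. h (inv_gram2 (Matrix.mat 2 (Suc N) z * transpose_mat (Matrix.mat 2 (Suc N) z)))
       \<partial>gauss ({..<2} \<times> {..<Suc N})) =
    (\<integral>\<^sup>+r. (\<integral>\<^sup>+z. h (inv_gram2 (?Q r z * transpose_mat (?Q r z))) \<partial>gauss ({..<1} \<times> {..<Suc N})) \<partial>gauss ({1 :: nat} \<times> {..<Suc N}))"
    by (rule gram_remove_row[of 1 "\<lambda>V. h (inv_gram2 V)" N, unfolded two]) (auto intro: inv_gram2_measurable h)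
  also have "\<dots> = (\<integral>\<^sup>+r. (\<integral>\<^sup>+z. ?g r z \<partial>gauss ({0 :: nat} \<times> {..<Suc N})) \<partial>gauss ({1 :: nat} \<times> {..<Suc N}))"
  proof (rule nn_integral_cong_AE)
    show "AE r in gauss ({1 :: nat} \<times> {..<Suc N}). (\<integral>\<^sup>+z. h (inv_gram2 (?Q r z * transpose_mat (?Q r z))) \<partial>gauss ({..<1} \<times> {..<Suc N}))
        = (\<integral>\<^sup>+z. ?g r z \<partial>gauss ({0 :: nat} \<times> {..<Suc N}))"
      using AE_gauss_row_norm[of 1 N]
    proof eventually_elim
      case (elim r)
      have "inv_gram2 (?Q r z * transpose_mat (?Q r z)) = (inverse (\<Sum>j<N. (z (0, j))\<^sup>2),
        - (inverse (\<Sum>j<N. (z (0, j))\<^sup>2) * z (0, N)) / sqrt (\<Sum>j<Suc N. (r (1, j))\<^sup>2))" for z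
        using inv_gram_bordered(1)[of "Matrix.mat 1 N z" 1 N "Matrix.mat 1 1 (\<lambda>(i, _). z (i, N))", OF _ _ elim, of 0 0]
          inv_gram_bordered(2)[of "Matrix.mat 1 N z" 1 N "Matrix.mat 1 1 (\<lambda>(i, _). z (i, N))", OF _ _ elim, of 0]
        unfolding inv_gram2_def inv_gram_one by (simp add: inv_gram_one[unfolded One_nat_def])
      then show ?case unfolding one by simp
    qed
  qed
  also have "\<dots> = (\<integral>\<^sup>+r. (\<integral>\<^sup>+k. (\<integral>\<^sup>+s. h (inverse (\<Sum>j<N. (k (0, j))\<^sup>2),
        - (inverse (\<Sum>j<N. (k (0, j))\<^sup>2) * s (0, N)) / sqrt (\<Sum>j<Suc N. (r (1, j))\<^sup>2))
      \<partial>gauss ({0 :: nat} \<times> {N})) \<partial>gauss ({0 :: nat} \<times> {..<N})) \<partial>gauss ({1 :: nat} \<times> {..<Suc N}))"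
  proof (rule nn_integral_cong)
    fix r :: "nat \<times> nat \<Rightarrow> real"
    have U: "{0 :: nat} \<times> {..<Suc N} = {0} \<times> {..<N} \<union> {0} \<times> {N}" by auto
    have m: "?g r \<in> borel_measurable (gauss ({0 :: nat} \<times> {..<N} \<union> {0} \<times> {N}))"
    proof (rule measurable_compose[OF _ h], intro borel_measurable_Pair)
      have c: "(\<lambda>z. z (0, j)) \<in> borel_measurable (gauss ({0 :: nat} \<times> {..<N} \<union> {0} \<times> {N}))" if "j \<le> N" for j
        using that by (auto simp: measurable_cong_sets[OF sets_gauss refl] intro!: measurable_component_singleton)
      show "(\<lambda>z. inverse (\<Sum>j<N. (z (0, j))\<^sup>2)) \<in> borel_measurable (gauss ({0 :: nat} \<times> {..<N} \<union> {0} \<times> {N}))"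
        by (intro borel_measurable_inverse borel_measurable_sum borel_measurable_power c) auto
      then show "(\<lambda>z. - (inverse (\<Sum>j<N. (z (0, j))\<^sup>2) * z (0, N)) / sqrt (\<Sum>j<Suc N. (r (1, j))\<^sup>2))
          \<in> borel_measurable (gauss ({0 :: nat} \<times> {..<N} \<union> {0} \<times> {N}))"
        using c[of N] by (intro borel_measurable_divide borel_measurable_uminus borel_measurable_times) auto
    qed
    show "(\<integral>\<^sup>+z. ?g r z \<partial>gauss ({0 :: nat} \<times> {..<Suc N})) = (\<integral>\<^sup>+k. (\<integral>\<^sup>+s. h (inverse (\<Sum>j<N. (k (0, j))\<^sup>2),
        - (inverse (\<Sum>j<N. (k (0, j))\<^sup>2) * s (0, N)) / sqrt (\<Sum>j<Suc N. (r (1, j))\<^sup>2))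
      \<partial>gauss ({0 :: nat} \<times> {N})) \<partial>gauss ({0 :: nat} \<times> {..<N}))"
      unfolding U by (subst nn_integral_gauss_Un[OF _ _ _ m]) (auto simp: merge_def intro!: nn_integral_cong)
  qed
  finally show ?thesis .
qed

section \<open>The law of the statistic\<close>

text \<open>Two reflections: the first aligns a with the first axis, the second rotates the part of
  y orthogonal to a onto the second axis. Here b is the component of y along a, and the square root
  is the norm of the orthogonal part.\<close>

lemma rotate_two_vectors:
  fixes a y :: "real Matrix.vec"
  assumes p: "2 \<le> p" and a: "a \<in> carrier_vec p" and y: "y \<in> carrier_vec p" and a0: "0 < a \<bullet> a"
  defines "b \<equiv> (a \<bullet> y) / sqrt (a \<bullet> a)"
  shows "\<exists>H \<in> carrier_mat p p. transpose_mat H * H = 1\<^sub>m p \<and>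
    H *\<^sub>v a = Matrix.vec p (\<lambda>i. if i = 0 then sqrt (a \<bullet> a) else 0) \<and>
    H *\<^sub>v y = Matrix.vec p (\<lambda>i. if i = 0 then b else if i = 1 then sqrt (y \<bullet> y - b\<^sup>2) else 0)"
proof -
  define e where "e = Matrix.vec p (\<lambda>i. if i = 0 then sqrt (a \<bullet> a) else 0)"
  define t where "t = Matrix.vec p (\<lambda>i. if i = 0 then b else if i = 1 then sqrt (y \<bullet> y - b\<^sup>2) else 0)"
  have e: "e \<in> carrier_vec p" and t: "t \<in> carrier_vec p" by (auto simp: e_def t_def)
  have split: "(\<Sum>i<p. f i) = f 0 + (\<Sum>i\<in>{1..<p}. f i)" for f :: "nat \<Rightarrow> real"
    using p by (simp add: lessThan_atLeast0 sum.atLeast_Suc_lessThan)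
  have split2: "(\<Sum>i<p. f i) = f 0 + (f 1 + (\<Sum>i\<in>{2..<p}. f i))" for f :: "nat \<Rightarrow> real"
    unfolding split using p by (simp add: sum.atLeast_Suc_lessThan numeral_2_eq_2)
  have ev: "e \<bullet> x = sqrt (a \<bullet> a) * x $ 0" if "x \<in> carrier_vec p" for x
  proof -
    have "e \<bullet> x = (\<Sum>i<p. e $ i * x $ i)" using that by (simp add: scalar_prod_def lessThan_atLeast0)
    also have "\<dots> = sqrt (a \<bullet> a) * x $ 0" unfolding split using p by (auto simp: e_def)
    finally show ?thesis .
  qed
  have "a \<bullet> a = e \<bullet> e" using ev[OF e] a0 p by (simp add: e_def)
  then obtain H1 where H1: "H1 \<in> carrier_mat p p" "transpose_mat H1 = H1" "H1 * H1 = 1\<^sub>m p" "H1 *\<^sub>v a = e"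
    using householder_exists[OF a e] by metis
  have inner: "(H1 *\<^sub>v x) \<bullet> (H1 *\<^sub>v z) = x \<bullet> z" if "x \<in> carrier_vec p" "z \<in> carrier_vec p" for x z
    using scalar_prod_mult_mat_vec_transpose[OF H1(1) that(1), of "H1 *\<^sub>v z"] H1 that
    by (simp add: assoc_mult_mat_vec[symmetric, of _ p p _ p])
  define y1 where "y1 = H1 *\<^sub>v y"
  have y1: "y1 \<in> carrier_vec p" using H1 y by (simp add: y1_def)
  have y10: "y1 $ 0 = b"
    using inner[OF a y] ev[OF y1] a0 unfolding H1(4) y1_def[symmetric] b_def
    by (simp add: eq_divide_eq mult.commute)
  have yy: "y1 \<bullet> y1 = y \<bullet> y" unfolding y1_def by (rule inner[OF y y])
  have "y1 \<bullet> y1 = (\<Sum>i<p. y1 $ i * y1 $ i)" using y1 by (simp add: scalar_prod_def lessThan_atLeast0)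
  then have "y \<bullet> y - b\<^sup>2 = (\<Sum>i\<in>{1..<p}. y1 $ i * y1 $ i)"
    unfolding yy split y10 by (simp add: power2_eq_square)
  then have nn: "0 \<le> y \<bullet> y - b\<^sup>2" by (simp add: sum_nonneg)
  have "t \<bullet> t = (\<Sum>i<p. t $ i * t $ i)" using t by (simp add: scalar_prod_def lessThan_atLeast0)
  also have "\<dots> = b * b + (y \<bullet> y - b\<^sup>2)"
    unfolding split2 using p nn by (auto simp: t_def)
  finally have "y1 \<bullet> y1 = t \<bullet> t" by (simp add: yy power2_eq_square)
  then obtain H2 where H2: "H2 \<in> carrier_mat p p" "transpose_mat H2 = H2" "H2 * H2 = 1\<^sub>m p" "H2 *\<^sub>v y1 = t"
    "\<And>w. w \<in> carrier_vec p \<Longrightarrow> w \<bullet> (y1 - t) = 0 \<Longrightarrow> H2 *\<^sub>v w = w"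
    using householder_exists[OF y1 t] by metis
  \<comment> \<open>y1 and t agree in coordinate 0, so the second reflection leaves e, the image of
    a, in place.\<close>
  have "e \<bullet> (y1 - t) = 0" using ev[of "y1 - t"] y1 t y10 p by (simp add: t_def)
  then have H2e: "H2 *\<^sub>v e = e" using H2(5)[OF e] by simp
  show ?thesis
  proof (intro bexI conjI)
    show "transpose_mat (H2 * H1) * (H2 * H1) = 1\<^sub>m p"
    proof -
      have "transpose_mat (H2 * H1) * (H2 * H1) = H1 * H2 * (H2 * H1)"
        using transpose_mult[OF H2(1) H1(1)] H1(2) H2(2) by simp
      also have "\<dots> = H1 * (H2 * (H2 * H1))" by (rule assoc_mult_mat[OF H1(1) H2(1)]) (use H1 H2 in auto)
      also have "H2 * (H2 * H1) = H2 * H2 * H1" by (rule assoc_mult_mat[symmetric, OF H2(1) H2(1) H1(1)])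
      finally show ?thesis using H1 H2 by simp
    qed
    show "(H2 * H1) *\<^sub>v a = Matrix.vec p (\<lambda>i. if i = 0 then sqrt (a \<bullet> a) else 0)"
      using assoc_mult_mat_vec[OF H2(1) H1(1) a] H1 H2e by (simp add: e_def)
    show "(H2 * H1) *\<^sub>v y = Matrix.vec p (\<lambda>i. if i = 0 then b else if i = 1 then sqrt (y \<bullet> y - b\<^sup>2) else 0)"
      using assoc_mult_mat_vec[OF H2(1) H1(1) y] H2 by (simp add: t_def y1_def)
  qed (use H1 H2 in auto)
qed

lemma smult_mat_mult_vec:
  fixes A :: "real Matrix.mat"
  shows "A \<in> carrier_mat n p \<Longrightarrow> x \<in> carrier_vec p \<Longrightarrow> (c \<cdot>\<^sub>m A) *\<^sub>v x = c \<cdot>\<^sub>v (A *\<^sub>v x)"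
  by (rule eq_vecI) (auto simp: scalar_prod_def sum_distrib_left mult.assoc)

lemma gram_index:
  fixes A :: "real Matrix.mat"
  shows "A \<in> carrier_mat p n \<Longrightarrow> i < p \<Longrightarrow> k < p \<Longrightarrow>
    (A * transpose_mat A) $$ (i, k) = (\<Sum>j<n. A $$ (i, j) * A $$ (k, j))"
  by (simp add: scalar_prod_def lessThan_atLeast0)

text \<open>The area of the parallelogram spanned by a and y, or |a| times the norm of the part of y
  orthogonal to a.\<close>

definition perp_factor :: "real Matrix.vec \<Rightarrow> real Matrix.vec \<Rightarrow> real" where
  "perp_factor a y = sqrt ((a \<bullet> a) * (y \<bullet> y) - (a \<bullet> y)\<^sup>2)"

text \<open>The arguments r, k, s are what is left of a standard normal matrix with 2 rows and m + 1
  columns: its row 1, the first m entries of its row 0, and the last entry of its row 0. The sums of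
  squares over r and k are the variables \<zeta> and \<xi> of the overview.\<close>

definition bilinear_value :: "nat \<Rightarrow> real Matrix.vec \<Rightarrow> real Matrix.vec \<Rightarrow>
    (nat \<times> nat \<Rightarrow> real) \<Rightarrow> (nat \<times> nat \<Rightarrow> real) \<Rightarrow> (nat \<times> nat \<Rightarrow> real) \<Rightarrow> real" where
  "bilinear_value m a y r k s =
    (a \<bullet> y - perp_factor a y * s (0, m) / sqrt (\<Sum>j<Suc m. (r (1, j))\<^sup>2)) / (\<Sum>j<m. (k (0, j))\<^sup>2)"

lemma gauss_component_measurable:
  "i \<in> K \<Longrightarrow> (\<lambda>z. z i) \<in> borel_measurable (gauss K)"
  by (auto simp: measurable_cong_sets[OF sets_gauss refl] intro!: measurable_component_singleton)

lemma scalar_prod_self_pos: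
  fixes a :: "real Matrix.vec"
  assumes a: "a \<in> carrier_vec p" and a0: "a \<noteq> 0\<^sub>v p"
  shows "0 < a \<bullet> a"
proof -
  have aa: "a \<bullet> a = (\<Sum>i<p. a $ i * a $ i)" using a by (simp add: scalar_prod_def lessThan_atLeast0)
  have "\<exists>i<p. a $ i \<noteq> 0"
  proof (rule ccontr)
    assume "\<not> ?thesis"
    then have "a = 0\<^sub>v p" using a by (intro eq_vecI) auto
    then show False using a0 by simp
  qed
  then obtain i where i: "i < p" "a $ i \<noteq> 0" by blast
  have "0 < a $ i * a $ i" using i by (simp add: zero_less_mult_iff) linarith
  also have "\<dots> \<le> (\<Sum>i<p. a $ i * a $ i)" by (rule member_le_sum) (use i in auto)
  finally show ?thesis by (simp add: aa)
qed

text \<open>Rotation invariance allows a and y to be moved into the span of the first two axes,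
  where \<open>inv_gram2\<close> suffices. Removing p - 2 rows together with as many columns leaves
  2 rows and N - (p - 2) = m + 1 columns.\<close>

lemma bilinear_inv_gram_law:
  fixes h :: "real \<Rightarrow> ennreal"
  assumes p: "1 \<le> p" "p \<le> N" and a: "a \<in> carrier_vec p" and y: "y \<in> carrier_vec p" and a0: "a \<noteq> 0\<^sub>v p"
    and h: "h \<in> borel_measurable borel"
  defines "m \<equiv> Suc N - p"
  shows "(\<integral>\<^sup>+z. h (a \<bullet> (inv_mat (Matrix.mat p N z * transpose_mat (Matrix.mat p N z)) *\<^sub>v y)) \<partial>gauss ({..<p} \<times> {..<N})) =
    (\<integral>\<^sup>+r. (\<integral>\<^sup>+k. (\<integral>\<^sup>+s. h (bilinear_value m a y r k s)
      \<partial>gauss ({0} \<times> {m})) \<partial>gauss ({0} \<times> {..<m})) \<partial>gauss ({1} \<times> {..<Suc m}))"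
proof (cases "p = 1")
  \<comment> \<open>In dimension one there is no second axis. Then a and y are parallel,
    \<open>perp_factor\<close> vanishes, and the integrals over r and s contribute only the factor
    one.\<close>
  case True
  then have m: "m = N" by (simp add: m_def)
  have ay: "a \<bullet> y = a $ 0 * y $ 0" "a \<bullet> a = a $ 0 * a $ 0" "y \<bullet> y = y $ 0 * y $ 0"
    using a y True by (auto simp: scalar_prod_def)
  have pf: "perp_factor a y = 0" by (simp add: perp_factor_def ay power2_eq_square)
  have "a \<bullet> (inv_mat (Matrix.mat p N z * transpose_mat (Matrix.mat p N z)) *\<^sub>v y) =
      (a \<bullet> y) / (\<Sum>j<m. (z (0, j))\<^sup>2)" for z
  proof -
    let ?V = "inv_mat (Matrix.mat 1 N z * transpose_mat (Matrix.mat 1 N z))"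
    have V: "?V \<in> carrier_mat 1 1" by (rule inv_mat_carrier, rule mult_carrier_mat[of _ 1 N]) auto
    have "a \<bullet> (?V *\<^sub>v y) = a $ 0 * (?V $$ (0, 0) * y $ 0)"
      using V a y True by (auto simp: scalar_prod_def)
    then show ?thesis unfolding True inv_gram_one m ay by (simp add: field_simps)
  qed
  moreover have "{..<p} = {0}" using True by auto
  moreover have "emeasure (gauss K) (space (gauss K)) = 1" for K :: "(nat \<times> nat) set"
    by (rule prob_space.emeasure_space_1[OF prob_space_gauss])
  ultimately show ?thesis by (simp add: bilinear_value_def pf m)
next
  case False
  then have p2: "2 \<le> p" using p by simp
  have aa: "0 < a \<bullet> a" by (rule scalar_prod_self_pos[OF a a0])
  define b where "b = (a \<bullet> y) / sqrt (a \<bullet> a)"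
  define d where "d = sqrt (y \<bullet> y - b\<^sup>2)"
  define e where "e = Matrix.vec p (\<lambda>i. if i = 0 then sqrt (a \<bullet> a) else 0)"
  define t where "t = Matrix.vec p (\<lambda>i. if i = 0 then b else if i = 1 then d else 0)"
  obtain H where H: "H \<in> carrier_mat p p" "transpose_mat H * H = 1\<^sub>m p" "H *\<^sub>v a = e" "H *\<^sub>v y = t"
    using rotate_two_vectors[OF p2 a y aa] unfolding b_def d_def e_def t_def by metis
  have dH: "Determinant.det H \<noteq> 0"
    using det_mult[of "transpose_mat H" p H] H by auto
  have "sqrt (a \<bullet> a) * d = sqrt ((a \<bullet> a) * (y \<bullet> y - b\<^sup>2))" unfolding d_def by (simp add: real_sqrt_mult)
  also have "(a \<bullet> a) * (y \<bullet> y - b\<^sup>2) = (a \<bullet> a) * (y \<bullet> y) - (a \<bullet> y)\<^sup>2"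
    using aa by (simp add: b_def power_divide algebra_simps)
  finally have ad: "sqrt (a \<bullet> a) * d = perp_factor a y" by (simp add: perp_factor_def)
  have ab: "sqrt (a \<bullet> a) * b = a \<bullet> y" using aa by (simp add: b_def)
  define g where "g = (\<lambda>(v, w). h ((a \<bullet> y) * v + perp_factor a y * w))"
  have gm: "g \<in> borel_measurable borel"
    unfolding g_def split_beta'
    by (rule measurable_compose[OF _ h]) (intro borel_measurable_continuous_onI continuous_intros)
  define G where "G = (\<lambda>Z :: real Matrix.mat. Z * transpose_mat Z)"
  have form: "h (a \<bullet> (inv_mat (G Z) *\<^sub>v y)) = g (inv_gram2 (G (H * Z)))" if Z: "Z \<in> carrier_mat p N" for Z
  proof -
    have GZ: "G Z \<in> carrier_mat p p" unfolding G_def by (rule mult_carrier_mat[OF Z]) (use Z in simp)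
    have "H * G Z * transpose_mat H = G (H * Z)"
    proof -
      have "G (H * Z) = (H * Z) * (transpose_mat Z * transpose_mat H)"
        unfolding G_def by (simp only: transpose_mult[OF H(1) Z])
      also have "\<dots> = H * (Z * (transpose_mat Z * transpose_mat H))"
        by (rule assoc_mult_mat[OF H(1) Z]) (use H Z in auto)
      also have "Z * (transpose_mat Z * transpose_mat H) = G Z * transpose_mat H"
        unfolding G_def by (rule assoc_mult_mat[symmetric, OF Z]) (use H Z in auto)
      also have "H * (G Z * transpose_mat H) = H * G Z * transpose_mat H"
        by (rule assoc_mult_mat[symmetric, OF H(1) GZ]) (use H in auto)
      finally show ?thesis ..
    qed
    then have 1: "a \<bullet> (inv_mat (G Z) *\<^sub>v y) = e \<bullet> (inv_mat (G (H * Z)) *\<^sub>v t)"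
      using scalar_prod_inv_mat_congruence[OF GZ H(1) dH a y] H by simp
    let ?V = "inv_mat (G (H * Z))"
    have V: "?V \<in> carrier_mat p p"
      unfolding G_def by (rule inv_mat_carrier, rule mult_carrier_mat[of _ p N]) (use H Z in auto)
    have "e \<bullet> (?V *\<^sub>v t) = sqrt (a \<bullet> a) * (?V *\<^sub>v t) $ 0"
    proof -
      have "e \<bullet> x = sqrt (a \<bullet> a) * x $ 0" if "x \<in> carrier_vec p" for x
      proof -
        have "e \<bullet> x = (\<Sum>i<p. e $ i * x $ i)" using that by (simp add: scalar_prod_def lessThan_atLeast0)
        also have "\<dots> = (\<Sum>i\<in>{0}. e $ i * x $ i)"
          by (rule sum.mono_neutral_right) (use p in \<open>auto simp: e_def\<close>)
        finally show ?thesis using p by (simp add: e_def)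
      qed
      moreover have "?V *\<^sub>v t \<in> carrier_vec p" using V by (simp add: t_def)
      ultimately show ?thesis by blast
    qed
    also have "(?V *\<^sub>v t) $ 0 = (\<Sum>i<p. ?V $$ (0, i) * t $ i)"
      using V p by (simp add: scalar_prod_def lessThan_atLeast0 t_def)
    also have "\<dots> = (\<Sum>i\<in>{0, 1}. ?V $$ (0, i) * t $ i)"
      by (rule sum.mono_neutral_right) (use p2 in \<open>auto simp: t_def\<close>)
    also have "\<dots> = b * ?V $$ (0, 0) + d * ?V $$ (0, 1)" using p2 by (simp add: t_def)
    finally have "a \<bullet> (inv_mat (G Z) *\<^sub>v y) = (sqrt (a \<bullet> a) * b) * ?V $$ (0, 0) + (sqrt (a \<bullet> a) * d) * ?V $$ (0, 1)"
      unfolding 1 by (simp add: algebra_simps)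
    then show ?thesis unfolding ab ad by (simp add: g_def inv_gram2_def)
  qed
  have "(\<integral>\<^sup>+z. h (a \<bullet> (inv_mat (G (Matrix.mat p N z)) *\<^sub>v y)) \<partial>gauss ({..<p} \<times> {..<N})) =
    (\<integral>\<^sup>+z. g (inv_gram2 (G (H * Matrix.mat p N z * 1\<^sub>m N))) \<partial>gauss ({..<p} \<times> {..<N}))"
    using form H by simp
  also have "\<dots> = (\<integral>\<^sup>+z. g (inv_gram2 (G (Matrix.mat p N z))) \<partial>gauss ({..<p} \<times> {..<N}))"
    unfolding G_def
    by (rule gauss_mat_orthogonal)
       (use H in \<open>auto intro!: inv_gram2_measurable[OF _ p2 gm] mat_measurable_mult[of _ N] mat_measurable_transpose mat_measurable_gauss\<close>)
  also have "\<dots> = (\<integral>\<^sup>+z. g (inv_gram2 (G (Matrix.mat 2 (Suc m) z))) \<partial>gauss ({..<2} \<times> {..<Suc m}))"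
  proof -
    have "2 + (p - 2) = p" "Suc m + (p - 2) = N" using p2 p by (auto simp: m_def)
    then show ?thesis using inv_gram2_reduce[OF gm, of "p - 2" "Suc m"] unfolding G_def by simp
  qed
  also have "\<dots> = (\<integral>\<^sup>+r. (\<integral>\<^sup>+k. (\<integral>\<^sup>+s. h (bilinear_value m a y r k s)
      \<partial>gauss ({0} \<times> {m})) \<partial>gauss ({0} \<times> {..<m})) \<partial>gauss ({1} \<times> {..<Suc m}))"
    unfolding G_def inv_gram2_two[OF gm]
    by (intro nn_integral_cong) (simp add: g_def bilinear_value_def divide_inverse algebra_simps)
  finally show ?thesis unfolding G_def .
qed

text \<open>H has a constant last column, as in Helmert's transformation. Hence the last column of Z
  H is sqrt n times the mean. Since H preserves Z Z^T, the other N columns carry what remains after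
  subtracting n times the outer square of the mean, that is N times the sample covariance.\<close>

lemma sample_rotation:
  assumes W: "Z \<in> carrier_mat p (Suc N)" and H: "H \<in> carrier_mat (Suc N) (Suc N)" "transpose_mat H = H" "H * H = 1\<^sub>m (Suc N)"
    and Hc: "\<And>j. j < Suc N \<Longrightarrow> H $$ (j, N) = 1 / sqrt (Suc N)" and N: "0 < N"
  defines "A \<equiv> Matrix.mat p N (\<lambda>ij. (Z * H) $$ ij)"
  shows "sample_mean Z = Matrix.vec p (\<lambda>i. (Z * H) $$ (i, N) / sqrt (Suc N))"
    and "sample_cov Z = (1 / real N) \<cdot>\<^sub>m (A * transpose_mat A)"
proof -
  let ?n = "real (Suc N)"
  have WN: "(Z * H) $$ (i, N) = (\<Sum>j<Suc N. Z $$ (i, j)) / sqrt ?n" if "i < p" for i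
    using that W H Hc by (simp add: scalar_prod_def sum_divide_distrib[symmetric] lessThan_atLeast0
        add_divide_distrib del: of_nat_Suc)
  have sm: "sample_mean Z $ i = (\<Sum>j<Suc N. Z $$ (i, j)) / ?n" if "i < p" for i
    using that W by (simp add: sample_mean_def)
  have sq: "sqrt ?n * sqrt ?n = ?n" by simp
  show sm2: "sample_mean Z = Matrix.vec p (\<lambda>i. (Z * H) $$ (i, N) / sqrt ?n)"
    using W by (intro eq_vecI) (auto simp: WN sample_mean_def simp del: of_nat_Suc sum.lessThan_Suc)
  show "sample_cov Z = (1 / real N) \<cdot>\<^sub>m (A * transpose_mat A)"
  proof (rule eq_matI)
    fix i k assume "i < dim_row ((1 / real N) \<cdot>\<^sub>m (A * transpose_mat A))" "k < dim_col ((1 / real N) \<cdot>\<^sub>m (A * transpose_mat A))"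
    then have i: "i < p" and k: "k < p" by (auto simp: A_def)
    let ?x = "sample_mean Z"
    have nx: "(\<Sum>j<Suc N. Z $$ (l, j)) = ?n * ?x $ l" if "l < p" for l using sm[OF that] by (simp del: of_nat_Suc sum.lessThan_Suc)
    have "(\<Sum>j<Suc N. (Z $$ (i, j) - ?x $ i) * (Z $$ (k, j) - ?x $ k)) =
        (\<Sum>j<Suc N. Z $$ (i, j) * Z $$ (k, j)) - ?x $ k * (\<Sum>j<Suc N. Z $$ (i, j)) - ?x $ i * (\<Sum>j<Suc N. Z $$ (k, j)) + ?n * (?x $ i * ?x $ k)"
    proof -
      have "(\<Sum>j<Suc N. (Z $$ (i, j) - ?x $ i) * (Z $$ (k, j) - ?x $ k)) =
        (\<Sum>j<Suc N. Z $$ (i, j) * Z $$ (k, j) - ?x $ k * Z $$ (i, j) - ?x $ i * Z $$ (k, j) + ?x $ i * ?x $ k)"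
        by (intro sum.cong) (auto simp: algebra_simps)
      also have "\<dots> = (\<Sum>j<Suc N. Z $$ (i, j) * Z $$ (k, j)) - (\<Sum>j<Suc N. ?x $ k * Z $$ (i, j)) - (\<Sum>j<Suc N. ?x $ i * Z $$ (k, j)) + (\<Sum>j<Suc N. ?x $ i * ?x $ k)"
        by (simp only: sum.distrib sum_subtractf)
      finally show ?thesis 
        by (simp only: sum_distrib_left[symmetric] sum_constant card_lessThan)
           (simp add: ac_simps del: sum.lessThan_Suc of_nat_Suc)
    qed
    also have "\<dots> = (\<Sum>j<Suc N. Z $$ (i, j) * Z $$ (k, j)) - ?n * (?x $ i * ?x $ k)"
      unfolding nx[OF i] nx[OF k] by (simp add: algebra_simps del: sum.lessThan_Suc)
    also have "(\<Sum>j<Suc N. Z $$ (i, j) * Z $$ (k, j)) = (Z * transpose_mat Z) $$ (i, k)"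
      by (rule gram_index[OF W i k, symmetric])
    also have "Z * transpose_mat Z = (Z * H) * transpose_mat (Z * H)"
      by (rule gram_right_orthogonal[symmetric, OF W H(1)]) (simp add: H)
    also have "((Z * H) * transpose_mat (Z * H)) $$ (i, k) = (\<Sum>j<Suc N. (Z * H) $$ (i, j) * (Z * H) $$ (k, j))"
      by (rule gram_index[OF mult_carrier_mat[OF W H(1)] i k])
    also have "\<dots> = (\<Sum>j<N. (Z * H) $$ (i, j) * (Z * H) $$ (k, j)) + (Z * H) $$ (i, N) * (Z * H) $$ (k, N)" by simp
    also have "(Z * H) $$ (i, N) * (Z * H) $$ (k, N) = ?n * (?x $ i * ?x $ k)"
    proof -
      have "(Z * H) $$ (l, N) = sqrt ?n * ?x $ l" if "l < p" for l
        unfolding sm2 using that by (simp del: of_nat_Suc index_mult_mat(1))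
      then have "(Z * H) $$ (i, N) * (Z * H) $$ (k, N) = (sqrt ?n * sqrt ?n) * (?x $ i * ?x $ k)"
        using i k by simp
      then show ?thesis unfolding sq .
    qed
    finally have "(\<Sum>j<Suc N. (Z $$ (i, j) - ?x $ i) * (Z $$ (k, j) - ?x $ k)) = (\<Sum>j<N. (Z * H) $$ (i, j) * (Z * H) $$ (k, j))"
      by simp
    moreover have "(A * transpose_mat A) $$ (i, k) = (\<Sum>j<N. (Z * H) $$ (i, j) * (Z * H) $$ (k, j))"
      using gram_index[of A p N i k] i k by (simp add: A_def del: index_mult_mat(1))
    ultimately show "sample_cov Z $$ (i, k) = ((1 / real N) \<cdot>\<^sub>m (A * transpose_mat A)) $$ (i, k)"
      using i k W by (simp add: sample_cov_def A_def del: sum.lessThan_Suc index_mult_mat(1))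
  qed (use W in \<open>auto simp: sample_cov_def A_def\<close>)
qed

section \<open>Measurability of the sample moments and of the statistic, and its law\<close>

lemma scalar_prod_measurable:
  assumes "\<And>x. x \<in> space M \<Longrightarrow> u x \<in> carrier_vec p" "\<And>x. x \<in> space M \<Longrightarrow> v x \<in> carrier_vec p"
    and "\<And>i. i < p \<Longrightarrow> (\<lambda>x. u x $ i) \<in> borel_measurable M" "\<And>i. i < p \<Longrightarrow> (\<lambda>x. v x $ i) \<in> borel_measurable M"
  shows "(\<lambda>x. u x \<bullet> v x :: real) \<in> borel_measurable M"
proof -
  have "(\<lambda>x. \<Sum>i<p. u x $ i * v x $ i) \<in> borel_measurable M"
    using assms by (intro borel_measurable_sum borel_measurable_times) auto
  moreover have "u x \<bullet> v x = (\<Sum>i<p. u x $ i * v x $ i)" if "x \<in> space M" for x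
    using assms(2)[OF that] by (simp add: scalar_prod_def lessThan_atLeast0)
  ultimately show ?thesis by (subst measurable_cong) auto
qed

lemma mult_mat_vec_measurable:
  assumes V: "mat_measurable n p M V" and i: "i < n"
    and v: "\<And>x. x \<in> space M \<Longrightarrow> v x \<in> carrier_vec p" "\<And>i. i < p \<Longrightarrow> (\<lambda>x. v x $ i) \<in> borel_measurable M"
  shows "(\<lambda>x. (V x *\<^sub>v v x) $ i) \<in> borel_measurable M"
proof -
  have "(\<lambda>x. \<Sum>j<p. V x $$ (i, j) * v x $ j) \<in> borel_measurable M"
    using V v i by (intro borel_measurable_sum borel_measurable_times) (auto simp: mat_measurable_def)
  moreover have "(V x *\<^sub>v v x) $ i = (\<Sum>j<p. V x $$ (i, j) * v x $ j)" if "x \<in> space M" for x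
  proof -
    have "V x \<in> carrier_mat n p" using V that by (auto simp: mat_measurable_def)
    then show ?thesis using v(1)[OF that] i by (simp add: scalar_prod_def lessThan_atLeast0)
  qed
  ultimately show ?thesis by (subst measurable_cong) auto
qed

lemma bilinear_measurable:
  assumes V: "mat_measurable p p M V" and a: "a \<in> carrier_vec p"
    and v: "\<And>x. x \<in> space M \<Longrightarrow> v x \<in> carrier_vec p" "\<And>i. i < p \<Longrightarrow> (\<lambda>x. v x $ i) \<in> borel_measurable M"
  shows "(\<lambda>x. a \<bullet> (V x *\<^sub>v v x)) \<in> borel_measurable M"
proof (rule scalar_prod_measurable[where p = p])
  show "V x *\<^sub>v v x \<in> carrier_vec p" if "x \<in> space M" for x
    using V v(1)[OF that] that by (auto simp: mat_measurable_def)
qed (use a mult_mat_vec_measurable[OF V _ v] in auto)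

lemma mat_measurable_sample_cov:
  assumes A: "mat_measurable p n M A"
  shows "mat_measurable p p M (\<lambda>x. sample_cov (A x))"
    and "i < p \<Longrightarrow> (\<lambda>x. sample_mean (A x) $ i) \<in> borel_measurable M"
proof -
  have c: "A x \<in> carrier_mat p n" if "x \<in> space M" for x using A that by (auto simp: mat_measurable_def)
  have e: "(\<lambda>x. A x $$ (i, j)) \<in> borel_measurable M" if "i < p" "j < n" for i j
    using A that by (auto simp: mat_measurable_def)
  have m: "(\<lambda>x. sample_mean (A x) $ i) \<in> borel_measurable M" if i: "i < p" for i
  proof -
    have "(\<lambda>x. (\<Sum>j<n. A x $$ (i, j)) / real n) \<in> borel_measurable M"
      using e i by (intro borel_measurable_divide borel_measurable_sum) auto
    moreover have "sample_mean (A x) $ i = (\<Sum>j<n. A x $$ (i, j)) / real n" if "x \<in> space M" for x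
      using c[OF that] i by (simp add: sample_mean_def)
    ultimately show ?thesis by (subst measurable_cong) auto
  qed
  then show "i < p \<Longrightarrow> (\<lambda>x. sample_mean (A x) $ i) \<in> borel_measurable M" .
  show "mat_measurable p p M (\<lambda>x. sample_cov (A x))"
    unfolding mat_measurable_def
  proof (intro conjI ballI allI impI)
    show "sample_cov (A x) \<in> carrier_mat p p" if "x \<in> space M" for x
      using c[OF that] by (simp add: sample_cov_def)
    fix i k assume ik: "i < p" "k < p"
    have "(\<lambda>x. (\<Sum>j<n. (A x $$ (i, j) - sample_mean (A x) $ i) * (A x $$ (k, j) - sample_mean (A x) $ k)) / (real n - 1))
        \<in> borel_measurable M"
      using e m ik by (intro borel_measurable_divide borel_measurable_sum borel_measurable_times borel_measurable_diff) auto
    moreover have "sample_cov (A x) $$ (i, k) =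
        (\<Sum>j<n. (A x $$ (i, j) - sample_mean (A x) $ i) * (A x $$ (k, j) - sample_mean (A x) $ k)) / (real n - 1)"
      if "x \<in> space M" for x
      using c[OF that] ik by (simp add: sample_cov_def)
    ultimately show "(\<lambda>x. sample_cov (A x) $$ (i, k)) \<in> borel_measurable M"
      by (subst measurable_cong) auto
  qed
qed

text \<open>The target quantity in whitened coordinates: the observations are the columns of Z
  shifted by v, and the shift affects the sample mean but not the sample covariance.\<close>

definition statistic :: "real Matrix.vec \<Rightarrow> real Matrix.vec \<Rightarrow> real Matrix.mat \<Rightarrow> real" where
  "statistic a v Z = a \<bullet> (inv_mat (sample_cov Z) *\<^sub>v (v + sample_mean Z))"

text \<open>The vector y = v + z / sqrt n of the overview, where z is column N of the rotated noise
  and n = Suc N.\<close>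

definition shifted_mean :: "nat \<Rightarrow> nat \<Rightarrow> real Matrix.vec \<Rightarrow> (nat \<times> nat \<Rightarrow> real) \<Rightarrow> real Matrix.vec" where
  "shifted_mean p N v w = v + Matrix.vec p (\<lambda>i. w (i, N) / sqrt (Suc N))"

lemma shifted_mean_carrier [simp]: "v \<in> carrier_vec p \<Longrightarrow> shifted_mean p N v w \<in> carrier_vec p"
  by (simp add: shifted_mean_def)

lemma sample_mean_carrier [simp]: "X \<in> carrier_mat p n \<Longrightarrow> sample_mean X \<in> carrier_vec p"
  by (simp add: sample_mean_def)

lemma dim_sample_mean [simp]: "dim_vec (sample_mean X) = dim_row X"
  by (simp add: sample_mean_def)

lemma sample_cov_carrier [simp]: "X \<in> carrier_mat p n \<Longrightarrow> sample_cov X \<in> carrier_mat p p"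
  by (simp add: sample_cov_def)

lemma statistic_measurable:
  assumes Z: "mat_measurable p n M Z" and a: "a \<in> carrier_vec p"
    and v: "\<And>x. x \<in> space M \<Longrightarrow> v x \<in> carrier_vec p" "\<And>i. i < p \<Longrightarrow> (\<lambda>x. v x $ i) \<in> borel_measurable M"
  shows "(\<lambda>x. statistic a (v x) (Z x)) \<in> borel_measurable M"
  unfolding statistic_def
proof (rule bilinear_measurable[where p = p])
  have c: "Z x \<in> carrier_mat p n" if "x \<in> space M" for x using Z that by (simp add: mat_measurable_def)
  show "mat_measurable p p M (\<lambda>x. inv_mat (sample_cov (Z x)))"
    by (intro mat_measurable_inv_mat mat_measurable_sample_cov[OF Z])
  show "v x + sample_mean (Z x) \<in> carrier_vec p" if "x \<in> space M" for x
    using v(1)[OF that] sample_mean_carrier[OF c[OF that]] by simp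
  fix i assume i: "i < p"
  have "(\<lambda>x. v x $ i + sample_mean (Z x) $ i) \<in> borel_measurable M"
    using v(2)[OF i] mat_measurable_sample_cov(2)[OF Z i] by measurable
  moreover have "(v x + sample_mean (Z x)) $ i = v x $ i + sample_mean (Z x) $ i" if "x \<in> space M" for x
    using i c[OF that] by simp
  ultimately show "(\<lambda>x. (v x + sample_mean (Z x)) $ i) \<in> borel_measurable M"
    by (subst measurable_cong) auto
qed (rule a)

text \<open>After the rotation the mean and the covariance use disjoint columns. So the column w can
  be fixed by the outer integral, and inside it the bilinear law applies to a constant vector y. The
  factor \<open>real N\<close> comes from inverting the normalisation of the sample
  covariance.\<close>

lemma nn_integral_statistic:
  fixes h :: "real \<Rightarrow> ennreal"
  assumes p: "1 \<le> p" "p \<le> N" and a: "a \<in> carrier_vec p" and v: "v \<in> carrier_vec p" and a0: "a \<noteq> 0\<^sub>v p"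
    and h: "h \<in> borel_measurable borel"
  defines "m \<equiv> Suc N - p"
  shows "(\<integral>\<^sup>+z. h (statistic a v (Matrix.mat p (Suc N) z)) \<partial>gauss ({..<p} \<times> {..<Suc N})) =
    (\<integral>\<^sup>+w. (\<integral>\<^sup>+r. (\<integral>\<^sup>+k. (\<integral>\<^sup>+s. h (real N * bilinear_value m a (shifted_mean p N v w) r k s)
      \<partial>gauss ({0} \<times> {m})) \<partial>gauss ({0} \<times> {..<m})) \<partial>gauss ({1} \<times> {..<Suc m})) \<partial>gauss ({..<p} \<times> {N}))"
proof -
  let ?n = "real (Suc N)" and ?K = "{..<p} \<times> {..<Suc N}"
  define u where "u = Matrix.vec (Suc N) (\<lambda>_. 1 / sqrt ?n)"
  define e where "e = Matrix.vec (Suc N) (\<lambda>j. if j = N then 1 else 0 :: real)"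
  have ue: "u \<in> carrier_vec (Suc N)" "e \<in> carrier_vec (Suc N)" by (auto simp: u_def e_def)
  have "u \<bullet> u = (\<Sum>j<Suc N. 1 / ?n)"
    by (simp add: u_def scalar_prod_def lessThan_atLeast0 del: sum.op_ivl_Suc sum.lessThan_Suc of_nat_Suc)
  also have "\<dots> = 1" by simp
  finally have "u \<bullet> u = e \<bullet> e" by (simp add: e_def scalar_prod_def)
  then obtain H where H: "H \<in> carrier_mat (Suc N) (Suc N)" "transpose_mat H = H" "H * H = 1\<^sub>m (Suc N)" "H *\<^sub>v u = e"
    using householder_exists[OF ue] by metis
  \<comment> \<open>H is an involution, so mapping u to e it also maps e to u; hence the last column
    of H is the constant unit vector.\<close>
  have He: "H *\<^sub>v e = u"
    using assoc_mult_mat_vec[OF H(1) H(1) ue(1)] H ue by simp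
  have Hc: "H $$ (j, N) = 1 / sqrt ?n" if "j < Suc N" for j
  proof -
    have "u $ j = (\<Sum>l<Suc N. H $$ (j, l) * e $ l)"
      unfolding He[symmetric] using H(1) ue(2) that
      by (simp add: scalar_prod_def lessThan_atLeast0 del: sum.op_ivl_Suc sum.lessThan_Suc)
    also have "\<dots> = H $$ (j, N)" by (simp add: e_def)
    finally show ?thesis using that by (simp add: u_def)
  qed
  define G where "G = (\<lambda>Z :: real Matrix.mat. Z * transpose_mat Z)"
  define F where "F = (\<lambda>Z. h (real N * (a \<bullet> (inv_mat (G (Matrix.mat p N (\<lambda>ij. Z $$ ij))) *\<^sub>v
     (v + Matrix.vec p (\<lambda>i. Z $$ (i, N) / sqrt ?n))))))"
  have N0: "0 < N" using p by simp
  have st: "h (statistic a v Z) = F (Z * H)" if Z: "Z \<in> carrier_mat p (Suc N)" for Z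
  proof -
    let ?A = "Matrix.mat p N (\<lambda>ij. (Z * H) $$ ij)"
    have GA: "G ?A \<in> carrier_mat p p" unfolding G_def by (rule mult_carrier_mat[of _ p N]) auto
    have "inv_mat (sample_cov Z) = real N \<cdot>\<^sub>m inv_mat (G ?A)"
      using sample_rotation(2)[OF Z H(1-3) Hc N0] inv_mat_smult[OF GA, of "1 / real N"] N0 unfolding G_def by simp
    moreover have y: "v + Matrix.vec p (\<lambda>i. (Z * H) $$ (i, N) / sqrt ?n) \<in> carrier_vec p" using v by simp
    ultimately show ?thesis
      using inv_mat_carrier[OF GA] a sample_rotation(1)[OF Z H(1-3) Hc N0]
      unfolding statistic_def F_def
      by (simp add: smult_mat_mult_vec[of _ p p] scalar_prod_smult_distrib[of _ p] del: of_nat_Suc)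
  qed
  have Fz: "F (Matrix.mat p (Suc N) z) = h (real N * (a \<bullet> (inv_mat (G (Matrix.mat p N z)) *\<^sub>v shifted_mean p N v z)))" for z
  proof -
    have "Matrix.mat p N (\<lambda>ij. Matrix.mat p (Suc N) z $$ ij) = Matrix.mat p N z" by (rule eq_matI) auto
    moreover have "Matrix.vec p (\<lambda>i. Matrix.mat p (Suc N) z $$ (i, N) / sqrt ?n) = Matrix.vec p (\<lambda>i. z (i, N) / sqrt ?n)"
      by (rule eq_vecI) auto
    ultimately show ?thesis by (simp add: F_def shifted_mean_def)
  qed
  have Fm: "(\<lambda>z. F (Matrix.mat p (Suc N) z)) \<in> borel_measurable (gauss ?K)"
    unfolding Fz
  proof (rule measurable_compose[OF _ h], intro borel_measurable_times borel_measurable_const bilinear_measurable[where p = p])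
    show "mat_measurable p p (gauss ?K) (\<lambda>x. inv_mat (G (Matrix.mat p N x)))"
      unfolding G_def by (intro mat_measurable_inv_mat mat_measurable_mult[of p N] mat_measurable_transpose mat_measurable_gauss) auto
    fix i assume i: "i < p"
    have "(\<lambda>x. v $ i + x (i, N) / sqrt ?n) \<in> borel_measurable (gauss ?K)"
      using gauss_component_measurable[of "(i, N)" ?K] i by (intro borel_measurable_add borel_measurable_divide) auto
    then show "(\<lambda>x. shifted_mean p N v x $ i) \<in> borel_measurable (gauss ?K)"
      using i v by (simp add: shifted_mean_def del: of_nat_Suc)
  qed (use a v in auto)
  have "(\<integral>\<^sup>+z. h (statistic a v (Matrix.mat p (Suc N) z)) \<partial>gauss ?K) =
      (\<integral>\<^sup>+z. F (1\<^sub>m p * Matrix.mat p (Suc N) z * H) \<partial>gauss ?K)"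
    by (simp add: st)
  also have "\<dots> = (\<integral>\<^sup>+z. F (Matrix.mat p (Suc N) z) \<partial>gauss ?K)"
    by (rule gauss_mat_orthogonal[OF _ _ _ _ Fm]) (use H in auto)
  also have "\<dots> = (\<integral>\<^sup>+w. (\<integral>\<^sup>+z. h (real N * (a \<bullet> (inv_mat (G (Matrix.mat p N z)) *\<^sub>v shifted_mean p N v w)))
      \<partial>gauss ({..<p} \<times> {..<N})) \<partial>gauss ({..<p} \<times> {N}))"
  proof -
    have U: "?K = {..<p} \<times> {N} \<union> {..<p} \<times> {..<N}" by auto
    have "Matrix.mat p N (merge ({..<p} \<times> {N}) ({..<p} \<times> {..<N}) (w, z)) = Matrix.mat p N z" for w z :: "nat \<times> nat \<Rightarrow> real"
      by (rule eq_matI) (auto simp: merge_def)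
    moreover have "shifted_mean p N v (merge ({..<p} \<times> {N}) ({..<p} \<times> {..<N}) (w, z)) = shifted_mean p N v w" for w z :: "nat \<times> nat \<Rightarrow> real"
      unfolding shifted_mean_def by (rule arg_cong2[where f = "(+)", OF refl]) (rule eq_vecI, auto simp: merge_def)
    ultimately show ?thesis
      unfolding U by (subst nn_integral_gauss_Un[OF _ _ _ Fm[unfolded U]]) (auto simp: Fz)
  qed
  also have "\<dots> = (\<integral>\<^sup>+w. (\<integral>\<^sup>+r. (\<integral>\<^sup>+k. (\<integral>\<^sup>+s. h (real N * bilinear_value m a (shifted_mean p N v w) r k s)
      \<partial>gauss ({0} \<times> {m})) \<partial>gauss ({0} \<times> {..<m})) \<partial>gauss ({1} \<times> {..<Suc m})) \<partial>gauss ({..<p} \<times> {N}))"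
    unfolding G_def m_def
  proof (rule nn_integral_cong)
    fix w :: "nat \<times> nat \<Rightarrow> real"
    have hm: "(\<lambda>x. h (real N * x)) \<in> borel_measurable borel" using h by measurable
    show "(\<integral>\<^sup>+z. h (real N * (a \<bullet> (inv_mat (Matrix.mat p N z * transpose_mat (Matrix.mat p N z)) *\<^sub>v shifted_mean p N v w)))
        \<partial>gauss ({..<p} \<times> {..<N})) = (\<integral>\<^sup>+r. (\<integral>\<^sup>+k. (\<integral>\<^sup>+s. h (real N * bilinear_value (Suc N - p) a (shifted_mean p N v w) r k s)
      \<partial>gauss ({0} \<times> {Suc N - p})) \<partial>gauss ({0} \<times> {..<Suc N - p})) \<partial>gauss ({1} \<times> {..<Suc (Suc N - p)}))"
      by (rule bilinear_inv_gram_law[OF p a shifted_mean_carrier[OF v] a0 hm])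
  qed
  finally show ?thesis .
qed

text \<open>The factors carry, in this order, the column w of the mean and the families r, k, s of
  \<open>bilinear_value\<close>; the nesting follows the iterated integral in
  \<open>nn_integral_statistic\<close>.\<close>

definition reference_space :: "nat \<Rightarrow> nat \<Rightarrow>
    ((nat \<times> nat \<Rightarrow> real) \<times> (nat \<times> nat \<Rightarrow> real) \<times> (nat \<times> nat \<Rightarrow> real) \<times> (nat \<times> nat \<Rightarrow> real)) measure" where
  "reference_space p N = (let m = Suc N - p in
    gauss ({..<p} \<times> {N}) \<Otimes>\<^sub>M (gauss ({1} \<times> {..<Suc m}) \<Otimes>\<^sub>M (gauss ({0} \<times> {..<m}) \<Otimes>\<^sub>M gauss ({0} \<times> {m}))))"

lemma nn_integral_pair_prob:
  assumes "prob_space N" and "f \<in> borel_measurable (M \<Otimes>\<^sub>M N)"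
  shows "(\<integral>\<^sup>+x. f x \<partial>(M \<Otimes>\<^sub>M N)) = (\<integral>\<^sup>+x. (\<integral>\<^sup>+y. f (x, y) \<partial>N) \<partial>M)"
  using sigma_finite_measure.nn_integral_fst[OF prob_space_imp_sigma_finite[OF assms(1)] assms(2)] by simp

lemma nn_integral_pair_prob4:
  assumes "prob_space M2" "prob_space M3" "prob_space M4"
    and f: "f \<in> borel_measurable (M1 \<Otimes>\<^sub>M (M2 \<Otimes>\<^sub>M (M3 \<Otimes>\<^sub>M M4)))"
  shows "(\<integral>\<^sup>+x. f x \<partial>(M1 \<Otimes>\<^sub>M (M2 \<Otimes>\<^sub>M (M3 \<Otimes>\<^sub>M M4)))) =
    (\<integral>\<^sup>+x. (\<integral>\<^sup>+y. (\<integral>\<^sup>+z. (\<integral>\<^sup>+w. f (x, y, z, w) \<partial>M4) \<partial>M3) \<partial>M2) \<partial>M1)"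
proof -
  have f1: "(\<lambda>y. f (x, y)) \<in> borel_measurable (M2 \<Otimes>\<^sub>M (M3 \<Otimes>\<^sub>M M4))" if "x \<in> space M1" for x
    using measurable_compose[OF measurable_Pair1'[OF that] f] .
  have f2: "(\<lambda>z. f (x, y, z)) \<in> borel_measurable (M3 \<Otimes>\<^sub>M M4)" if "x \<in> space M1" "y \<in> space M2" for x y
    using measurable_compose[OF measurable_Pair1'[OF that(2)] f1[OF that(1)]] .
  show ?thesis
    using assms f1 f2
    by (simp add: nn_integral_pair_prob prob_space_pair cong: nn_integral_cong)
qed

lemma prob_space_reference_space: "prob_space (reference_space p N)"
  unfolding reference_space_def Let_def by (intro prob_space_pair prob_space_gauss)

lemma bilinear_value_measurable:
  fixes p N a v defines "m \<equiv> Suc N - p"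
  assumes a: "a \<in> carrier_vec p" and v: "v \<in> carrier_vec p"
  shows "(\<lambda>(w, r, k, s). bilinear_value m a (shifted_mean p N v w) r k s) \<in> borel_measurable (reference_space p N)"
proof -
  let ?R = "reference_space p N"
  have c1 [measurable]: "(\<lambda>x. fst x i) \<in> borel_measurable ?R" if "i \<in> {..<p} \<times> {N}" for i
    unfolding reference_space_def Let_def
    by (rule measurable_compose[OF measurable_fst gauss_component_measurable[OF that]])
  have c2 [measurable]: "(\<lambda>x. fst (snd x) i) \<in> borel_measurable ?R" if "i \<in> {1} \<times> {..<Suc m}" for i
    unfolding reference_space_def Let_def m_def[symmetric]
    by (rule measurable_compose[OF _ gauss_component_measurable[OF that]]) measurable
  have c3 [measurable]: "(\<lambda>x. fst (snd (snd x)) i) \<in> borel_measurable ?R" if "i \<in> {0} \<times> {..<m}" for i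
    unfolding reference_space_def Let_def m_def[symmetric]
    by (rule measurable_compose[OF _ gauss_component_measurable[OF that]]) measurable
  have c4 [measurable]: "(\<lambda>x. snd (snd (snd x)) i) \<in> borel_measurable ?R" if "i \<in> {0} \<times> {m}" for i
    unfolding reference_space_def Let_def m_def[symmetric]
    by (rule measurable_compose[OF _ gauss_component_measurable[OF that]]) measurable
  have sm: "(\<lambda>x. shifted_mean p N v (fst x) $ i) \<in> borel_measurable ?R" if i: "i < p" for i
  proof -
    have "(\<lambda>x. v $ i + fst x (i, N) / sqrt (real (Suc N))) \<in> borel_measurable ?R"
      using c1[of "(i, N)"] i by (intro borel_measurable_add borel_measurable_divide) auto
    then show ?thesis using i v by (simp add: shifted_mean_def del: of_nat_Suc)
  qed
  have ay: "(\<lambda>x. a \<bullet> shifted_mean p N v (fst x)) \<in> borel_measurable ?R"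
    by (rule scalar_prod_measurable[where p = p]) (use a v sm in auto)
  have yy: "(\<lambda>x. shifted_mean p N v (fst x) \<bullet> shifted_mean p N v (fst x)) \<in> borel_measurable ?R"
    by (rule scalar_prod_measurable[where p = p]) (use a v sm in auto)
  have pf: "(\<lambda>x. perp_factor a (shifted_mean p N v (fst x))) \<in> borel_measurable ?R"
    unfolding perp_factor_def using ay yy by measurable
  show ?thesis
    unfolding split_beta' bilinear_value_def
    by (intro borel_measurable_divide borel_measurable_diff borel_measurable_times borel_measurable_sum
        borel_measurable_power measurable_compose[OF _ borel_measurable_sqrt] ay pf c2 c3 c4) auto
qed

lemma distr_statistic:
  assumes p: "1 \<le> p" "p \<le> N" and a: "a \<in> carrier_vec p" and v: "v \<in> carrier_vec p" and a0: "a \<noteq> 0\<^sub>v p"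
  shows "distr (gauss ({..<p} \<times> {..<Suc N})) borel (\<lambda>z. statistic a v (Matrix.mat p (Suc N) z)) =
    distr (reference_space p N) borel (\<lambda>(w, r, k, s). real N * bilinear_value (Suc N - p) a (shifted_mean p N v w) r k s)"
    (is "distr ?G borel ?S = distr ?R borel ?B")
proof (rule measure_eqI)
  fix E assume "E \<in> sets (distr ?G borel ?S)"
  then have E: "E \<in> sets borel" by simp
  define h where "h = (indicator E :: real \<Rightarrow> ennreal)"
  have h: "h \<in> borel_measurable borel" using E by (simp add: h_def)
  have S: "?S \<in> borel_measurable ?G"
    by (rule statistic_measurable[where p = p and n = "Suc N"]) (use a v in \<open>auto intro: mat_measurable_gauss\<close>)
  have B: "?B \<in> borel_measurable ?R"
    using borel_measurable_times[OF borel_measurable_const bilinear_value_measurable[OF a v], of "real N" N]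
    by (simp add: split_beta')
  have hB: "(\<lambda>x. h (?B x)) \<in> borel_measurable ?R" by (rule measurable_compose[OF B h])
  have "emeasure (distr ?G borel ?S) E = (\<integral>\<^sup>+z. h (?S z) \<partial>?G)"
  proof -
    have "emeasure (distr ?G borel ?S) E = (\<integral>\<^sup>+x. h x \<partial>distr ?G borel ?S)" using E by (simp add: h_def)
    also have "\<dots> = (\<integral>\<^sup>+z. h (?S z) \<partial>?G)" by (rule nn_integral_distr[OF S]) (use h in simp)
    finally show ?thesis .
  qed
  also have "\<dots> = (\<integral>\<^sup>+x. h (?B x) \<partial>?R)"
    unfolding nn_integral_statistic[OF p a v a0 h]
    by (simp only: reference_space_def Let_def
        nn_integral_pair_prob4[OF prob_space_gauss prob_space_gauss prob_space_gauss hB[unfolded reference_space_def Let_def]] case_prod_conv)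
  also have "\<dots> = emeasure (distr ?R borel ?B) E"
  proof -
    have "emeasure (distr ?R borel ?B) E = (\<integral>\<^sup>+x. h x \<partial>distr ?R borel ?B)" using E by (simp add: h_def)
    also have "\<dots> = (\<integral>\<^sup>+z. h (?B z) \<partial>?R)" by (rule nn_integral_distr[OF B]) (use h in simp)
    finally show ?thesis by simp
  qed
  finally show "emeasure (distr ?G borel ?S) E = emeasure (distr ?R borel ?B) E" .
qed simp

section \<open>Second moments and characteristic functions\<close>

lemma std_normal_moments:
  "(LINT x|std_normal_distribution. x) = 0" "(LINT x|std_normal_distribution. x\<^sup>2) = 1"
  "(LINT x|std_normal_distribution. x ^ 4) = 3"
  "integrable std_normal_distribution (\<lambda>x. x)" "integrable std_normal_distribution (\<lambda>x. x ^ k)"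
  "integrable std_normal_distribution (\<lambda>x. \<bar>x\<bar> ^ k)"
proof -
  show "(LINT x|std_normal_distribution. x) = 0"
    using integral_std_normal_distribution_moment_odd[of 1] by simp
  show "(LINT x|std_normal_distribution. x\<^sup>2) = 1"
    using std_normal_distribution_even_moments(1)[of 1] by simp
  show "(LINT x|std_normal_distribution. x ^ 4) = 3"
    using std_normal_distribution_even_moments(1)[of 2] by (simp add: fact_numeral)
  show i: "integrable std_normal_distribution (\<lambda>x. x ^ k)" for k by (rule integrable_std_normal_distribution_moment)
  show "integrable std_normal_distribution (\<lambda>x. x)" using i[of 1] by simp
  show "integrable std_normal_distribution (\<lambda>x. \<bar>x\<bar> ^ k)"
    using integrable_abs[OF i[of k]] by (simp add: power_abs)
qed

lemma std_normal_square_moments: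
  "(LINT x|std_normal_distribution. x\<^sup>2 - 1) = 0" "(LINT x|std_normal_distribution. (x\<^sup>2 - 1)\<^sup>2) = 2"
  "integrable std_normal_distribution (\<lambda>x. x\<^sup>2 - 1)" "integrable std_normal_distribution (\<lambda>x. (x\<^sup>2 - 1)\<^sup>2)"
  "integrable std_normal_distribution (\<lambda>x. \<bar>x\<^sup>2 - 1\<bar> ^ 3)"
proof -
  have e: "(x\<^sup>2 - 1)\<^sup>2 = x ^ 4 - 2 * x\<^sup>2 + 1" for x :: real by (simp add: power2_eq_square power4_eq_xxxx algebra_simps)
  note [simp] = std_normal_moments std_normal.prob_space[simplified]
  show "(LINT x|std_normal_distribution. x\<^sup>2 - 1) = 0" by simp
  show "(LINT x|std_normal_distribution. (x\<^sup>2 - 1)\<^sup>2) = 2" unfolding e by simp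
  show "integrable std_normal_distribution (\<lambda>x. x\<^sup>2 - 1)" by simp
  show "integrable std_normal_distribution (\<lambda>x. (x\<^sup>2 - 1)\<^sup>2)" unfolding e by simp
  have p: "(x\<^sup>2 + 1) ^ 3 = x ^ 6 + 3 * x ^ 4 + 3 * x\<^sup>2 + 1" for x :: real
    by (simp add: eval_nat_numeral algebra_simps)
  have i: "integrable std_normal_distribution (\<lambda>x. (x\<^sup>2 + 1) ^ 3)" unfolding p by simp
  show "integrable std_normal_distribution (\<lambda>x. \<bar>x\<^sup>2 - 1\<bar> ^ 3)"
  proof (rule Bochner_Integration.integrable_bound[OF i])
    show "AE x in std_normal_distribution. norm (\<bar>x\<^sup>2 - 1\<bar> ^ 3) \<le> norm ((x\<^sup>2 + 1) ^ 3)"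
      by (intro AE_I2) (auto intro!: power_mono simp: abs_le_iff)
  qed simp
qed

text \<open>The summands are independent and centred, so the cross terms vanish. It serves linear
  forms with u x = x and centred chi-squared variables with u x = x^2 - 1.\<close>

lemma gauss_second_moment:
  fixes u :: "real \<Rightarrow> real" and c :: "'i \<Rightarrow> real"
  assumes "finite K" and u: "integrable std_normal_distribution u" "integrable std_normal_distribution (\<lambda>x. (u x)\<^sup>2)"
    and m: "(LINT x|std_normal_distribution. u x) = 0" and v: "(LINT x|std_normal_distribution. (u x)\<^sup>2) = v"
  shows "(\<integral>\<^sup>+x. ennreal ((\<Sum>i\<in>K. c i * u (x i))\<^sup>2) \<partial>gauss K) = ennreal (v * (\<Sum>i\<in>K. (c i)\<^sup>2))"
  using assms(1)
proof (induction K)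
  case empty
  then show ?case by simp
next
  case (insert i K)
  have um [measurable]: "u \<in> borel_measurable borel" using borel_measurable_integrable[OF u(1)] by simp
  have v0: "0 \<le> v" unfolding v[symmetric] by (rule integral_nonneg_AE) simp
  have meas: "(\<lambda>x. \<Sum>j\<in>J. c j * u (x j)) \<in> borel_measurable (gauss J)" for J :: "'i set"
    using um by (intro borel_measurable_sum borel_measurable_times borel_measurable_const)
      (rule measurable_compose[OF gauss_component_measurable], auto)
  have inner: "(\<integral>\<^sup>+y. ennreal ((s + d * u y)\<^sup>2) \<partial>std_normal_distribution) = ennreal (s\<^sup>2) + ennreal (d\<^sup>2 * v)" for s d :: real
  proof -
    have e: "(s + d * u y)\<^sup>2 = s\<^sup>2 + 2 * s * d * u y + d\<^sup>2 * (u y)\<^sup>2" for y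
      by (simp add: power2_eq_square algebra_simps)
    have "(\<integral>\<^sup>+y. ennreal ((s + d * u y)\<^sup>2) \<partial>std_normal_distribution) = ennreal (LINT y|std_normal_distribution. (s + d * u y)\<^sup>2)"
      by (rule nn_integral_eq_integral) (simp add: e u, simp)
    also have "(LINT y|std_normal_distribution. (s + d * u y)\<^sup>2) = s\<^sup>2 + d\<^sup>2 * v"
      unfolding e using u m v std_normal.prob_space by simp
    finally show ?thesis using v0 by (simp add: ennreal_plus)
  qed
  have "(\<integral>\<^sup>+x. ennreal ((\<Sum>j\<in>insert i K. c j * u (x j))\<^sup>2) \<partial>gauss (insert i K)) =
      (\<integral>\<^sup>+x. (\<integral>\<^sup>+y. ennreal ((\<Sum>j\<in>insert i K. c j * u ((x(i := y)) j))\<^sup>2) \<partial>std_normal_distribution) \<partial>gauss K)"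
    using meas[of "insert i K"] unfolding gauss_def
    by (intro std_normal_prod.product_nn_integral_insert insert.hyps) measurable
  also have "\<dots> = (\<integral>\<^sup>+x. (\<integral>\<^sup>+y. ennreal (((\<Sum>j\<in>K. c j * u (x j)) + c i * u y)\<^sup>2) \<partial>std_normal_distribution) \<partial>gauss K)"
  proof (intro nn_integral_cong arg_cong[where f = ennreal])
    fix x :: "'i \<Rightarrow> real" and y :: real
    have "(\<Sum>j\<in>K. c j * u ((x(i := y)) j)) = (\<Sum>j\<in>K. c j * u (x j))"
      by (rule sum.cong) (use insert.hyps in auto)
    then show "(\<Sum>j\<in>insert i K. c j * u ((x(i := y)) j))\<^sup>2 = ((\<Sum>j\<in>K. c j * u (x j)) + c i * u y)\<^sup>2"
      using insert.hyps by (simp add: add.commute)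
  qed
  also have "\<dots> = (\<integral>\<^sup>+x. ennreal ((\<Sum>j\<in>K. c j * u (x j))\<^sup>2) + ennreal ((c i)\<^sup>2 * v) \<partial>gauss K)"
    unfolding inner ..
  also have "\<dots> = (\<integral>\<^sup>+x. ennreal ((\<Sum>j\<in>K. c j * u (x j))\<^sup>2) \<partial>gauss K) + ennreal ((c i)\<^sup>2 * v)"
    using meas[of K] by (subst nn_integral_add) (auto simp: prob_space.emeasure_space_1[OF prob_space_gauss])
  also have "\<dots> = ennreal (v * (\<Sum>j\<in>insert i K. (c j)\<^sup>2))"
    using insert v0 by (simp add: ennreal_plus[symmetric] sum_nonneg algebra_simps del: ennreal_plus)
  finally show ?case .
qed

lemma char_gauss_linear:
  fixes c :: "'i \<Rightarrow> real"
  assumes K: "finite K"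
  shows "(CLINT x|gauss K. iexp (t * (\<Sum>i\<in>K. c i * x i))) = exp (- (t\<^sup>2 * (\<Sum>i\<in>K. (c i)\<^sup>2)) / 2)"
proof -
  have "iexp (t * (\<Sum>i\<in>K. c i * x i)) = (\<Prod>i\<in>K. iexp ((t * c i) * x i))" for x
    by (simp add: exp_sum[OF K, symmetric] sum_distrib_left sum_distrib_right mult.assoc)
  then have "(CLINT x|gauss K. iexp (t * (\<Sum>i\<in>K. c i * x i))) = (CLINT x|gauss K. (\<Prod>i\<in>K. iexp ((t * c i) * x i)))"
    by simp
  also have "\<dots> = (\<Prod>i\<in>K. CLINT x|std_normal_distribution. iexp ((t * c i) * x))"
    unfolding gauss_def
    by (rule std_normal_prod.product_integral_prod[OF K]) (auto intro!: std_normal.integrable_iexp)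
  also have "\<dots> = (\<Prod>i\<in>K. complex_of_real (exp (- ((t * c i)\<^sup>2) / 2)))"
  proof (intro prod.cong refl)
    fix i
    show "(CLINT x|std_normal_distribution. iexp ((t * c i) * x)) = complex_of_real (exp (- ((t * c i)\<^sup>2) / 2))"
      using char_std_normal_distribution[THEN fun_cong, of "t * c i"] unfolding char_def by simp
  qed
  also have "\<dots> = exp (- (t\<^sup>2 * (\<Sum>i\<in>K. (c i)\<^sup>2)) / 2)"
    by (simp add: exp_sum[OF K, symmetric] of_real_prod[symmetric] exp_of_real[symmetric] sum_distrib_left
        sum_negf sum_divide_distrib power_mult_distrib del: of_real_prod)
  finally show ?thesis .
qed

lemma char_third_order_bound:
  assumes u [measurable]: "u \<in> borel_measurable borel"
    and "integrable std_normal_distribution u" "integrable std_normal_distribution (\<lambda>x. (u x)\<^sup>2)"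
    and i3: "integrable std_normal_distribution (\<lambda>x. \<bar>u x\<bar> ^ 3)"
    and m: "(LINT x|std_normal_distribution. u x) = 0" and v: "(LINT x|std_normal_distribution. (u x)\<^sup>2) = v"
  shows "cmod ((CLINT x|std_normal_distribution. iexp (s * u x)) - (1 - s\<^sup>2 * v / 2)) \<le>
    \<bar>s\<bar> ^ 3 * (LINT x|std_normal_distribution. \<bar>u x\<bar> ^ 3)"
proof -
  let ?N = std_normal_distribution
  have "cmod (char (distr ?N borel u) s - (1 - s\<^sup>2 * v / 2)) \<le>
      (s\<^sup>2 / 6) * (LINT x|?N. min (6 * (u x)\<^sup>2) (\<bar>s\<bar> * \<bar>u x\<bar> ^ 3))"
    by (rule std_normal.char_approx3') (use assms in auto)
  also have "\<dots> \<le> (s\<^sup>2 / 6) * (LINT x|?N. \<bar>s\<bar> * \<bar>u x\<bar> ^ 3)"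
    using i3 assms(3)
    by (intro mult_left_mono integral_mono) (auto intro!: integrable_mult_right integrable_min)
  also have "\<dots> = (s\<^sup>2 * \<bar>s\<bar>) / 6 * (LINT x|?N. \<bar>u x\<bar> ^ 3)" by simp
  also have "\<dots> \<le> s\<^sup>2 * \<bar>s\<bar> * (LINT x|?N. \<bar>u x\<bar> ^ 3)"
    by (intro mult_right_mono integral_nonneg_AE) auto
  also have "s\<^sup>2 * \<bar>s\<bar> = \<bar>s\<bar> ^ 3" by (simp add: power2_eq_square power3_eq_cube abs_mult[symmetric])
  finally show ?thesis by (simp add: char_def integral_distr)
qed

text \<open>The chi-squared variable with \<open>card K\<close> degrees of freedom, standardised:
  each square has mean 1 and variance 2.\<close>

definition chi_norm :: "'i set \<Rightarrow> ('i \<Rightarrow> real) \<Rightarrow> real" where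
  "chi_norm K k = ((\<Sum>i\<in>K. (k i)\<^sup>2) - real (card K)) / sqrt (2 * real (card K))"

text \<open>A quantitative central limit theorem is needed since the degrees of freedom vary with n
  and the argument t is later multiplied by a coefficient depending on a and v. Both characteristic
  functions are m-th powers of numbers of modulus at most one, so they differ by at most m times the
  difference of the bases. The bases agree to second order, which leaves the third absolute moments
  of x^2 - 1 and x as constants.\<close>

lemma char_chi_norm:
  "\<exists>C \<ge> 0. \<forall>K :: 'i set. \<forall>t. finite K \<longrightarrow> K \<noteq> {} \<longrightarrow>
    cmod ((CLINT k|gauss K. iexp (t * chi_norm K k)) - exp (- t\<^sup>2 / 2)) \<le> C * \<bar>t\<bar> ^ 3 / sqrt (card K)"
proof -
  let ?N = std_normal_distribution
  define C1 where "C1 = (LINT x|?N. \<bar>x\<^sup>2 - 1\<bar> ^ 3)"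
  define C2 where "C2 = (LINT x|?N. \<bar>x\<bar> ^ 3)"
  have C0: "0 \<le> C1" "0 \<le> C2" unfolding C1_def C2_def by (auto intro!: integral_nonneg_AE)
  have "cmod ((CLINT k|gauss K. iexp (t * chi_norm K k)) - exp (- t\<^sup>2 / 2)) \<le> (C1 + C2) * \<bar>t\<bar> ^ 3 / sqrt (card K)"
    if K: "finite K" "K \<noteq> {}" for K :: "'i set" and t
  proof -
    define m where "m = real (card K)"
    have m: "m \<ge> 1" using K by (simp add: m_def Suc_le_eq card_gt_0_iff)
    define s where "s = t / sqrt (2 * m)"
    define r where "r = t / sqrt m"
    define \<psi> where "\<psi> = (CLINT x|?N. iexp (s * (x\<^sup>2 - 1)))"
    define e where "e = complex_of_real (exp (- r\<^sup>2 / 2))"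
    have "iexp (t * chi_norm K k) = (\<Prod>i\<in>K. iexp (s * ((k i)\<^sup>2 - 1)))" for k
    proof -
      have r: "t * chi_norm K k = (\<Sum>i\<in>K. s * ((k i)\<^sup>2 - 1))"
        by (simp only: sum_distrib_left[symmetric] sum_subtractf) (simp add: chi_norm_def s_def m_def)
      show ?thesis unfolding r by (simp only: of_real_sum sum_distrib_left exp_sum[OF K(1)])
    qed
    then have "(CLINT k|gauss K. iexp (t * chi_norm K k)) = (CLINT k|gauss K. (\<Prod>i\<in>K. iexp (s * ((k i)\<^sup>2 - 1))))"
      by simp
    also have "\<dots> = (\<Prod>i\<in>K. CLINT x|?N. iexp (s * (x\<^sup>2 - 1)))"
      unfolding gauss_def
      by (rule std_normal_prod.product_integral_prod[OF K(1)]) (auto intro!: std_normal.integrable_iexp)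
    also have "\<dots> = \<psi> ^ card K" by (simp add: \<psi>_def)
    finally have 1: "(CLINT k|gauss K. iexp (t * chi_norm K k)) = \<psi> ^ card K" .
    have "e ^ card K = complex_of_real (exp (m * (- r\<^sup>2 / 2)))"
      unfolding e_def of_real_power[symmetric] by (simp only: m_def exp_of_nat_mult)
    also have "m * (- r\<^sup>2 / 2) = - t\<^sup>2 / 2" using m by (simp add: r_def power_divide)
    finally have 2: "e ^ card K = complex_of_real (exp (- t\<^sup>2 / 2))" .
    have "cmod \<psi> \<le> 1"
    proof -
      have "cmod \<psi> \<le> (LINT x|?N. cmod (iexp (s * (x\<^sup>2 - 1))))"
        unfolding \<psi>_def by (rule integral_norm_bound)
      also have "\<dots> = 1" using std_normal.prob_space by simp
      finally show ?thesis .
    qed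
    moreover have "cmod e \<le> 1" by (simp add: e_def)
    ultimately have "cmod (\<psi> ^ card K - e ^ card K) \<le> m * cmod (\<psi> - e)"
      unfolding m_def by (rule norm_power_diff)
    also have "cmod (\<psi> - e) \<le> (C1 + C2) * (\<bar>t\<bar> ^ 3 / (m * sqrt m))"
    proof -
      have a: "cmod (\<psi> - (1 - s\<^sup>2 * 2 / 2)) \<le> \<bar>s\<bar> ^ 3 * C1"
        using char_third_order_bound[of "\<lambda>x. x\<^sup>2 - 1" 2 s] std_normal_square_moments
        unfolding \<psi>_def C1_def by simp
      have b: "cmod (e - (1 - r\<^sup>2 * 1 / 2)) \<le> \<bar>r\<bar> ^ 3 * C2"
      proof -
        have "e = (CLINT x|?N. iexp (r * x))"
          using char_std_normal_distribution[THEN fun_cong, of r] unfolding char_def e_def by (rule sym)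
        moreover have "cmod ((CLINT x|?N. iexp (r * x)) - (1 - r\<^sup>2 * 1 / 2)) \<le> \<bar>r\<bar> ^ 3 * C2"
          unfolding C2_def
          by (rule char_third_order_bound[OF measurable_ident_sets[OF refl] std_normal_moments(4) std_normal_moments(5)
              std_normal_moments(6) std_normal_moments(1) std_normal_moments(2)])
        ultimately show ?thesis by (rule ssubst)
      qed
      have sr: "s\<^sup>2 * 2 = r\<^sup>2" using m by (simp add: s_def r_def power_divide)
      have "cmod (\<psi> - e) \<le> cmod (\<psi> - (1 - s\<^sup>2 * 2 / 2)) + cmod (e - (1 - r\<^sup>2 * 1 / 2))"
        using norm_triangle_ineq4[of "\<psi> - (1 - s\<^sup>2 * 2 / 2)" "e - (1 - r\<^sup>2 * 1 / 2)"] sr by simp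
      also have "\<dots> \<le> \<bar>s\<bar> ^ 3 * C1 + \<bar>r\<bar> ^ 3 * C2" using a b by linarith
      also have "\<dots> \<le> \<bar>r\<bar> ^ 3 * C1 + \<bar>r\<bar> ^ 3 * C2"
      proof -
        have "sqrt m \<le> sqrt (2 * m)" "0 < sqrt m" using m by auto
        then have "\<bar>s\<bar> \<le> \<bar>r\<bar>" unfolding s_def r_def by (auto simp: abs_divide intro!: divide_left_mono)
        then have "\<bar>s\<bar> ^ 3 \<le> \<bar>r\<bar> ^ 3" by (intro power_mono) auto
        then show ?thesis using C0 by (intro add_right_mono mult_right_mono) auto
      qed
      also have "\<bar>r\<bar> ^ 3 = \<bar>t\<bar> ^ 3 / (m * sqrt m)"
        using m by (simp add: r_def abs_divide power_divide power3_eq_cube)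
      finally show ?thesis by (simp add: algebra_simps add_divide_distrib)
    qed
    then have "m * cmod (\<psi> - e) \<le> m * ((C1 + C2) * (\<bar>t\<bar> ^ 3 / (m * sqrt m)))"
      using m by (intro mult_left_mono) auto
    also have "\<dots> = (C1 + C2) * \<bar>t\<bar> ^ 3 / sqrt m" using m by simp
    finally show ?thesis unfolding 1 2 m_def using order.trans by blast
  qed
  then show ?thesis using C0 by (intro exI[of _ "C1 + C2"]) auto
qed

section \<open>Asymptotics with bounded noise\<close>

lemma inverse_sqrt_tendsto_zero: "(\<lambda>n. 1 / sqrt (real n)) \<longlonglongrightarrow> 0"
  by (intro tendsto_divide_0[OF tendsto_const] filterlim_at_top_imp_at_infinity
      filterlim_compose[OF sqrt_at_top filterlim_real_sequentially])

lemma bounded_times_null: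
  fixes x y :: "nat \<Rightarrow> real"
  assumes x: "\<And>n. \<bar>x n\<bar> \<le> K" and y: "y \<longlonglongrightarrow> 0"
  shows "(\<lambda>n. x n * y n) \<longlonglongrightarrow> 0"
proof (rule Lim_null_comparison)
  show "\<forall>\<^sub>F n in sequentially. norm (x n * y n) \<le> K * \<bar>y n\<bar>"
    by (rule always_eventually) (auto simp: abs_mult intro!: mult_right_mono x)
  show "(\<lambda>n. K * \<bar>y n\<bar>) \<longlonglongrightarrow> 0" using tendsto_mult_right_zero[OF tendsto_rabs_zero[OF y]] by simp
qed

text \<open>In the deterministic estimate below the perturbed radicand x may be negative. There
  \<open>sqrt\<close> is extended as an odd function; the factor 2 pays for this case.\<close>

lemma abs_sqrt_diff_le:
  assumes "0 \<le> y"
  shows "\<bar>sqrt x - sqrt y\<bar> \<le> 2 * sqrt \<bar>x - y\<bar>"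
proof (cases "0 \<le> x")
  case True
  have "\<bar>sqrt x - sqrt y\<bar> * \<bar>sqrt x - sqrt y\<bar> \<le> \<bar>sqrt x - sqrt y\<bar> * (sqrt x + sqrt y)"
    by (rule mult_left_mono) (use True assms in \<open>auto simp: abs_le_iff\<close>)
  also have "\<dots> = \<bar>(sqrt x - sqrt y) * (sqrt x + sqrt y)\<bar>" using True assms by (simp add: abs_mult)
  also have "(sqrt x - sqrt y) * (sqrt x + sqrt y) = x - y" using True assms by (simp add: algebra_simps)
  finally have "(sqrt x - sqrt y)\<^sup>2 \<le> \<bar>x - y\<bar>" by (simp add: power2_eq_square abs_mult[symmetric])
  then have "\<bar>sqrt x - sqrt y\<bar> \<le> sqrt \<bar>x - y\<bar>" by (rule real_le_rsqrt[of "\<bar>sqrt x - sqrt y\<bar>", simplified])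
  moreover have "0 \<le> sqrt \<bar>x - y\<bar>" by simp
  ultimately show ?thesis by linarith
next
  case False
  have "sqrt x = - sqrt (- x)" by (simp add: real_sqrt_minus)
  moreover have "sqrt (- x) \<le> sqrt \<bar>x - y\<bar>" "sqrt y \<le> sqrt \<bar>x - y\<bar>" using False assms by auto
  moreover have "0 \<le> sqrt (- x)" "0 \<le> sqrt y" using False assms by auto
  ultimately show ?thesis by linarith
qed

text \<open>The random variables are replaced by arbitrary sequences. Those that stand for noise are
  bounded by K, which holds outside an event of small probability. \<theta> and V may be unbounded,
  so everything is divided by \<tau>, which dominates 1, |\<theta>| and sqrt V.\<close>

context
  fixes \<kappa> K :: real and p :: "nat \<Rightarrow> nat" and \<theta> V z1 z2 Q g h s :: "nat \<Rightarrow> real"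
  assumes \<kappa>: "0 < \<kappa>" "\<kappa> \<le> 1"
    and rate: "(\<lambda>n. sqrt (real n) * (real (p n) / real n - (1 - \<kappa>))) \<longlonglongrightarrow> 0"
    and V: "\<And>n. (\<theta> n)\<^sup>2 \<le> V n"
    and bounds: "\<And>n. \<bar>z1 n\<bar> \<le> K" "\<And>n. \<bar>z2 n\<bar> \<le> K" "\<And>n. \<bar>Q n\<bar> \<le> K" "\<And>n. \<bar>g n\<bar> \<le> K" "\<And>n. \<bar>h n\<bar> \<le> K" "\<And>n. \<bar>s n\<bar> \<le> K"
begin

text \<open>In terms of the law of the statistic, X is \<xi> / n, Y is \<zeta> / n, and \<rho> is
  \<open>perp_factor\<close> divided by |a|. E is \<rho> with the noise dropped and p / n replaced
  by its limit 1 - \<kappa>. Up to the factor |a| / (\<kappa> sqrt \<kappa>), \<tau> is the scaling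
  \<open>sigma_tilde\<close>.\<close>

private definition "q n = (real n - real (p n)) / real n" for n
private definition "X n = (real n - real (p n) + sqrt (2 * (real n - real (p n))) * g n) / real n" for n
private definition "Y n = (real n - real (p n) + 1 + sqrt (real n) * h n) / real n" for n
private definition "\<tau> n = sqrt (1 + (\<theta> n)\<^sup>2 + V n)" for n
private definition "\<rho> n = sqrt (V n + 2 * sqrt (V n) * z2 n / sqrt (real n) + real (p n) / real n + Q n / sqrt (real n)
    - (\<theta> n + z1 n / sqrt (real n))\<^sup>2)" for n
private definition "E n = sqrt (V n - (\<theta> n)\<^sup>2 + (1 - \<kappa>))" for n

private lemma pos: "\<forall>\<^sub>F n in sequentially. real n > 0"
  by (simp add: eventually_gt_at_top)

private lemma bounded_inv_sqrt: "(\<And>n. \<bar>x n\<bar> \<le> K) \<Longrightarrow> (\<lambda>n. x n / sqrt (real n)) \<longlonglongrightarrow> 0"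
  using bounded_times_null[OF _ inverse_sqrt_tendsto_zero, of x K] by simp

private lemma ratio: "(\<lambda>n. real (p n) / real n - (1 - \<kappa>)) \<longlonglongrightarrow> 0"
proof (rule Lim_transform_eventually)
  show "(\<lambda>n. (sqrt (real n) * (real (p n) / real n - (1 - \<kappa>))) * (1 / sqrt (real n))) \<longlonglongrightarrow> 0"
    using tendsto_mult[OF rate inverse_sqrt_tendsto_zero] by simp
  show "\<forall>\<^sub>F n in sequentially. (sqrt (real n) * (real (p n) / real n - (1 - \<kappa>))) * (1 / sqrt (real n)) = real (p n) / real n - (1 - \<kappa>)"
    using pos by eventually_elim simp
qed

private lemma q_lim: "q \<longlonglongrightarrow> \<kappa>"
proof (rule Lim_transform_eventually)
  show "(\<lambda>n. \<kappa> - (real (p n) / real n - (1 - \<kappa>))) \<longlonglongrightarrow> \<kappa>"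
    using tendsto_diff[OF tendsto_const ratio, of \<kappa>] by simp
  show "\<forall>\<^sub>F n in sequentially. \<kappa> - (real (p n) / real n - (1 - \<kappa>)) = q n"
    using pos by eventually_elim (simp add: q_def field_simps)
qed

private lemma X_eq: "real n > 0 \<Longrightarrow> X n = q n + sqrt 2 * sqrt (q n) * (g n / sqrt (real n))"
proof -
  assume n: "real n > 0"
  have "sqrt (2 * (real n - real (p n))) = sqrt 2 * (sqrt (q n) * sqrt (real n))"
    using n unfolding real_sqrt_mult[symmetric] by (simp add: q_def)
  then have e: "X n = q n + sqrt 2 * (sqrt (q n) * sqrt (real n)) * g n / real n"
    by (simp add: X_def q_def add_divide_distrib)
  define t where "t = sqrt (real n)"
  have t: "t > 0" "real n = t * t" using n by (auto simp: t_def)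
  show ?thesis unfolding e t_def[symmetric] t(2) using t(1) by simp
qed

private lemma X_lim: "X \<longlonglongrightarrow> \<kappa>"
proof (rule Lim_transform_eventually)
  show "(\<lambda>n. q n + sqrt 2 * sqrt (q n) * (g n / sqrt (real n))) \<longlonglongrightarrow> \<kappa>"
    using tendsto_add[OF q_lim tendsto_mult[OF tendsto_mult[OF tendsto_const tendsto_real_sqrt[OF q_lim]] bounded_inv_sqrt[OF bounds(4)]], of "sqrt 2"]
    by simp
  show "\<forall>\<^sub>F n in sequentially. q n + sqrt 2 * sqrt (q n) * (g n / sqrt (real n)) = X n"
    using pos by eventually_elim (simp add: X_eq)
qed

private lemma Y_lim: "Y \<longlonglongrightarrow> \<kappa>"
proof (rule Lim_transform_eventually)
  have "(\<lambda>n. 1 / sqrt (real n) * (1 / sqrt (real n))) \<longlonglongrightarrow> 0" using tendsto_mult[OF inverse_sqrt_tendsto_zero inverse_sqrt_tendsto_zero] by simp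
  then show "(\<lambda>n. q n + 1 / sqrt (real n) * (1 / sqrt (real n)) + h n / sqrt (real n)) \<longlonglongrightarrow> \<kappa>"
    using tendsto_add[OF tendsto_add[OF q_lim] bounded_inv_sqrt[OF bounds(5)]] by fastforce
  show "\<forall>\<^sub>F n in sequentially. q n + 1 / sqrt (real n) * (1 / sqrt (real n)) + h n / sqrt (real n) = Y n"
    using pos
  proof eventually_elim
    case (elim n)
    define t where "t = sqrt (real n)"
    have t: "t > 0" "real n = t * t" using elim by (auto simp: t_def)
    show ?case
      unfolding Y_def q_def t_def[symmetric] t(2) using t(1) by (simp add: field_simps)
  qed
qed

private lemma X_nonzero: "\<forall>\<^sub>F n in sequentially. X n > 0"
  using order_tendstoD(1)[OF X_lim \<kappa>(1)] .

private lemma ratio_lim: "(\<lambda>n. (real n - 1) / (real n * X n)) \<longlonglongrightarrow> 1 / \<kappa>"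
proof (rule Lim_transform_eventually)
  have "(\<lambda>n. 1 - 1 / sqrt (real n) * (1 / sqrt (real n))) \<longlonglongrightarrow> 1 - 0 * 0"
    by (intro tendsto_intros inverse_sqrt_tendsto_zero)
  then show "(\<lambda>n. (1 - 1 / sqrt (real n) * (1 / sqrt (real n))) / X n) \<longlonglongrightarrow> 1 / \<kappa>"
    using tendsto_divide[OF _ X_lim] \<kappa> by fastforce
  show "\<forall>\<^sub>F n in sequentially. (1 - 1 / sqrt (real n) * (1 / sqrt (real n))) / X n = (real n - 1) / (real n * X n)"
    using pos by eventually_elim (simp add: field_simps)
qed

text \<open>The delta method for the reciprocal of \<xi>: X fluctuates around \<kappa> by sqrt (2
  \<kappa> / n) g, so 1 / X fluctuates around 1 / \<kappa> by the negative of this over \<kappa>^2.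
  The full rate o(n^(-1/2)) is spent here, since the error of p / n as an approximation of c is
  multiplied by sqrt n.\<close>

private lemma centred_lim:
  "(\<lambda>n. \<kappa> * sqrt \<kappa> * (sqrt (real n) * ((real n - 1) / (real n * X n) - 1 / \<kappa>)) + sqrt 2 * g n) \<longlonglongrightarrow> 0"
proof (rule Lim_transform_eventually)
  let ?r = "\<lambda>n. sqrt (real n) * (real (p n) / real n - (1 - \<kappa>))"
  have 1: "(\<lambda>n. \<kappa> * sqrt \<kappa> / X n * (?r n / \<kappa> - 1 / sqrt (real n))) \<longlonglongrightarrow> \<kappa> * sqrt \<kappa> / \<kappa> * (0 / \<kappa> - 0)"
    using \<kappa> by (intro tendsto_intros X_lim rate inverse_sqrt_tendsto_zero) auto
  have "(\<lambda>n. sqrt 2 * (1 - sqrt \<kappa> * sqrt (q n) / X n)) \<longlonglongrightarrow> sqrt 2 * (1 - sqrt \<kappa> * sqrt \<kappa> / \<kappa>)"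
    using \<kappa> by (intro tendsto_intros X_lim q_lim) auto
  then have "(\<lambda>n. g n * (sqrt 2 * (1 - sqrt \<kappa> * sqrt (q n) / X n))) \<longlonglongrightarrow> 0"
    using \<kappa> by (intro bounded_times_null[OF bounds(4)]) simp
  with 1 show "(\<lambda>n. \<kappa> * sqrt \<kappa> / X n * (?r n / \<kappa> - 1 / sqrt (real n)) + g n * (sqrt 2 * (1 - sqrt \<kappa> * sqrt (q n) / X n))) \<longlonglongrightarrow> 0"
    using tendsto_add by fastforce
  show "\<forall>\<^sub>F n in sequentially. \<kappa> * sqrt \<kappa> / X n * (?r n / \<kappa> - 1 / sqrt (real n)) + g n * (sqrt 2 * (1 - sqrt \<kappa> * sqrt (q n) / X n)) =
      \<kappa> * sqrt \<kappa> * (sqrt (real n) * ((real n - 1) / (real n * X n) - 1 / \<kappa>)) + sqrt 2 * g n"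
    using pos X_nonzero
  proof eventually_elim
    case (elim n)
    define t where "t = sqrt (real n)"
    have t: "t > 0" "real n = t * t" using elim by (auto simp: t_def)
    have qn: "q n = 1 - real (p n) / real n" using elim by (simp add: q_def field_simps)
    have gx: "g n * sqrt 2 * sqrt (q n) = t * (X n - q n)"
      using elim t by (simp add: X_eq t_def[symmetric])
    have "t * ((real n - 1) / (real n * X n) - 1 / \<kappa>) = (t - 1 / t - t * X n / \<kappa>) / X n"
      using elim t \<kappa> by (simp add: field_simps)
    also have "t - 1 / t - t * X n / \<kappa> = ?r n / \<kappa> - 1 / t - g n * sqrt 2 * sqrt (q n) / \<kappa>"
      unfolding gx using \<kappa> by (simp add: qn t_def[symmetric] field_simps)
    finally have fin: "t * ((real n - 1) / (real n * X n) - 1 / \<kappa>) = (?r n / \<kappa> - 1 / t - g n * sqrt 2 * sqrt (q n) / \<kappa>) / X n" .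
    define A where "A = ?r n / \<kappa> - 1 / t"
    have "\<kappa> * sqrt \<kappa> / X n * A + g n * (sqrt 2 * (1 - sqrt \<kappa> * sqrt (q n) / X n)) =
        \<kappa> * sqrt \<kappa> * ((A - g n * sqrt 2 * sqrt (q n) / \<kappa>) / X n) + sqrt 2 * g n"
      using elim(2) \<kappa> by (simp add: field_simps)
    then show ?case using fin unfolding A_def t_def by simp
  qed
qed

private lemma tau_pos: "\<tau> n \<ge> 1"
proof -
  have "0 \<le> V n" using V[of n] zero_le_power2 order.trans by blast
  then show ?thesis by (simp add: \<tau>_def)
qed

private lemma theta_tau: "\<bar>\<theta> n / \<tau> n\<bar> \<le> 1" and inv_tau: "\<bar>1 / \<tau> n\<bar> \<le> 1" and E_tau: "\<bar>E n / \<tau> n\<bar> \<le> 1"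
  and theta_tau2: "\<bar>\<theta> n / (\<tau> n)\<^sup>2\<bar> \<le> 1" and V_tau2: "\<bar>sqrt (V n) / (\<tau> n)\<^sup>2\<bar> \<le> 1" and inv_tau2: "\<bar>1 / (\<tau> n)\<^sup>2\<bar> \<le> 1"
proof -
  have v: "0 \<le> V n" using V[of n] zero_le_power2 order.trans by blast
  have t: "\<tau> n \<ge> 1" by (rule tau_pos)
  have tt: "\<tau> n \<le> (\<tau> n)\<^sup>2" using t by (simp add: power2_eq_square)
  have th: "\<bar>\<theta> n\<bar> \<le> \<tau> n" unfolding \<tau>_def by (rule real_le_rsqrt) (use v in auto)
  have sv: "sqrt (V n) \<le> \<tau> n" unfolding \<tau>_def by (simp add: add_increasing)
  have En: "E n \<le> \<tau> n" unfolding E_def \<tau>_def using \<kappa> by (simp add: add_increasing)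
      (smt (verit) zero_le_power2)
  have E0: "0 \<le> E n" unfolding E_def using V[of n] \<kappa> by simp
  show "\<bar>\<theta> n / \<tau> n\<bar> \<le> 1" "\<bar>1 / \<tau> n\<bar> \<le> 1" "\<bar>E n / \<tau> n\<bar> \<le> 1" using t th En E0 by (auto simp: abs_divide)
  show "\<bar>\<theta> n / (\<tau> n)\<^sup>2\<bar> \<le> 1" "\<bar>sqrt (V n) / (\<tau> n)\<^sup>2\<bar> \<le> 1" "\<bar>1 / (\<tau> n)\<^sup>2\<bar> \<le> 1"
    using t tt th sv v by (auto simp: abs_divide divide_le_eq_1)
qed

text \<open>The radicands of \<rho> and E differ by noise terms of size at most sqrt V, |\<theta>|
  or 1, each carrying a factor 1 / sqrt n, and by the error of p / n. Divided by \<tau>^2 this tends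
  to zero however large \<theta> and V are; \<open>abs_sqrt_diff_le\<close> transfers it to the
  roots.\<close>

private lemma rho_lim: "(\<lambda>n. \<rho> n / \<tau> n - E n / \<tau> n) \<longlonglongrightarrow> 0"
proof (rule Lim_null_comparison)
  define a where "a n = (V n + 2 * sqrt (V n) * z2 n / sqrt (real n) + real (p n) / real n + Q n / sqrt (real n)
    - (\<theta> n + z1 n / sqrt (real n))\<^sup>2)" for n
  define D where "D n = (a n - (V n - (\<theta> n)\<^sup>2 + (1 - \<kappa>))) / (\<tau> n)\<^sup>2" for n
  have D_eq: "D n = 2 * (sqrt (V n) / (\<tau> n)\<^sup>2 * (z2 n / sqrt (real n))) + 1 / (\<tau> n)\<^sup>2 * (real (p n) / real n - (1 - \<kappa>))
      + 1 / (\<tau> n)\<^sup>2 * (Q n / sqrt (real n)) - 2 * (\<theta> n / (\<tau> n)\<^sup>2 * (z1 n / sqrt (real n)))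
      - 1 / (\<tau> n)\<^sup>2 * (z1 n / sqrt (real n) * (z1 n / sqrt (real n)))" for n
    unfolding D_def a_def divide_inverse by (simp add: power2_eq_square algebra_simps)
  have "D \<longlonglongrightarrow> 2 * 0 + 0 + 0 - 2 * 0 - 0"
    unfolding D_eq
  proof (intro tendsto_add tendsto_diff tendsto_mult_left)
    show "(\<lambda>n. sqrt (V n) / (\<tau> n)\<^sup>2 * (z2 n / sqrt (real n))) \<longlonglongrightarrow> 0"
      by (rule bounded_times_null[OF V_tau2 bounded_inv_sqrt[OF bounds(2)]])
    show "(\<lambda>n. 1 / (\<tau> n)\<^sup>2 * (real (p n) / real n - (1 - \<kappa>))) \<longlonglongrightarrow> 0"
      by (rule bounded_times_null[OF inv_tau2 ratio])
    show "(\<lambda>n. 1 / (\<tau> n)\<^sup>2 * (Q n / sqrt (real n))) \<longlonglongrightarrow> 0"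
      by (rule bounded_times_null[OF inv_tau2 bounded_inv_sqrt[OF bounds(3)]])
    show "(\<lambda>n. \<theta> n / (\<tau> n)\<^sup>2 * (z1 n / sqrt (real n))) \<longlonglongrightarrow> 0"
      by (rule bounded_times_null[OF theta_tau2 bounded_inv_sqrt[OF bounds(1)]])
    show "(\<lambda>n. 1 / (\<tau> n)\<^sup>2 * (z1 n / sqrt (real n) * (z1 n / sqrt (real n)))) \<longlonglongrightarrow> 0"
      using tendsto_mult[OF bounded_inv_sqrt[OF bounds(1)] bounded_inv_sqrt[OF bounds(1)]]
      by (intro bounded_times_null[OF inv_tau2]) simp
  qed
  then have D0: "D \<longlonglongrightarrow> 0" by simp
  show "(\<lambda>n. 2 * sqrt \<bar>D n\<bar>) \<longlonglongrightarrow> 0"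
    using tendsto_mult_right_zero[OF tendsto_real_sqrt[OF tendsto_rabs_zero[OF D0], simplified]] by simp
  show "\<forall>\<^sub>F n in sequentially. norm (\<rho> n / \<tau> n - E n / \<tau> n) \<le> 2 * sqrt \<bar>D n\<bar>"
  proof (rule always_eventually, rule allI)
    fix n
    have t: "\<tau> n > 0" using tau_pos[of n] by simp
    have st: "sqrt ((\<tau> n)\<^sup>2) = \<tau> n" using t by simp
    have "\<rho> n / \<tau> n = sqrt (a n / (\<tau> n)\<^sup>2)" "E n / \<tau> n = sqrt ((V n - (\<theta> n)\<^sup>2 + (1 - \<kappa>)) / (\<tau> n)\<^sup>2)"
      unfolding real_sqrt_divide st by (simp_all add: \<rho>_def a_def E_def)
    moreover have "0 \<le> (V n - (\<theta> n)\<^sup>2 + (1 - \<kappa>)) / (\<tau> n)\<^sup>2" using V[of n] \<kappa> by simp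
    ultimately show "norm (\<rho> n / \<tau> n - E n / \<tau> n) \<le> 2 * sqrt \<bar>D n\<bar>"
      using abs_sqrt_diff_le[of "(V n - (\<theta> n)\<^sup>2 + (1 - \<kappa>)) / (\<tau> n)\<^sup>2" "a n / (\<tau> n)\<^sup>2"]
      by (simp add: D_def diff_divide_distrib)
  qed
qed

private lemma scale_lim: "(\<lambda>n. sqrt (real n) / sqrt (real n * Y n)) \<longlonglongrightarrow> 1 / sqrt \<kappa>"
proof (rule Lim_transform_eventually)
  show "(\<lambda>n. 1 / sqrt (Y n)) \<longlonglongrightarrow> 1 / sqrt \<kappa>" using \<kappa> by (intro tendsto_intros Y_lim) auto
  show "\<forall>\<^sub>F n in sequentially. 1 / sqrt (Y n) = sqrt (real n) / sqrt (real n * Y n)"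
    using pos by eventually_elim (simp add: real_sqrt_mult)
qed

text \<open>The difference splits into a term in \<theta> / \<tau>, where the fluctuation of 1 /
  \<xi> produces g, a term in z1 / \<tau>, and a term in s \<rho> / \<tau>. In each of them bounded
  quotients and bounded noise multiply null sequences.\<close>

lemma standardised_limit:
  "(\<lambda>n. \<kappa> * sqrt \<kappa> * (sqrt (real n) / sqrt (1 + (\<theta> n)\<^sup>2 + V n)) *
      ((real n - 1) * (\<theta> n + z1 n / sqrt (real n) -
        sqrt (V n + 2 * sqrt (V n) * z2 n / sqrt (real n) + real (p n) / real n + Q n / sqrt (real n)
          - (\<theta> n + z1 n / sqrt (real n))\<^sup>2) * s n / sqrt (real n - real (p n) + 1 + sqrt (real n) * h n)) /
        (real n - real (p n) + sqrt (2 * (real n - real (p n))) * g n) - \<theta> n / \<kappa>)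
    - (- sqrt 2 * (\<theta> n / sqrt (1 + (\<theta> n)\<^sup>2 + V n)) * g n + sqrt \<kappa> * (1 / sqrt (1 + (\<theta> n)\<^sup>2 + V n)) * z1 n
       - sqrt (V n - (\<theta> n)\<^sup>2 + (1 - \<kappa>)) / sqrt (1 + (\<theta> n)\<^sup>2 + V n) * s n)) \<longlonglongrightarrow> 0"
  (is "?F \<longlonglongrightarrow> 0")
proof (rule Lim_transform_eventually)
  let ?R = "\<lambda>n. (real n - 1) / (real n * X n)" and ?S = "\<lambda>n. sqrt (real n) / sqrt (real n * Y n)"
  let ?C = "\<lambda>n. \<kappa> * sqrt \<kappa> * (sqrt (real n) * (?R n - 1 / \<kappa>)) + sqrt 2 * g n"
  have kk: "\<kappa> * sqrt \<kappa> * (1 / \<kappa>) = sqrt \<kappa>" "\<kappa> * sqrt \<kappa> * (1 / \<kappa>) * (1 / sqrt \<kappa>) = 1" using \<kappa> by auto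
  have 1: "(\<lambda>n. \<theta> n / \<tau> n * ?C n) \<longlonglongrightarrow> 0" by (rule bounded_times_null[OF theta_tau centred_lim])
  have "(\<lambda>n. \<kappa> * sqrt \<kappa> * ?R n - sqrt \<kappa>) \<longlonglongrightarrow> \<kappa> * sqrt \<kappa> * (1 / \<kappa>) - sqrt \<kappa>"
    by (intro tendsto_intros ratio_lim)
  then have "(\<lambda>n. \<kappa> * sqrt \<kappa> * ?R n - sqrt \<kappa>) \<longlonglongrightarrow> 0" unfolding kk by simp
  then have 2: "(\<lambda>n. 1 / \<tau> n * (z1 n * (\<kappa> * sqrt \<kappa> * ?R n - sqrt \<kappa>))) \<longlonglongrightarrow> 0"
    by (intro bounded_times_null[OF inv_tau] bounded_times_null[OF bounds(1)])
  have "(\<lambda>n. \<kappa> * sqrt \<kappa> * ?R n * ?S n) \<longlonglongrightarrow> \<kappa> * sqrt \<kappa> * (1 / \<kappa>) * (1 / sqrt \<kappa>)"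
    by (intro tendsto_intros ratio_lim scale_lim)
  then have w: "(\<lambda>n. \<kappa> * sqrt \<kappa> * ?R n * ?S n) \<longlonglongrightarrow> 1" unfolding kk(2) .
  have "(\<lambda>n. \<kappa> * sqrt \<kappa> * ?R n * ?S n - 1) \<longlonglongrightarrow> 1 - 1" by (intro tendsto_intros w)
  then have "(\<lambda>n. E n / \<tau> n * (\<kappa> * sqrt \<kappa> * ?R n * ?S n - 1)) \<longlonglongrightarrow> 0"
    by (intro bounded_times_null[OF E_tau]) simp
  moreover have "(\<lambda>n. \<kappa> * sqrt \<kappa> * ?R n * ?S n * (\<rho> n / \<tau> n - E n / \<tau> n)) \<longlonglongrightarrow> 1 * 0"
    by (intro tendsto_mult w rho_lim)
  ultimately have "(\<lambda>n. E n / \<tau> n * (\<kappa> * sqrt \<kappa> * ?R n * ?S n - 1) + \<kappa> * sqrt \<kappa> * ?R n * ?S n * (\<rho> n / \<tau> n - E n / \<tau> n)) \<longlonglongrightarrow> 0 + 1 * 0"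
    by (rule tendsto_add)
  then have 3: "(\<lambda>n. s n * (E n / \<tau> n * (\<kappa> * sqrt \<kappa> * ?R n * ?S n - 1) + \<kappa> * sqrt \<kappa> * ?R n * ?S n * (\<rho> n / \<tau> n - E n / \<tau> n))) \<longlonglongrightarrow> 0"
    by (intro bounded_times_null[OF bounds(6)]) simp
  show "(\<lambda>n. \<theta> n / \<tau> n * ?C n + 1 / \<tau> n * (z1 n * (\<kappa> * sqrt \<kappa> * ?R n - sqrt \<kappa>)) -
      s n * (E n / \<tau> n * (\<kappa> * sqrt \<kappa> * ?R n * ?S n - 1) + \<kappa> * sqrt \<kappa> * ?R n * ?S n * (\<rho> n / \<tau> n - E n / \<tau> n))) \<longlonglongrightarrow> 0"
    using tendsto_diff[OF tendsto_add[OF 1 2] 3] by simp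
  show "\<forall>\<^sub>F n in sequentially. \<theta> n / \<tau> n * ?C n + 1 / \<tau> n * (z1 n * (\<kappa> * sqrt \<kappa> * ?R n - sqrt \<kappa>)) -
      s n * (E n / \<tau> n * (\<kappa> * sqrt \<kappa> * ?R n * ?S n - 1) + \<kappa> * sqrt \<kappa> * ?R n * ?S n * (\<rho> n / \<tau> n - E n / \<tau> n)) = ?F n"
    using pos
  proof eventually_elim
    case (elim n)
    have X': "real n - real (p n) + sqrt (2 * (real n - real (p n))) * g n = real n * X n" using elim by (simp add: X_def)
    have Y': "real n - real (p n) + 1 + sqrt (real n) * h n = real n * Y n" using elim by (simp add: Y_def)
    define t where "t = sqrt (real n)"
    define i where "i = inverse t"
    have ti: "t * i = 1" using elim by (simp add: t_def i_def)
    \<comment> \<open>With all reciprocals named, the claim is a polynomial identity in which t * i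
      = 1 is the only relation used. In particular it does not matter whether X n or Y n
      vanishes.\<close>
    define x where "x = inverse (real n * X n)"
    define y where "y = inverse (sqrt (real n * Y n))"
    define u where "u = inverse (\<tau> n)"
    define k where "k = inverse \<kappa>"
    have R: "?R n = (real n - 1) * x" by (simp add: x_def divide_inverse)
    have ti': "t * (i * w) = w" "i * (t * w) = w" for w using ti by (simp_all add: mult.assoc[symmetric] mult.commute)
    show ?case
      unfolding X' Y' \<tau>_def[symmetric] \<rho>_def[symmetric] E_def[symmetric] R
      unfolding divide_inverse t_def[symmetric] i_def[symmetric] x_def[symmetric] y_def[symmetric] u_def[symmetric] k_def[symmetric]
      by (simp add: algebra_simps ti')
  qed
qed

end

text \<open>If the bound failed for infinitely many n, choosing at each such n a point where it
  fails would give a sequence along which D does not tend to zero. This turns limits along arbitrary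
  sequences, which are easy to compute, into uniform convergence.\<close>

lemma uniform_of_sequences:
  fixes D :: "nat \<Rightarrow> 'b \<Rightarrow> real"
  assumes lim: "\<And>x. (\<And>n. x n \<in> A) \<Longrightarrow> (\<lambda>n. D n (x n)) \<longlonglongrightarrow> 0" and e: "0 < \<epsilon>"
  shows "\<forall>\<^sub>F n in sequentially. \<forall>y\<in>A. \<bar>D n y\<bar> < \<epsilon>"
proof (cases "A = {}")
  case False
  then obtain a where a: "a \<in> A" by blast
  define x where "x n = (if \<exists>y\<in>A. \<epsilon> \<le> \<bar>D n y\<bar> then SOME y. y \<in> A \<and> \<epsilon> \<le> \<bar>D n y\<bar> else a)" for n
  have x: "x n \<in> A \<and> ((\<exists>y\<in>A. \<epsilon> \<le> \<bar>D n y\<bar>) \<longrightarrow> \<epsilon> \<le> \<bar>D n (x n)\<bar>)" for n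
  proof (cases "\<exists>y\<in>A. \<epsilon> \<le> \<bar>D n y\<bar>")
    case True
    then have "\<exists>y. y \<in> A \<and> \<epsilon> \<le> \<bar>D n y\<bar>" by blast
    from someI_ex[OF this] True show ?thesis by (simp add: x_def)
  qed (auto simp: x_def a)
  have "\<forall>\<^sub>F n in sequentially. \<bar>D n (x n)\<bar> < \<epsilon>"
    using tendstoD[OF lim[of x] e] x by (simp add: dist_real_def)
  then show ?thesis
    by eventually_elim (use x in \<open>meson not_less\<close>)
qed simp

section \<open>Uniform convergence of characteristic functions\<close>

lemma integral_pair_prob_mult:
  fixes f :: "'a \<Rightarrow> complex" and g :: "'b \<Rightarrow> complex"
  assumes M: "prob_space M" and N: "prob_space N"
    and f: "f \<in> borel_measurable M" "\<And>x. cmod (f x) \<le> 1"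
    and g: "g \<in> borel_measurable N" "\<And>x. cmod (g x) \<le> 1"
  shows "(CLINT x|M \<Otimes>\<^sub>M N. f (fst x) * g (snd x)) = (CLINT x|M. f x) * (CLINT y|N. g y)"
proof -
  interpret M: prob_space M by (rule M)
  interpret N: prob_space N by (rule N)
  interpret P: pair_prob_space M N ..
  have m: "(\<lambda>x. f (fst x) * g (snd x)) \<in> borel_measurable (M \<Otimes>\<^sub>M N)"
    using f(1) g(1) by measurable
  have "integrable (M \<Otimes>\<^sub>M N) (\<lambda>x. f (fst x) * g (snd x))"
    by (rule P.integrable_const_bound[where B = 1])
       (use m f(2) g(2) in \<open>auto simp: norm_mult intro!: mult_le_one\<close>)
  from P.integral_fst'[OF this]
  have "(CLINT x|M \<Otimes>\<^sub>M N. f (fst x) * g (snd x)) = (CLINT x|M. (CLINT y|N. f x * g y))" by simp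
  also have "\<dots> = (CLINT x|M. f x * (CLINT y|N. g y))" by simp
  finally show ?thesis by simp
qed

lemma sum_times_singleton: "(\<Sum>ij\<in>A \<times> {N}. f ij) = (\<Sum>i\<in>A. f (i, N))"
  and sum_singleton_times: "(\<Sum>ij\<in>{N} \<times> A. f ij) = (\<Sum>j\<in>A. f (N, j))"
  by (simp_all add: sum.cartesian_product')

lemma scalar_prod_eq_sum:
  fixes x y :: "real Matrix.vec"
  shows "y \<in> carrier_vec p \<Longrightarrow> x \<bullet> y = (\<Sum>i<p. x $ i * y $ i)"
  by (simp add: scalar_prod_def lessThan_atLeast0)

lemma scalar_prod_Cauchy_Schwarz:
  fixes x y :: "real Matrix.vec"
  assumes x: "x \<in> carrier_vec p" and y: "y \<in> carrier_vec p"
  shows "(x \<bullet> y)\<^sup>2 \<le> (x \<bullet> x) * (y \<bullet> y)"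
  using Cauchy_Schwarz_ineq_sum[of "\<lambda>i. x $ i" "\<lambda>i. y $ i" "{..<p}"]
  by (simp add: scalar_prod_eq_sum[OF x] scalar_prod_eq_sum[OF y] power2_eq_square)

lemma iexp_diff_le: "cmod (iexp x - iexp y) \<le> min 2 \<bar>x - y\<bar>"
proof -
  have "cmod (iexp x - iexp y) \<le> cmod (iexp x) + cmod (iexp y)" by (rule norm_triangle_ineq4)
  then have 1: "cmod (iexp x - iexp y) \<le> 2" by simp
  have "iexp x - iexp y = iexp y * (iexp (x - y) - 1)"
    by (simp add: algebra_simps exp_add[symmetric])
  then have "cmod (iexp x - iexp y) = cmod (iexp (x - y) - 1)" by (simp add: norm_mult)
  also have "\<dots> \<le> \<bar>x - y\<bar>" using iexp_approx1[of "x - y" 0] by simp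
  finally show ?thesis using 1 by simp
qed

text \<open>The normalised statistic after whitening, with \<kappa> = 1 - c: the bilinear forms in
  the inverse of \<Sigma> have become scalar products of a and v, and y stands for the value of the
  statistic.\<close>

definition standardised :: "real \<Rightarrow> nat \<Rightarrow> nat \<Rightarrow> real Matrix.vec \<Rightarrow> real Matrix.vec \<Rightarrow> real \<Rightarrow> real" where
  "standardised \<kappa> n p a v y = sqrt (real n) *
     inverse (sqrt (1 / \<kappa> ^ 3 * ((a \<bullet> v)\<^sup>2 + (a \<bullet> a) * (1 + v \<bullet> v)))) * (y - 1 / \<kappa> * (a \<bullet> v))"

text \<open>
  In the following two expressions, \<open>\<theta> = a \<bullet> v / |a|\<close>, \<open>V = |v|\<^sup>2\<close>, \<open>z1 = a \<bullet> z / |a|\<close>, \<open>z2 = v \<bullet> z / |v|\<close>,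
  and \<open>Q\<close>, \<open>g\<close>, \<open>h\<close> are the normalised squared norm \<open>|z|\<^sup>2\<close> and the normalised chi-squared variables
  \<open>\<xi>\<close> and \<open>\<zeta>\<close>; all but \<open>\<theta>\<close> and \<open>V\<close> have bounded second moments.
\<close>

definition stat_expr :: "real \<Rightarrow> nat \<Rightarrow> nat \<Rightarrow> real \<times> real \<times> real \<times> real \<times> real \<times> real \<times> real \<times> real \<Rightarrow> real" where
  "stat_expr \<kappa> p n = (\<lambda>(\<theta>, V, z1, z2, Q, g, h, s).
     \<kappa> * sqrt \<kappa> * (sqrt (real n) / sqrt (1 + \<theta>\<^sup>2 + V)) *
      ((real n - 1) * (\<theta> + z1 / sqrt (real n) -
        sqrt (V + 2 * sqrt V * z2 / sqrt (real n) + real p / real n + Q / sqrt (real n)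
          - (\<theta> + z1 / sqrt (real n))\<^sup>2) * s / sqrt (real n - real p + 1 + sqrt (real n) * h)) /
        (real n - real p + sqrt (2 * (real n - real p)) * g) - \<theta> / \<kappa>))"

definition limit_expr :: "real \<Rightarrow> real \<times> real \<times> real \<times> real \<times> real \<times> real \<times> real \<times> real \<Rightarrow> real" where
  "limit_expr \<kappa> = (\<lambda>(\<theta>, V, z1, z2, Q, g, h, s).
     - sqrt 2 * (\<theta> / sqrt (1 + \<theta>\<^sup>2 + V)) * g + sqrt \<kappa> * (1 / sqrt (1 + \<theta>\<^sup>2 + V)) * z1
       - sqrt (V - \<theta>\<^sup>2 + (1 - \<kappa>)) / sqrt (1 + \<theta>\<^sup>2 + V) * s)"

text \<open>The threshold on n depends on K and \<epsilon> but not on \<theta> and V, which range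
  over an unbounded set restricted only by Cauchy-Schwarz.\<close>

lemma stat_expr_limit:
  fixes p :: "nat \<Rightarrow> nat"
  assumes \<kappa>: "0 < \<kappa>" "\<kappa> \<le> 1"
    and rate: "(\<lambda>n. sqrt (real n) * (real (p n) / real n - (1 - \<kappa>))) \<longlonglongrightarrow> 0" and e: "0 < \<epsilon>"
  shows "\<forall>\<^sub>F n in sequentially. \<forall>\<theta> V z1 z2 Q g h s.
    \<theta>\<^sup>2 \<le> V \<longrightarrow> \<bar>z1\<bar> \<le> K \<longrightarrow> \<bar>z2\<bar> \<le> K \<longrightarrow> \<bar>Q\<bar> \<le> K \<longrightarrow> \<bar>g\<bar> \<le> K \<longrightarrow> \<bar>h\<bar> \<le> K \<longrightarrow> \<bar>s\<bar> \<le> K \<longrightarrow>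
    \<bar>stat_expr \<kappa> (p n) n (\<theta>, V, z1, z2, Q, g, h, s) - limit_expr \<kappa> (\<theta>, V, z1, z2, Q, g, h, s)\<bar> < \<epsilon>"
proof -
  define A where "A = {x :: real \<times> real \<times> real \<times> real \<times> real \<times> real \<times> real \<times> real. case x of (\<theta>, V, z1, z2, Q, g, h, s) \<Rightarrow>
    \<theta>\<^sup>2 \<le> V \<and> \<bar>z1\<bar> \<le> K \<and> \<bar>z2\<bar> \<le> K \<and> \<bar>Q\<bar> \<le> K \<and> \<bar>g\<bar> \<le> K \<and> \<bar>h\<bar> \<le> K \<and> \<bar>s\<bar> \<le> K}"
  have "\<forall>\<^sub>F n in sequentially. \<forall>y\<in>A. \<bar>stat_expr \<kappa> (p n) n y - limit_expr \<kappa> y\<bar> < \<epsilon>"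
  proof (rule uniform_of_sequences[OF _ e])
    fix x :: "nat \<Rightarrow> real \<times> real \<times> real \<times> real \<times> real \<times> real \<times> real \<times> real" assume x: "\<And>n. x n \<in> A"
    define f1 where "f1 n = fst (x n)" for n
    define f2 where "f2 n = fst (snd (x n))" for n
    define f3 where "f3 n = fst (snd (snd (x n)))" for n
    define f4 where "f4 n = fst (snd (snd (snd (x n))))" for n
    define f5 where "f5 n = fst (snd (snd (snd (snd (x n)))))" for n
    define f6 where "f6 n = fst (snd (snd (snd (snd (snd (x n))))))" for n
    define f7 where "f7 n = fst (snd (snd (snd (snd (snd (snd (x n)))))))" for n
    define f8 where "f8 n = snd (snd (snd (snd (snd (snd (snd (x n)))))))" for n
    have xn: "x n = (f1 n, f2 n, f3 n, f4 n, f5 n, f6 n, f7 n, f8 n)" for n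
      by (simp add: f1_def f2_def f3_def f4_def f5_def f6_def f7_def f8_def)
    have b: "(f1 n)\<^sup>2 \<le> f2 n" "\<bar>f3 n\<bar> \<le> K" "\<bar>f4 n\<bar> \<le> K" "\<bar>f5 n\<bar> \<le> K" "\<bar>f6 n\<bar> \<le> K" "\<bar>f7 n\<bar> \<le> K" "\<bar>f8 n\<bar> \<le> K" for n
      using x[of n] unfolding xn A_def by auto
    show "(\<lambda>n. stat_expr \<kappa> (p n) n (x n) - limit_expr \<kappa> (x n)) \<longlonglongrightarrow> 0"
      using standardised_limit[OF \<kappa> rate b] unfolding xn stat_expr_def limit_expr_def by simp
  qed
  then show ?thesis by eventually_elim (auto simp: A_def)
qed

text \<open>Here n = Suc N and m = n - p. The variable \<open>g\<close> has variance one, whereas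
  \<open>Q\<close> and \<open>h\<close> are divided by sqrt n and not by their own standard
  deviations: their variances 2 p / n and 2 (m + 1) / n are then bounded for every p, and they enter
  the statistic as lower order terms.\<close>

context
  fixes \<kappa> :: real and N p m :: nat and a v :: "real Matrix.vec"
  assumes \<kappa>: "0 < \<kappa>" "\<kappa> \<le> 1" and p: "1 \<le> p" "p \<le> N" and m: "m = Suc N - p"
    and a: "a \<in> carrier_vec p" and v: "v \<in> carrier_vec p" and a0: "a \<noteq> 0\<^sub>v p"
begin

private definition "\<theta> = (a \<bullet> v) / sqrt (a \<bullet> a)"
private definition "z1 w = (\<Sum>ij\<in>{..<p} \<times> {N}. a $ fst ij / sqrt (a \<bullet> a) * w ij)" for w :: "nat \<times> nat \<Rightarrow> real"
private definition "z2 w = (\<Sum>ij\<in>{..<p} \<times> {N}. v $ fst ij / sqrt (v \<bullet> v) * w ij)" for w :: "nat \<times> nat \<Rightarrow> real"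
private definition "Q w = (\<Sum>ij\<in>{..<p} \<times> {N}. 1 / sqrt (real (Suc N)) * ((w ij)\<^sup>2 - 1))" for w :: "nat \<times> nat \<Rightarrow> real"
private definition "g k = (\<Sum>ij\<in>{0} \<times> {..<m}. 1 / sqrt (2 * real m) * ((k ij)\<^sup>2 - 1))" for k :: "nat \<times> nat \<Rightarrow> real"
private definition "h r = (\<Sum>ij\<in>{1} \<times> {..<Suc m}. 1 / sqrt (real (Suc N)) * ((r ij)\<^sup>2 - 1))" for r :: "nat \<times> nat \<Rightarrow> real"
private definition "s' s = (\<Sum>ij\<in>{0} \<times> {m}. 1 * s ij)" for s :: "nat \<times> nat \<Rightarrow> real"
private definition "coords = (\<lambda>(w, r, k, s). (\<theta>, v \<bullet> v, z1 w, z2 w, Q w, g k, h r, s' s))"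
private abbreviation "R \<equiv> reference_space p N"
private definition "T = (\<lambda>(w, r, k, s). standardised \<kappa> (Suc N) p a v (real N * bilinear_value m a (shifted_mean p N v w) r k s))"

private lemma aa: "0 < a \<bullet> a" by (rule scalar_prod_self_pos[OF a a0])

private lemma vv: "0 \<le> v \<bullet> v" unfolding scalar_prod_eq_sum[OF v] by (intro sum_nonneg) simp

private lemma theta_le: "\<theta>\<^sup>2 \<le> v \<bullet> v"
  using scalar_prod_Cauchy_Schwarz[OF a v] aa unfolding \<theta>_def
  by (simp add: power_divide pos_divide_le_eq mult.commute)

private lemma m1: "1 \<le> m" using p m by simp

private lemma chi_norm_g: "g k = chi_norm ({0} \<times> {..<m}) k"
  unfolding g_def chi_norm_def sum_distrib_left[symmetric] sum_subtractf by simp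

text \<open>An identity at every point of the reference space: the norm |a| cancels, and zero
  denominators are treated alike on both sides. It separates the randomness from the deterministic
  estimate \<open>stat_expr_limit\<close>.\<close>

private lemma stat_expr_eq: "T x = stat_expr \<kappa> p (Suc N) (coords x)"
proof -
  obtain w r k s where x: "x = (w, r, k, s)" by (cases x)
  define n where "n = real (Suc N)"
  define t where "t = sqrt n"
  have t: "t > 0" "n = t * t" by (auto simp: t_def n_def)
  define L where "L = sqrt (a \<bullet> a)"
  have L: "L > 0" "a \<bullet> a = L * L" "L\<^sup>2 = a \<bullet> a" using aa by (auto simp: L_def)
  define y where "y = shifted_mean p N v w"
  have y: "y \<in> carrier_vec p" using v by (simp add: y_def)
  have yi: "y $ i = v $ i + w (i, N) / t" if "i < p" for i
    using that v by (simp add: y_def shifted_mean_def t_def n_def)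
  have mn: "real m = n - real p" using p m by (simp add: n_def)
  have av: "a \<bullet> v = L * \<theta>" using L by (simp add: \<theta>_def L_def[symmetric])
  have "a \<bullet> y = (\<Sum>i<p. a $ i * v $ i) + (\<Sum>i<p. a $ i * w (i, N)) / t"
    unfolding scalar_prod_eq_sum[OF y] sum_divide_distrib sum.distrib[symmetric]
    by (intro sum.cong) (auto simp: yi algebra_simps)
  moreover have "(\<Sum>i<p. a $ i * w (i, N)) = L * z1 w"
    using L by (simp add: z1_def sum_times_singleton sum_distrib_left L_def[symmetric])
  ultimately have ay: "a \<bullet> y = L * (\<theta> + z1 w / t)"
    using av by (simp add: scalar_prod_eq_sum[OF v] algebra_simps)
  have vw: "(\<Sum>i<p. v $ i * w (i, N)) = sqrt (v \<bullet> v) * z2 w"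
  proof (cases "v \<bullet> v = 0")
    \<comment> \<open>For v = 0 the direction used in \<open>z2\<close> degenerates, but both sides
      vanish.\<close>
    case True
    then have "v $ i = 0" if "i < p" for i
      using that unfolding scalar_prod_eq_sum[OF v] by (subst (asm) sum_nonneg_eq_0_iff) auto
    then show ?thesis using True by simp
  next
    case False
    then have "sqrt (v \<bullet> v) \<noteq> 0" by simp
    then show ?thesis by (simp add: z2_def sum_times_singleton sum_distrib_left)
  qed
  have Qw: "(\<Sum>i<p. (w (i, N))\<^sup>2) = real p + t * Q w"
    using t(1) unfolding Q_def sum_times_singleton sum_distrib_left[symmetric] sum_subtractf
    by (simp add: t_def n_def)
  have "y \<bullet> y = (\<Sum>i<p. v $ i * v $ i) + 2 * (\<Sum>i<p. v $ i * w (i, N)) / t + (\<Sum>i<p. (w (i, N))\<^sup>2) / (t * t)"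
    unfolding scalar_prod_eq_sum[OF y] sum_divide_distrib sum_distrib_left sum.distrib[symmetric]
    by (intro sum.cong) (use t(1) in \<open>auto simp: yi power2_eq_square field_simps\<close>)
  also have "\<dots> = v \<bullet> v + 2 * sqrt (v \<bullet> v) * z2 w / t + real p / n + Q w / t"
    unfolding vw Qw scalar_prod_eq_sum[OF v, symmetric] t(2) using t(1) by (simp add: field_simps)
  finally have yy: "y \<bullet> y = v \<bullet> v + 2 * sqrt (v \<bullet> v) * z2 w / t + real p / n + Q w / t" .
  define \<rho> where "\<rho> = sqrt (v \<bullet> v + 2 * sqrt (v \<bullet> v) * z2 w / t + real p / n + Q w / t - (\<theta> + z1 w / t)\<^sup>2)"
  have pf: "perp_factor a y = L * \<rho>"
  proof -
    have "(a \<bullet> a) * (y \<bullet> y) - (a \<bullet> y)\<^sup>2 = (a \<bullet> a) * (y \<bullet> y - (\<theta> + z1 w / t)\<^sup>2)"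
      unfolding ay power_mult_distrib L(3) by (simp add: algebra_simps)
    then show ?thesis unfolding perp_factor_def \<rho>_def yy[symmetric] by (simp add: real_sqrt_mult L_def)
  qed
  have xi: "(\<Sum>j<m. (k (0, j))\<^sup>2) = n - real p + sqrt (2 * (n - real p)) * g k"
  proof -
    have "sqrt (2 * real m) * g k = (\<Sum>j<m. (k (0, j))\<^sup>2) - real m"
      using m1 unfolding g_def sum_singleton_times sum_distrib_left[symmetric] sum_subtractf by simp
    then show ?thesis unfolding mn by simp
  qed
  have zeta: "(\<Sum>j<Suc m. (r (1, j))\<^sup>2) = n - real p + 1 + t * h r"
  proof -
    have "t * h r = (\<Sum>j<Suc m. (r (1, j))\<^sup>2) - real (Suc m)"
      using t(1) unfolding h_def sum_singleton_times sum_distrib_left[symmetric] sum_subtractf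
      by (simp add: t_def n_def del: sum.lessThan_Suc of_nat_Suc)
    then show ?thesis using mn by simp
  qed
  have ss: "s (0, m) = s' s" by (simp add: s'_def)
  define \<tau> where "\<tau> = sqrt (1 + \<theta>\<^sup>2 + v \<bullet> v)"
  have \<tau>: "\<tau> > 0" unfolding \<tau>_def using vv by (simp add: add_pos_nonneg add_nonneg_pos)
  have "1 / \<kappa> ^ 3 * ((a \<bullet> v)\<^sup>2 + (a \<bullet> a) * (1 + v \<bullet> v)) = ((L * L) * (1 + \<theta>\<^sup>2 + v \<bullet> v)) / ((\<kappa> * \<kappa>) * \<kappa>)"
    unfolding av L(2) by (simp add: power2_eq_square power3_eq_cube algebra_simps add_divide_distrib)
  then have \<sigma>: "sqrt (1 / \<kappa> ^ 3 * ((a \<bullet> v)\<^sup>2 + (a \<bullet> a) * (1 + v \<bullet> v))) = L * \<tau> / (\<kappa> * sqrt \<kappa>)"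
    using L \<kappa> by (simp add: real_sqrt_mult real_sqrt_divide \<tau>_def)
  have N: "real N = n - 1" by (simp add: n_def)
  define X where "X = n - real p + sqrt (2 * (n - real p)) * g k"
  define Z where "Z = sqrt (n - real p + 1 + t * h r)"
  have "T x = t * inverse (L * \<tau> / (\<kappa> * sqrt \<kappa>)) *
      ((n - 1) * ((L * (\<theta> + z1 w / t) - L * \<rho> * s' s / Z) / X) - 1 / \<kappa> * (L * \<theta>))"
    unfolding x T_def standardised_def case_prod_conv bilinear_value_def y_def[symmetric] \<sigma>[unfolded av] av ay pf xi zeta ss N X_def Z_def t_def n_def[symmetric] ..
  also have "\<dots> = \<kappa> * sqrt \<kappa> * (t / \<tau>) * ((n - 1) * (\<theta> + z1 w / t - \<rho> * s' s / Z) / X - \<theta> / \<kappa>)"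
  proof -
    have "(n - 1) * ((L * (\<theta> + z1 w / t) - L * \<rho> * s' s / Z) / X) - 1 / \<kappa> * (L * \<theta>) =
        L * ((n - 1) * (\<theta> + z1 w / t - \<rho> * s' s / Z) / X - \<theta> / \<kappa>)"
      by (simp add: right_diff_distrib diff_divide_distrib distrib_left)
         (simp add: ac_simps)
    moreover have "t * inverse (L * \<tau> / (\<kappa> * sqrt \<kappa>)) * (L * W) = \<kappa> * sqrt \<kappa> * (t / \<tau>) * W" for W
      using L(1) by (simp add: field_simps)
    ultimately show ?thesis by simp
  qed
  finally show ?thesis
    unfolding x coords_def stat_expr_def case_prod_conv X_def Z_def \<rho>_def \<tau>_def t_def n_def .
qed

private lemma measurable_linear:
  "(\<lambda>w. \<Sum>ij\<in>J. c ij * w ij) \<in> borel_measurable (gauss J)"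
  by (intro borel_measurable_sum borel_measurable_times borel_measurable_const gauss_component_measurable)

private lemma measurable_square:
  "(\<lambda>w. \<Sum>ij\<in>J. c * ((w ij)\<^sup>2 - 1)) \<in> borel_measurable (gauss J)"
  by (intro borel_measurable_sum borel_measurable_times borel_measurable_const borel_measurable_diff
      borel_measurable_power gauss_component_measurable)

private lemma second_moments:
  "(\<integral>\<^sup>+w. ennreal ((z1 w)\<^sup>2) \<partial>gauss ({..<p} \<times> {N})) \<le> 1"
  "(\<integral>\<^sup>+w. ennreal ((z2 w)\<^sup>2) \<partial>gauss ({..<p} \<times> {N})) \<le> 1"
  "(\<integral>\<^sup>+w. ennreal ((Q w)\<^sup>2) \<partial>gauss ({..<p} \<times> {N})) \<le> 2"
  "(\<integral>\<^sup>+k. ennreal ((g k)\<^sup>2) \<partial>gauss ({0} \<times> {..<m})) \<le> 1"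
  "(\<integral>\<^sup>+r. ennreal ((h r)\<^sup>2) \<partial>gauss ({1} \<times> {..<Suc m})) \<le> 2"
  "(\<integral>\<^sup>+s. ennreal ((s' s)\<^sup>2) \<partial>gauss ({0} \<times> {m})) \<le> 1"
proof -
  have lin: "(\<integral>\<^sup>+x. ennreal ((\<Sum>i\<in>J. c i * x i)\<^sup>2) \<partial>gauss J) = ennreal (1 * (\<Sum>i\<in>J. (c i)\<^sup>2))"
    if "finite J" for J :: "(nat \<times> nat) set" and c
    by (rule gauss_second_moment[OF that std_normal_moments(4) std_normal_moments(5) std_normal_moments(1) std_normal_moments(2)])
  have sqr: "(\<integral>\<^sup>+x. ennreal ((\<Sum>i\<in>J. c * ((x i)\<^sup>2 - 1))\<^sup>2) \<partial>gauss J) = ennreal (2 * (\<Sum>i\<in>J. c\<^sup>2))"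
    if "finite J" for J :: "(nat \<times> nat) set" and c
    by (rule gauss_second_moment[OF that std_normal_square_moments(3) std_normal_square_moments(4)
        std_normal_square_moments(1) std_normal_square_moments(2)])
  have one: "(\<Sum>i\<in>{..<p} \<times> {N}. (b $ fst i / sqrt (b \<bullet> b))\<^sup>2) \<le> 1" if b: "b \<in> carrier_vec p" for b :: "real Matrix.vec"
  proof -
    have bb: "0 \<le> b \<bullet> b" unfolding scalar_prod_eq_sum[OF b] by (intro sum_nonneg) simp
    have "(\<Sum>i\<in>{..<p} \<times> {N}. (b $ fst i / sqrt (b \<bullet> b))\<^sup>2) = (b \<bullet> b) / (b \<bullet> b)"
      using bb by (simp add: sum_times_singleton power_divide sum_divide_distrib[symmetric] scalar_prod_eq_sum[OF b] power2_eq_square)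
    then show ?thesis by simp
  qed
  show "(\<integral>\<^sup>+w. ennreal ((z1 w)\<^sup>2) \<partial>gauss ({..<p} \<times> {N})) \<le> 1" "(\<integral>\<^sup>+w. ennreal ((z2 w)\<^sup>2) \<partial>gauss ({..<p} \<times> {N})) \<le> 1"
    unfolding z1_def z2_def using one[OF a] one[OF v] by (subst lin; simp add: ennreal_le_1)+
  \<comment> \<open>The second bound is \<open>1 \<le> p\<close>, because Suc m = Suc N + 1 -
    p.\<close>
  have pn: "real p \<le> real (Suc N)" "real (Suc m) \<le> real (Suc N)" using p m by auto
  have "real p / real (Suc N) \<le> 1" "real (Suc m) / real (Suc N) \<le> 1"
    using pn by (simp_all only: divide_le_eq_1) auto
  then have d: "2 * (real p / real (Suc N)) \<le> 2" "2 * (real (Suc m) / real (Suc N)) \<le> 2" by linarith+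
  have "ennreal (2 * (real p / real (Suc N))) \<le> ennreal 2" "ennreal (2 * (real (Suc m) / real (Suc N))) \<le> ennreal 2"
    by (rule ennreal_leI[OF d(1)], rule ennreal_leI[OF d(2)])
  then show "(\<integral>\<^sup>+w. ennreal ((Q w)\<^sup>2) \<partial>gauss ({..<p} \<times> {N})) \<le> 2"
    "(\<integral>\<^sup>+r. ennreal ((h r)\<^sup>2) \<partial>gauss ({1} \<times> {..<Suc m})) \<le> 2"
    unfolding Q_def h_def by (subst sqr; simp add: power_divide card_cartesian_product del: of_nat_Suc)+
  show "(\<integral>\<^sup>+k. ennreal ((g k)\<^sup>2) \<partial>gauss ({0} \<times> {..<m})) \<le> 1"
    unfolding g_def using m1 by (subst sqr; simp add: power_divide card_cartesian_product)
  show "(\<integral>\<^sup>+s. ennreal ((s' s)\<^sup>2) \<partial>gauss ({0} \<times> {m})) \<le> 1"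
    unfolding s'_def by (subst lin) auto
qed

private lemma measurable_parts:
  "z1 \<in> borel_measurable (gauss ({..<p} \<times> {N}))" "z2 \<in> borel_measurable (gauss ({..<p} \<times> {N}))"
  "Q \<in> borel_measurable (gauss ({..<p} \<times> {N}))" "g \<in> borel_measurable (gauss ({0} \<times> {..<m}))"
  "h \<in> borel_measurable (gauss ({1} \<times> {..<Suc m}))" "s' \<in> borel_measurable (gauss ({0} \<times> {m}))"
  unfolding z1_def[abs_def] z2_def[abs_def] Q_def[abs_def] g_def[abs_def] h_def[abs_def] s'_def[abs_def]
  by (rule measurable_linear measurable_square)+

private lemma R_eq: "R = gauss ({..<p} \<times> {N}) \<Otimes>\<^sub>M (gauss ({1} \<times> {..<Suc m}) \<Otimes>\<^sub>M (gauss ({0} \<times> {..<m}) \<Otimes>\<^sub>M gauss ({0} \<times> {m})))"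
  unfolding reference_space_def m Let_def ..

text \<open>One sum of squares controls all six noise variables by a single use of Markov's
  inequality; its mean is at most 1 + 1 + 2 + 1 + 2 + 1 = 8.\<close>

private definition "sqsum x = (case x of (w, r, k, s) \<Rightarrow> (z1 w)\<^sup>2 + (z2 w)\<^sup>2 + (Q w)\<^sup>2 + (g k)\<^sup>2 + (h r)\<^sup>2 + (s' s)\<^sup>2)"

private lemma measurable_coordinates [measurable]:
  "(\<lambda>x. z1 (fst x)) \<in> borel_measurable R" "(\<lambda>x. z2 (fst x)) \<in> borel_measurable R" "(\<lambda>x. Q (fst x)) \<in> borel_measurable R"
  "(\<lambda>x. h (fst (snd x))) \<in> borel_measurable R" "(\<lambda>x. g (fst (snd (snd x)))) \<in> borel_measurable R"
  "(\<lambda>x. s' (snd (snd (snd x)))) \<in> borel_measurable R"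
  unfolding R_eq using measurable_parts by measurable

private lemma sqsum_integral: "(\<integral>\<^sup>+x. ennreal (sqsum x) \<partial>R) \<le> 8"
proof -
  have sp: "emeasure (gauss J) (space (gauss J)) = 1" for J :: "(nat \<times> nat) set"
    by (rule prob_space.emeasure_space_1[OF prob_space_gauss])
  have "(\<integral>\<^sup>+x. ennreal (sqsum x) \<partial>R) = (\<integral>\<^sup>+x. ennreal ((z1 (fst x))\<^sup>2) + ennreal ((z2 (fst x))\<^sup>2) + ennreal ((Q (fst x))\<^sup>2)
      + ennreal ((g (fst (snd (snd x))))\<^sup>2) + ennreal ((h (fst (snd x)))\<^sup>2) + ennreal ((s' (snd (snd (snd x))))\<^sup>2) \<partial>R)"
    by (simp add: sqsum_def split_beta' ennreal_plus[symmetric] del: ennreal_plus)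
  also have "\<dots> = (\<integral>\<^sup>+x. ennreal ((z1 (fst x))\<^sup>2) \<partial>R) + (\<integral>\<^sup>+x. ennreal ((z2 (fst x))\<^sup>2) \<partial>R) + (\<integral>\<^sup>+x. ennreal ((Q (fst x))\<^sup>2) \<partial>R)
      + (\<integral>\<^sup>+x. ennreal ((g (fst (snd (snd x))))\<^sup>2) \<partial>R) + (\<integral>\<^sup>+x. ennreal ((h (fst (snd x)))\<^sup>2) \<partial>R)
      + (\<integral>\<^sup>+x. ennreal ((s' (snd (snd (snd x))))\<^sup>2) \<partial>R)"
    by (simp add: nn_integral_add)
  also have "(\<integral>\<^sup>+x. ennreal ((z1 (fst x))\<^sup>2) \<partial>R) = (\<integral>\<^sup>+w. ennreal ((z1 w)\<^sup>2) \<partial>gauss ({..<p} \<times> {N}))"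
    using measurable_coordinates(1) unfolding R_eq
    by (subst nn_integral_pair_prob4[OF prob_space_gauss prob_space_gauss prob_space_gauss]) (simp_all add: sp)
  also have "(\<integral>\<^sup>+x. ennreal ((z2 (fst x))\<^sup>2) \<partial>R) = (\<integral>\<^sup>+w. ennreal ((z2 w)\<^sup>2) \<partial>gauss ({..<p} \<times> {N}))"
    using measurable_coordinates(2) unfolding R_eq
    by (subst nn_integral_pair_prob4[OF prob_space_gauss prob_space_gauss prob_space_gauss]) (simp_all add: sp)
  also have "(\<integral>\<^sup>+x. ennreal ((Q (fst x))\<^sup>2) \<partial>R) = (\<integral>\<^sup>+w. ennreal ((Q w)\<^sup>2) \<partial>gauss ({..<p} \<times> {N}))"
    using measurable_coordinates(3) unfolding R_eq
    by (subst nn_integral_pair_prob4[OF prob_space_gauss prob_space_gauss prob_space_gauss]) (simp_all add: sp)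
  also have "(\<integral>\<^sup>+x. ennreal ((g (fst (snd (snd x))))\<^sup>2) \<partial>R) = (\<integral>\<^sup>+k. ennreal ((g k)\<^sup>2) \<partial>gauss ({0} \<times> {..<m}))"
    using measurable_coordinates(5) unfolding R_eq
    by (subst nn_integral_pair_prob4[OF prob_space_gauss prob_space_gauss prob_space_gauss]) (simp_all add: sp)
  also have "(\<integral>\<^sup>+x. ennreal ((h (fst (snd x)))\<^sup>2) \<partial>R) = (\<integral>\<^sup>+r. ennreal ((h r)\<^sup>2) \<partial>gauss ({1} \<times> {..<Suc m}))"
    using measurable_coordinates(4) unfolding R_eq
    by (subst nn_integral_pair_prob4[OF prob_space_gauss prob_space_gauss prob_space_gauss]) (simp_all add: sp)
  also have "(\<integral>\<^sup>+x. ennreal ((s' (snd (snd (snd x))))\<^sup>2) \<partial>R) = (\<integral>\<^sup>+s. ennreal ((s' s)\<^sup>2) \<partial>gauss ({0} \<times> {m}))"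
    using measurable_coordinates(6) unfolding R_eq
    by (subst nn_integral_pair_prob4[OF prob_space_gauss prob_space_gauss prob_space_gauss]) (simp_all add: sp)
  also have "(\<integral>\<^sup>+w. ennreal ((z1 w)\<^sup>2) \<partial>gauss ({..<p} \<times> {N})) + (\<integral>\<^sup>+w. ennreal ((z2 w)\<^sup>2) \<partial>gauss ({..<p} \<times> {N}))
      + (\<integral>\<^sup>+w. ennreal ((Q w)\<^sup>2) \<partial>gauss ({..<p} \<times> {N})) + (\<integral>\<^sup>+k. ennreal ((g k)\<^sup>2) \<partial>gauss ({0} \<times> {..<m}))
      + (\<integral>\<^sup>+r. ennreal ((h r)\<^sup>2) \<partial>gauss ({1} \<times> {..<Suc m})) + (\<integral>\<^sup>+s. ennreal ((s' s)\<^sup>2) \<partial>gauss ({0} \<times> {m}))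
      \<le> 1 + 1 + 2 + 1 + 2 + 1"
    by (intro add_mono second_moments)
  finally show ?thesis by simp
qed

private lemma sqsum_measurable [measurable]: "sqsum \<in> borel_measurable R"
  unfolding sqsum_def[abs_def] split_beta' by measurable

private lemma prob_sqsum_ge:
  assumes K: "0 < K"
  shows "measure R {x \<in> space R. K\<^sup>2 \<le> sqsum x} \<le> 8 / K\<^sup>2"
proof -
  interpret R: prob_space R by (rule prob_space_reference_space)
  have "emeasure R {x \<in> space R. K\<^sup>2 \<le> sqsum x} \<le> emeasure R ({x \<in> space R. 1 \<le> ennreal (1 / K\<^sup>2) * ennreal (sqsum x)})"
  proof (rule emeasure_mono)
    show "{x \<in> space R. K\<^sup>2 \<le> sqsum x} \<subseteq> {x \<in> space R. 1 \<le> ennreal (1 / K\<^sup>2) * ennreal (sqsum x)}"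
      using K by (auto simp: ennreal_mult'[symmetric] ennreal_ge_1 le_divide_eq)
  qed measurable
  also have "\<dots> \<le> ennreal (1 / K\<^sup>2) * (\<integral>\<^sup>+x. ennreal (sqsum x) * indicator (space R) x \<partial>R)"
    using nn_integral_Markov_inequality[where u = "\<lambda>x. ennreal (sqsum x)" and M = R and A = "space R" and c = "ennreal (1 / K\<^sup>2)"] by simp
  also have "(\<integral>\<^sup>+x. ennreal (sqsum x) * indicator (space R) x \<partial>R) = (\<integral>\<^sup>+x. ennreal (sqsum x) \<partial>R)"
    by (intro nn_integral_cong) simp
  also have "ennreal (1 / K\<^sup>2) * \<dots> \<le> ennreal (1 / K\<^sup>2) * 8" by (intro mult_left_mono sqsum_integral) simp
  also have "\<dots> = ennreal (8 / K\<^sup>2)" using ennreal_mult'[of 8 "1 / K\<^sup>2"] K by (simp add: mult.commute)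
  finally show ?thesis by (simp add: R.emeasure_eq_measure)
qed

text \<open>The limit expression is a linear combination of the independent variables
  \<open>z1\<close>, \<open>g\<close> and \<open>s'\<close>. The first and the last are exactly
  normal, so the only error is that of the chi-squared variable \<open>g\<close> at the argument t *
  \<alpha>, and the coefficient satisfies |\<alpha>| \<le> 1.\<close>

private lemma char_limit_expr:
  assumes C: "\<And>t. cmod ((CLINT k|gauss ({0 :: nat} \<times> {..<m}). iexp (t * chi_norm ({0} \<times> {..<m}) k)) - exp (- t\<^sup>2 / 2)) \<le> C * \<bar>t\<bar> ^ 3 / sqrt m"
    and C0: "0 \<le> C"
  shows "cmod ((CLINT x|R. iexp (t * limit_expr \<kappa> (coords x))) - exp (- t\<^sup>2 / 2)) \<le> C * \<bar>t\<bar> ^ 3 / sqrt m"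
proof -
  let ?V = "v \<bullet> v"
  define \<tau> where "\<tau> = sqrt (1 + \<theta>\<^sup>2 + ?V)"
  have ts: "\<tau>\<^sup>2 = 1 + \<theta>\<^sup>2 + ?V" unfolding \<tau>_def using vv by (simp add: add_nonneg_nonneg)
  then have t2: "\<tau>\<^sup>2 > 0" using vv by (smt (verit) zero_le_power2)
  define \<alpha> where "\<alpha> = - sqrt 2 * (\<theta> / \<tau>)"
  define \<beta> where "\<beta> = sqrt \<kappa> * (1 / \<tau>)"
  define \<gamma> where "\<gamma> = - (sqrt (?V - \<theta>\<^sup>2 + (1 - \<kappa>)) / \<tau>)"
  have nn: "0 \<le> ?V - \<theta>\<^sup>2 + (1 - \<kappa>)" using theta_le \<kappa> by simp
  \<comment> \<open>The numerators 2 \<theta>^2, \<kappa> and V - \<theta>^2 + 1 - \<kappa> add up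
    to 1 + \<theta>^2 + V, which is \<tau>^2. The summand 1 - \<kappa> is the limit of |z|^2 / n,
    the contribution of the noise to the squared norm of y.\<close>
  have "\<alpha>\<^sup>2 + \<beta>\<^sup>2 + \<gamma>\<^sup>2 = (2 * \<theta>\<^sup>2 + \<kappa> + (?V - \<theta>\<^sup>2 + (1 - \<kappa>))) / \<tau>\<^sup>2"
    unfolding \<alpha>_def \<beta>_def \<gamma>_def using \<kappa> nn
    by (simp add: power_mult_distrib power_divide add_divide_distrib diff_divide_distrib)
  also have "\<dots> = 1" using t2 ts by simp
  finally have one: "\<alpha>\<^sup>2 + \<beta>\<^sup>2 + \<gamma>\<^sup>2 = 1" .
  then have "\<alpha>\<^sup>2 \<le> 1" using zero_le_power2[of \<beta>] zero_le_power2[of \<gamma>] by linarith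
  then have \<alpha>1: "\<bar>\<alpha>\<bar> \<le> 1" by (simp add: abs_square_le_1[symmetric])
  define F1 where "F1 = (\<lambda>w. iexp (t * \<beta> * z1 w))"
  define F3 where "F3 = (\<lambda>k. iexp (t * \<alpha> * g k))"
  define F4 where "F4 = (\<lambda>s. iexp (t * \<gamma> * s' s))"
  have meas: "F1 \<in> borel_measurable (gauss ({..<p} \<times> {N}))" "F3 \<in> borel_measurable (gauss ({0} \<times> {..<m}))"
    "F4 \<in> borel_measurable (gauss ({0} \<times> {m}))"
    unfolding F1_def F3_def F4_def using measurable_parts by measurable
  have bd: "cmod (F1 x) \<le> 1" "cmod (F3 x) \<le> 1" "cmod (F4 x) \<le> 1" for x
    by (simp_all add: F1_def F3_def F4_def)
  note ps = prob_space_gauss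
  have "iexp (t * limit_expr \<kappa> (coords x)) = F1 (fst x) * (1 * (F3 (fst (snd (snd x))) * F4 (snd (snd (snd x)))))" for x
  proof -
    have "limit_expr \<kappa> (coords x) = \<beta> * z1 (fst x) + (\<alpha> * g (fst (snd (snd x))) + \<gamma> * s' (snd (snd (snd x))))"
      by (cases x) (simp add: limit_expr_def coords_def \<tau>_def \<alpha>_def \<beta>_def \<gamma>_def)
    then show ?thesis
      unfolding F1_def F3_def F4_def by (simp add: exp_add[symmetric] distrib_left mult.assoc)
  qed
  then have "(CLINT x|R. iexp (t * limit_expr \<kappa> (coords x))) =
      (CLINT x|R. F1 (fst x) * (1 * (F3 (fst (snd (snd x))) * F4 (snd (snd (snd x))))))"
    by simp
  also have "\<dots> = (CLINT w|gauss ({..<p} \<times> {N}). F1 w) *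
      (CLINT y|gauss ({1 :: nat} \<times> {..<Suc m}) \<Otimes>\<^sub>M (gauss ({0} \<times> {..<m}) \<Otimes>\<^sub>M gauss ({0} \<times> {m})).
        1 * (F3 (fst (snd y)) * F4 (snd (snd y))))"
    unfolding R_eq
    by (rule integral_pair_prob_mult[where g = "\<lambda>y. 1 * (F3 (fst (snd y)) * F4 (snd (snd y)))"])
       (use meas bd in \<open>auto intro!: ps prob_space_pair mult_le_one simp: norm_mult\<close>)
  also have "(CLINT y|gauss ({1 :: nat} \<times> {..<Suc m}) \<Otimes>\<^sub>M (gauss ({0} \<times> {..<m}) \<Otimes>\<^sub>M gauss ({0} \<times> {m})).
        1 * (F3 (fst (snd y)) * F4 (snd (snd y)))) =
      (CLINT r|gauss ({1 :: nat} \<times> {..<Suc m}). 1) * (CLINT y|gauss ({0} \<times> {..<m}) \<Otimes>\<^sub>M gauss ({0} \<times> {m}). F3 (fst y) * F4 (snd y))"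
    by (rule integral_pair_prob_mult[where f = "\<lambda>_. 1" and g = "\<lambda>y. F3 (fst y) * F4 (snd y)"])
       (use meas bd in \<open>auto intro!: ps prob_space_pair mult_le_one simp: norm_mult\<close>)
  also have "(CLINT r|gauss ({1 :: nat} \<times> {..<Suc m}). 1) = 1" by (simp add: prob_space.prob_space[OF ps])
  also have "(CLINT y|gauss ({0} \<times> {..<m}) \<Otimes>\<^sub>M gauss ({0} \<times> {m}). F3 (fst y) * F4 (snd y)) =
      (CLINT k|gauss ({0} \<times> {..<m}). F3 k) * (CLINT s|gauss ({0} \<times> {m}). F4 s)"
    by (rule integral_pair_prob_mult) (use meas bd ps in auto)
  also have "(CLINT w|gauss ({..<p} \<times> {N}). F1 w) = exp (- ((t * \<beta>)\<^sup>2) / 2)"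
  proof -
    have "(\<Sum>i\<in>{..<p} \<times> {N}. (a $ fst i / sqrt (a \<bullet> a))\<^sup>2) = (a \<bullet> a) / (a \<bullet> a)"
      using aa by (simp add: sum_times_singleton power_divide sum_divide_distrib[symmetric] scalar_prod_eq_sum[OF a] power2_eq_square)
    then show ?thesis
      using char_gauss_linear[of "{..<p} \<times> {N}" "t * \<beta>" "\<lambda>ij. a $ fst ij / sqrt (a \<bullet> a)"] aa
      unfolding F1_def z1_def by simp
  qed
  also have "(CLINT s|gauss ({0} \<times> {m}). F4 s) = exp (- ((t * \<gamma>)\<^sup>2) / 2)"
    using char_gauss_linear[of "{0 :: nat} \<times> {m}" "t * \<gamma>" "\<lambda>_. 1"] unfolding F4_def s'_def by simp
  finally have eq: "(CLINT x|R. iexp (t * limit_expr \<kappa> (coords x))) =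
      exp (- ((t * \<beta>)\<^sup>2) / 2) * (CLINT k|gauss ({0} \<times> {..<m}). F3 k) * exp (- ((t * \<gamma>)\<^sup>2) / 2)" by simp
  have "- t\<^sup>2 / 2 = - (t\<^sup>2 * (\<alpha>\<^sup>2 + \<beta>\<^sup>2 + \<gamma>\<^sup>2)) / 2" unfolding one by simp
  also have "\<dots> = - ((t * \<beta>)\<^sup>2) / 2 + - ((t * \<alpha>)\<^sup>2) / 2 + - ((t * \<gamma>)\<^sup>2) / 2"
    by (simp add: power_mult_distrib algebra_simps add_divide_distrib diff_divide_distrib)
  finally have "- t\<^sup>2 / 2 = - ((t * \<beta>)\<^sup>2) / 2 + - ((t * \<alpha>)\<^sup>2) / 2 + - ((t * \<gamma>)\<^sup>2) / 2" .
  then have e: "exp (- t\<^sup>2 / 2) = exp (- ((t * \<beta>)\<^sup>2) / 2) * exp (- ((t * \<alpha>)\<^sup>2) / 2) * exp (- ((t * \<gamma>)\<^sup>2) / 2)"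
    by (simp only: exp_add)
  have "cmod ((CLINT x|R. iexp (t * limit_expr \<kappa> (coords x))) - exp (- t\<^sup>2 / 2)) =
      cmod (complex_of_real (exp (- ((t * \<beta>)\<^sup>2) / 2)) * complex_of_real (exp (- ((t * \<gamma>)\<^sup>2) / 2)) *
        ((CLINT k|gauss ({0} \<times> {..<m}). F3 k) - exp (- ((t * \<alpha>)\<^sup>2) / 2)))"
    unfolding eq e by (simp only: of_real_mult algebra_simps)
  also have "\<dots> = exp (- ((t * \<beta>)\<^sup>2) / 2) * exp (- ((t * \<gamma>)\<^sup>2) / 2) * cmod ((CLINT k|gauss ({0} \<times> {..<m}). F3 k) - exp (- ((t * \<alpha>)\<^sup>2) / 2))"
    by (simp add: norm_mult)
  also have "\<dots> \<le> 1 * 1 * cmod ((CLINT k|gauss ({0} \<times> {..<m}). F3 k) - exp (- ((t * \<alpha>)\<^sup>2) / 2))"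
    by (intro mult_mono) auto
  also have "\<dots> \<le> C * \<bar>t * \<alpha>\<bar> ^ 3 / sqrt m"
    using C[of "t * \<alpha>"] unfolding F3_def chi_norm_g by simp
  also have "\<dots> \<le> C * \<bar>t\<bar> ^ 3 / sqrt m"
  proof (intro divide_right_mono mult_left_mono power_mono)
    show "\<bar>t * \<alpha>\<bar> \<le> \<bar>t\<bar>" using \<alpha>1 by (simp add: abs_mult mult_left_le)
  qed (use C0 in auto)
  finally show ?thesis .
qed

private lemma T_measurable: "T \<in> borel_measurable R"
proof -
  have "(\<lambda>(w, r, k, s). bilinear_value m a (shifted_mean p N v w) r k s) \<in> borel_measurable R"
    unfolding m by (rule bilinear_value_measurable[OF a v])
  then show ?thesis unfolding T_def standardised_def split_beta' by measurable
qed

text \<open>Three errors are added. On the event that the sum of squares reaches K^2, of probability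
  at most 8 / K^2, the integrands differ by at most 2; off that event the arguments differ by at
  most |t| \<delta>; the last term is the distance of \<open>g\<close> from the normal law.\<close>

lemma char_standardised_bound:
  assumes K: "0 < K"
    and approx: "\<And>z1 z2 Q g h s. \<bar>z1\<bar> \<le> K \<Longrightarrow> \<bar>z2\<bar> \<le> K \<Longrightarrow> \<bar>Q\<bar> \<le> K \<Longrightarrow> \<bar>g\<bar> \<le> K \<Longrightarrow> \<bar>h\<bar> \<le> K \<Longrightarrow> \<bar>s\<bar> \<le> K \<Longrightarrow>
      \<bar>stat_expr \<kappa> p (Suc N) ((a \<bullet> v) / sqrt (a \<bullet> a), v \<bullet> v, z1, z2, Q, g, h, s) -
       limit_expr \<kappa> ((a \<bullet> v) / sqrt (a \<bullet> a), v \<bullet> v, z1, z2, Q, g, h, s)\<bar> \<le> \<delta>"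
    and C: "\<And>t. cmod ((CLINT k|gauss ({0 :: nat} \<times> {..<m}). iexp (t * chi_norm ({0} \<times> {..<m}) k)) - exp (- t\<^sup>2 / 2)) \<le> C * \<bar>t\<bar> ^ 3 / sqrt m"
    and C0: "0 \<le> C"
  shows "cmod ((CLINT x|reference_space p N. iexp (t * (case x of (w, r, k, s) \<Rightarrow>
        standardised \<kappa> (Suc N) p a v (real N * bilinear_value m a (shifted_mean p N v w) r k s)))) - exp (- t\<^sup>2 / 2))
    \<le> 16 / K\<^sup>2 + \<bar>t\<bar> * \<delta> + C * \<bar>t\<bar> ^ 3 / sqrt m"
proof -
  interpret R: prob_space R by (rule prob_space_reference_space)
  define B where "B = {x \<in> space R. K\<^sup>2 \<le> sqsum x}"
  have B: "B \<in> sets R" unfolding B_def by measurable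
  have d0: "0 \<le> \<delta>" using approx[of 0 0 0 0 0 0] K by (auto intro: order.trans[OF abs_ge_zero])
  let ?U = "\<lambda>x. limit_expr \<kappa> (coords x)"
  have U [measurable]: "?U \<in> borel_measurable R"
    unfolding limit_expr_def coords_def split_beta' fst_conv snd_conv by measurable
  note [measurable] = T_measurable
  have pw: "cmod (iexp (t * T x) - iexp (t * ?U x)) \<le> \<bar>t\<bar> * \<delta> + 2 * indicator B x" if x: "x \<in> space R" for x
  proof (cases "x \<in> B")
    case True
    have "cmod (iexp (t * T x) - iexp (t * ?U x)) \<le> 2" using iexp_diff_le[of "t * T x" "t * ?U x"] by simp
    then show ?thesis using True d0 by (simp add: add_increasing)
  next
    case False
    obtain w r k s where xe: "x = (w, r, k, s)" by (cases x)
    have tot: "(z1 w)\<^sup>2 + (z2 w)\<^sup>2 + (Q w)\<^sup>2 + (g k)\<^sup>2 + (h r)\<^sup>2 + (s' s)\<^sup>2 < K\<^sup>2"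
      using False x unfolding B_def xe sqsum_def by auto
    have sq: "\<bar>y\<bar> \<le> K" if "y\<^sup>2 < K\<^sup>2" for y
      using power2_less_imp_less[of "\<bar>y\<bar>" K] that K by simp
    note nn = zero_le_power2[of "z1 w"] zero_le_power2[of "z2 w"] zero_le_power2[of "Q w"]
      zero_le_power2[of "g k"] zero_le_power2[of "h r"] zero_le_power2[of "s' s"]
    have "\<bar>T x - ?U x\<bar> \<le> \<delta>"
      unfolding stat_expr_eq unfolding xe coords_def case_prod_conv \<theta>_def
      by (rule approx; rule sq; use tot nn in linarith)
    then have "\<bar>t * T x - t * ?U x\<bar> \<le> \<bar>t\<bar> * \<delta>"
      unfolding right_diff_distrib[symmetric] abs_mult by (intro mult_left_mono) auto
    then show ?thesis using iexp_diff_le[of "t * T x" "t * ?U x"] False by simp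
  qed
  have iT: "integrable R (\<lambda>x. iexp (t * T x))" "integrable R (\<lambda>x. iexp (t * ?U x))"
    by (auto intro!: R.integrable_iexp)
  have "cmod ((CLINT x|R. iexp (t * T x)) - (CLINT x|R. iexp (t * ?U x))) =
      cmod (CLINT x|R. iexp (t * T x) - iexp (t * ?U x))" using iT by simp
  also have "\<dots> \<le> (LINT x|R. cmod (iexp (t * T x) - iexp (t * ?U x)))" by (rule integral_norm_bound)
  also have "\<dots> \<le> (LINT x|R. \<bar>t\<bar> * \<delta> + 2 * indicator B x)"
  proof (rule integral_mono)
    show "integrable R (\<lambda>x. cmod (iexp (t * T x) - iexp (t * ?U x)))" using iT by (intro integrable_norm Bochner_Integration.integrable_diff)
    show "integrable R (\<lambda>x. \<bar>t\<bar> * \<delta> + 2 * indicator B x)" using B by (auto simp: R.emeasure_eq_measure)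
  qed (rule pw)
  also have "\<dots> = \<bar>t\<bar> * \<delta> + 2 * measure R B" using B R.prob_space by (simp add: R.emeasure_eq_measure)
  also have "\<dots> \<le> \<bar>t\<bar> * \<delta> + 16 / K\<^sup>2" using prob_sqsum_ge[OF K] unfolding B_def by simp
  finally have 1: "cmod ((CLINT x|R. iexp (t * T x)) - (CLINT x|R. iexp (t * ?U x))) \<le> \<bar>t\<bar> * \<delta> + 16 / K\<^sup>2" .
  have 2: "cmod ((CLINT x|R. iexp (t * ?U x)) - exp (- t\<^sup>2 / 2)) \<le> C * \<bar>t\<bar> ^ 3 / sqrt m"
    by (rule char_limit_expr[OF C C0])
  have "cmod ((CLINT x|R. iexp (t * T x)) - exp (- t\<^sup>2 / 2)) \<le> 16 / K\<^sup>2 + \<bar>t\<bar> * \<delta> + C * \<bar>t\<bar> ^ 3 / sqrt m"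
    using norm_diff_triangle_ineq[of "CLINT x|R. iexp (t * T x)" "CLINT x|R. iexp (t * ?U x)" "CLINT x|R. iexp (t * ?U x)" "complex_of_real (exp (- t\<^sup>2 / 2))"] 1 2
    by (smt (verit) norm_triangle_ineq diff_add_cancel add_diff_eq)
  then show ?thesis unfolding T_def split_beta' .
qed

end

section \<open>Whitening the model\<close>

text \<open>Presenting the sample covariance as a Gram matrix of centred observations reduces its
  behaviour under linear maps and shifts to that of the centred matrix.\<close>

definition centred :: "real Matrix.mat \<Rightarrow> real Matrix.mat" where
  "centred X = Matrix.mat (dim_row X) (dim_col X) (\<lambda>(i, j). X $$ (i, j) - sample_mean X $ i)"

lemma centred_carrier [simp]: "X \<in> carrier_mat p n \<Longrightarrow> centred X \<in> carrier_mat p n"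
  by (simp add: centred_def)

lemma sample_cov_eq_centred:
  assumes X: "X \<in> carrier_mat p n"
  shows "sample_cov X = (1 / (real n - 1)) \<cdot>\<^sub>m (centred X * transpose_mat (centred X))"
proof (rule eq_matI)
  fix i k assume "i < dim_row ((1 / (real n - 1)) \<cdot>\<^sub>m (centred X * transpose_mat (centred X)))"
    "k < dim_col ((1 / (real n - 1)) \<cdot>\<^sub>m (centred X * transpose_mat (centred X)))"
  then have ik: "i < p" "k < p" using X by (auto simp: centred_def)
  then show "sample_cov X $$ (i, k) = ((1 / (real n - 1)) \<cdot>\<^sub>m (centred X * transpose_mat (centred X))) $$ (i, k)"
    using X gram_index[OF centred_carrier[OF X] ik]
    by (simp add: sample_cov_def centred_def del: index_mult_mat(1))
qed (use X in \<open>auto simp: sample_cov_def centred_def\<close>)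

lemma sample_mean_mult:
  assumes P: "P \<in> carrier_mat k p" and X: "X \<in> carrier_mat p n"
  shows "sample_mean (P * X) = P *\<^sub>v sample_mean X"
proof (rule eq_vecI)
  fix i assume "i < dim_vec (P *\<^sub>v sample_mean X)"
  then have i: "i < k" using P by simp
  have "sample_mean (P * X) $ i = (\<Sum>j<n. \<Sum>l<p. P $$ (i, l) * X $$ (l, j)) / real n"
    using P X i by (simp add: sample_mean_def scalar_prod_def lessThan_atLeast0)
  also have "\<dots> = (\<Sum>l<p. P $$ (i, l) * ((\<Sum>j<n. X $$ (l, j)) / real n))"
    by (subst sum.swap) (simp add: sum_divide_distrib sum_distrib_left)
  also have "\<dots> = (P *\<^sub>v sample_mean X) $ i"
    using P X i by (simp add: sample_mean_def scalar_prod_def lessThan_atLeast0)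
  finally show "sample_mean (P * X) $ i = (P *\<^sub>v sample_mean X) $ i" .
qed (use P in \<open>simp add: sample_mean_def\<close>)

lemma centred_mult:
  assumes P: "P \<in> carrier_mat k p" and X: "X \<in> carrier_mat p n"
  shows "centred (P * X) = P * centred X"
proof (rule eq_matI)
  fix i j assume "i < dim_row (P * centred X)" "j < dim_col (P * centred X)"
  then have ij: "i < k" "j < n" using P X by (auto simp: centred_def)
  have "centred (P * X) $$ (i, j) = (P * X) $$ (i, j) - (P *\<^sub>v sample_mean X) $ i"
    using P X ij by (simp add: centred_def sample_mean_mult[OF P X] del: index_mult_mat(1) index_mult_mat_vec)
  also have "\<dots> = (\<Sum>l<p. P $$ (i, l) * (X $$ (l, j) - sample_mean X $ l))"
    using P X ij
    by (simp add: scalar_prod_def lessThan_atLeast0 sum_subtractf[symmetric] right_diff_distrib)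
  also have "\<dots> = (P * centred X) $$ (i, j)"
    using P X ij by (simp add: centred_def scalar_prod_def lessThan_atLeast0)
  finally show "centred (P * X) $$ (i, j) = (P * centred X) $$ (i, j)" .
qed (use P X in \<open>auto simp: centred_def\<close>)

lemma sample_cov_mult:
  assumes P: "P \<in> carrier_mat k p" and X: "X \<in> carrier_mat p n"
  shows "sample_cov (P * X) = P * sample_cov X * transpose_mat P"
proof -
  let ?D = "centred X"
  have D: "?D \<in> carrier_mat p n" "transpose_mat ?D \<in> carrier_mat n p" and PT: "transpose_mat P \<in> carrier_mat p k"
    using P X by auto
  have "(P * ?D) * transpose_mat (P * ?D) = (P * ?D) * (transpose_mat ?D * transpose_mat P)"
    by (simp only: transpose_mult[OF P D(1)])
  also have "\<dots> = P * (?D * (transpose_mat ?D * transpose_mat P))"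
    by (rule assoc_mult_mat[OF P D(1)]) (use D PT in auto)
  also have "?D * (transpose_mat ?D * transpose_mat P) = ?D * transpose_mat ?D * transpose_mat P"
    by (rule assoc_mult_mat[symmetric, OF D PT])
  also have "P * \<dots> = P * (?D * transpose_mat ?D) * transpose_mat P"
    by (rule assoc_mult_mat[symmetric, OF P _ PT]) (use D in auto)
  finally have e: "(P * ?D) * transpose_mat (P * ?D) = P * (?D * transpose_mat ?D) * transpose_mat P" .
  have DD: "?D * transpose_mat ?D \<in> carrier_mat p p" using D by auto
  have "P * ((1 / (real n - 1)) \<cdot>\<^sub>m (?D * transpose_mat ?D)) * transpose_mat P =
      (1 / (real n - 1)) \<cdot>\<^sub>m (P * (?D * transpose_mat ?D) * transpose_mat P)"
    using mult_smult_distrib[OF P DD] mult_smult_assoc_mat[OF mult_carrier_mat[OF P DD] PT] by simp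
  then show ?thesis
    using sample_cov_eq_centred[OF mult_carrier_mat[OF P X]] sample_cov_eq_centred[OF X] centred_mult[OF P X] e
    by simp
qed

lemma sample_add_repeat_col:
  assumes Z: "Z \<in> carrier_mat p n" and v: "v \<in> carrier_vec p" and n: "0 < n"
  shows "sample_mean (Z + repeat_col n v) = v + sample_mean Z"
    and "sample_cov (Z + repeat_col n v) = sample_cov Z"
proof -
  have r: "repeat_col n v \<in> carrier_mat p n" using v by (simp add: repeat_col_def)
  have e: "(Z + repeat_col n v) $$ (i, j) = Z $$ (i, j) + v $ i" if "i < p" "j < n" for i j
    using that Z v by (simp add: repeat_col_def)
  show m: "sample_mean (Z + repeat_col n v) = v + sample_mean Z"
  proof (rule eq_vecI)
    fix i assume "i < dim_vec (v + sample_mean Z)"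
    then have i: "i < p" using Z by (simp add: sample_mean_def)
    have "sample_mean (Z + repeat_col n v) $ i = (\<Sum>j<n. Z $$ (i, j) + v $ i) / real n"
      using Z r i e by (simp add: sample_mean_def)
    also have "\<dots> = (v + sample_mean Z) $ i"
      using Z v i n by (simp add: sample_mean_def sum.distrib add_divide_distrib)
    finally show "sample_mean (Z + repeat_col n v) $ i = (v + sample_mean Z) $ i" .
  qed (use Z v r in \<open>simp add: sample_mean_def\<close>)
  have "centred (Z + repeat_col n v) = centred Z"
  proof (rule eq_matI)
    fix i j assume "i < dim_row (centred Z)" "j < dim_col (centred Z)"
    then have ij: "i < p" "j < n" using Z by (auto simp: centred_def)
    then show "centred (Z + repeat_col n v) $$ (i, j) = centred Z $$ (i, j)"
      using Z r v e[OF ij] by (simp add: centred_def m)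
  qed (use Z r in \<open>auto simp: centred_def\<close>)
  then show "sample_cov (Z + repeat_col n v) = sample_cov Z"
    using sample_cov_eq_centred[OF Z] sample_cov_eq_centred[of "Z + repeat_col n v" p n] Z r by simp
qed

lemma statistic_whitened:
  assumes P: "P \<in> carrier_mat p p" "Determinant.det P \<noteq> 0" and X: "X \<in> carrier_mat p n" and n: "0 < n"
    and Z: "Z \<in> carrier_mat p n" and v: "v \<in> carrier_vec p" and PX: "P * X = Z + repeat_col n v"
    and l: "l \<in> carrier_vec p"
  shows "l \<bullet> (inv_mat (sample_cov X) *\<^sub>v sample_mean X) = statistic (P *\<^sub>v l) v Z"
  unfolding scalar_prod_inv_mat_congruence[OF sample_cov_carrier[OF X] P l sample_mean_carrier[OF X]]
    sample_cov_mult[OF P(1) X, symmetric] sample_mean_mult[OF P(1) X, symmetric] PX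
    sample_add_repeat_col[OF Z v n] statistic_def ..

lemma scalar_prod_inv_whitened:
  assumes P: "P \<in> carrier_mat p p" "Determinant.det P \<noteq> 0" and S: "S \<in> carrier_mat p p"
    and PSP: "P * S * transpose_mat P = 1\<^sub>m p" and x: "x \<in> carrier_vec p" and y: "y \<in> carrier_vec p"
  shows "x \<bullet> (inv_mat S *\<^sub>v y) = (P *\<^sub>v x) \<bullet> (P *\<^sub>v y)"
  unfolding scalar_prod_inv_mat_congruence[OF S P x y] PSP using P y by simp

text \<open>The centring and \<open>sigma_tilde\<close> involve \<Sigma> only through bilinear forms
  in its inverse, each of which whitening turns into a scalar product.\<close>

lemma target_eq_standardised:
  assumes P: "P \<in> carrier_mat p p" "Determinant.det P \<noteq> 0" and S: "S \<in> carrier_mat p p"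
    and PSP: "P * S * transpose_mat P = 1\<^sub>m p" and l: "l \<in> carrier_vec p" and m: "m \<in> carrier_vec p"
  shows "sqrt (real n) * inverse (sigma_tilde c S l m) * (y - 1 / (1 - c) * (l \<bullet> (inv_mat S *\<^sub>v m))) =
    standardised (1 - c) n p (P *\<^sub>v l) (P *\<^sub>v m) y"
  unfolding sigma_tilde_def standardised_def
  by (simp only: scalar_prod_inv_whitened[OF P S PSP l m] scalar_prod_inv_whitened[OF P S PSP l l]
      scalar_prod_inv_whitened[OF P S PSP m m])

text \<open>P is \<Lambda>^(-1/2) U^T, with rows u_i / sqrt (lam i). Its determinant is non-zero
  because it divides the determinant 1 of the product.\<close>

lemma eigen_whitening:
  assumes S: "S \<in> carrier_mat p p" and eig: "sorted_eigensystem p S lam u" and pos: "\<And>i. i < p \<Longrightarrow> 0 < lam i"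
  shows "\<exists>P \<in> carrier_mat p p. Determinant.det P \<noteq> 0 \<and> P * S * transpose_mat P = 1\<^sub>m p"
proof -
  define P where "P = Matrix.mat p p (\<lambda>(i, k). u i $ k / sqrt (lam i))"
  have P: "P \<in> carrier_mat p p" "transpose_mat P \<in> carrier_mat p p" by (auto simp: P_def)
  have u: "u i \<in> carrier_vec p" "S *\<^sub>v u i = lam i \<cdot>\<^sub>v u i" if "i < p" for i
    using eig that S unfolding sorted_eigensystem_def eigenvector_def by auto
  have orth: "u i \<bullet> u j = (if i = j then 1 else 0)" if "i < p" "j < p" for i j
    using eig that unfolding sorted_eigensystem_def by auto
  have row: "Matrix.row P i = (1 / sqrt (lam i)) \<cdot>\<^sub>v u i" if "i < p" for i
    using that u(1)[OF that] by (intro eq_vecI) (auto simp: P_def)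
  have PSP: "P * S * transpose_mat P = 1\<^sub>m p"
  proof (rule eq_matI)
    fix i j assume "i < dim_row (1\<^sub>m p :: real mat)" "j < dim_col (1\<^sub>m p :: real mat)"
    then have ij: "i < p" "j < p" by auto
    have s: "sqrt (lam i) > 0" "sqrt (lam j) > 0" using pos ij by auto
    have c: "Matrix.col (S * transpose_mat P) j = (lam j / sqrt (lam j)) \<cdot>\<^sub>v u j"
    proof -
      have "Matrix.col (S * transpose_mat P) j = S *\<^sub>v Matrix.col (transpose_mat P) j"
        by (rule col_mult2[OF S P(2) ij(2)])
      also have "Matrix.col (transpose_mat P) j = Matrix.row P j" using P ij by simp
      also have "S *\<^sub>v Matrix.row P j = (1 / sqrt (lam j)) \<cdot>\<^sub>v (lam j \<cdot>\<^sub>v u j)"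
        unfolding row[OF ij(2)] u(2)[OF ij(2), symmetric]
        by (rule mult_mat_vec[OF S u(1)[OF ij(2)]])
      also have "\<dots> = (lam j / sqrt (lam j)) \<cdot>\<^sub>v u j"
        by (rule eq_vecI) auto
      finally show ?thesis .
    qed
    have "(P * S * transpose_mat P) $$ (i, j) = (P * (S * transpose_mat P)) $$ (i, j)"
      using assoc_mult_mat[OF P(1) S P(2)] by simp
    also have "\<dots> = Matrix.row P i \<bullet> Matrix.col (S * transpose_mat P) j"
      using P S ij by simp
    also have "\<dots> = (1 / sqrt (lam i)) * ((lam j / sqrt (lam j)) * (u i \<bullet> u j))"
      unfolding row[OF ij(1)] c using u(1)[OF ij(1)] u(1)[OF ij(2)] by simp
    also have "\<dots> = 1\<^sub>m p $$ (i, j)"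
      using orth[OF ij] ij s pos[OF ij(1)] by (auto simp: real_sqrt_mult_self)
    finally show "(P * S * transpose_mat P) $$ (i, j) = 1\<^sub>m p $$ (i, j)" .
  qed (use P S in auto)
  have "Determinant.det (P * S * transpose_mat P) = 1" unfolding PSP by simp
  then have "Determinant.det P \<noteq> 0"
    using det_mult[OF mult_carrier_mat[OF P(1) S] P(2)] det_mult[OF P(1) S] by auto
  then show ?thesis using P PSP by blast
qed

lemma vec_coords_measurable:
  assumes "\<And>i. i < p \<Longrightarrow> (\<lambda>x. v x $ i) \<in> borel_measurable M"
  shows "(\<lambda>x. vec_coords p (v x)) \<in> M \<rightarrow>\<^sub>M gauss {..<p}"
  unfolding vec_coords_def measurable_cong_sets[OF refl sets_gauss]
  using assms by (intro measurable_restrict) auto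

text \<open>The quadratic form in the exponent of the normal density is the squared norm of P (x -
  \<mu>), which is the hypothesis of \<open>whitening\<close>; the normalising constant of the
  density plays the part of C.\<close>

lemma whitened_column:
  assumes M: "prob_space M" and P: "P \<in> carrier_mat p p" "Determinant.det P \<noteq> 0" and S: "S \<in> carrier_mat p p"
    and PSP: "P * S * transpose_mat P = 1\<^sub>m p" and \<mu>: "\<mu> \<in> carrier_vec p"
    and V: "has_vec_density M p V (mvn_density p \<mu> S)"
  shows "distr M (gauss {..<p}) (\<lambda>\<omega>. vec_coords p (P *\<^sub>v (V \<omega> - \<mu>))) = gauss {..<p}"
proof -
  define A where "A = (\<lambda>x. vec_coords p (P *\<^sub>v Matrix.vec p x))"
  define A' where "A' = (\<lambda>x. vec_coords p (inv_mat P *\<^sub>v Matrix.vec p x))"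
  let ?K = "{..<p}"
  have I: "inv_mat P \<in> carrier_mat p p" "P * inv_mat P = 1\<^sub>m p" using P inv_mat_right by auto
  have Vc: "V \<omega> \<in> carrier_vec p" if "\<omega> \<in> space M" for \<omega> using V that by (auto simp: has_vec_density_def)
  have vc: "Matrix.vec p (vec_coords p x) = x" if "x \<in> carrier_vec p" for x
    using that by (intro eq_vecI) (auto simp: vec_coords_def)
  have law: "distr M (gauss ?K) (\<lambda>\<omega>. A (\<lambda>i\<in>?K. vec_coords p (V \<omega>) i - \<mu> $ i)) = gauss ?K"
  proof (rule whitening[where A' = A' and g = "\<lambda>x. mvn_density p \<mu> S (Matrix.vec p x)"
        and C = "1 / sqrt ((2 * pi) ^ p * Determinant.det S)"])
    have "(\<lambda>x. vec_coords p (B *\<^sub>v Matrix.vec p x)) \<in> gauss ?K \<rightarrow>\<^sub>M gauss ?K" if "B \<in> carrier_mat p p" for B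
      by (intro vec_coords_measurable mult_mat_vec_measurable[where p = p] mat_measurable_const that)
         (use that in \<open>auto intro: gauss_component_measurable\<close>)
    then show "A \<in> gauss ?K \<rightarrow>\<^sub>M gauss ?K" "A' \<in> gauss ?K \<rightarrow>\<^sub>M gauss ?K"
      unfolding A_def A'_def using P I by auto
    show "A (\<lambda>i\<in>?K. x i + y i) = (\<lambda>i\<in>?K. A x i + A y i)" for x y
    proof -
      have "Matrix.vec p (\<lambda>i\<in>?K. x i + y i) = Matrix.vec p x + Matrix.vec p y" by (rule eq_vecI) auto
      then have "P *\<^sub>v Matrix.vec p (\<lambda>i\<in>?K. x i + y i) = P *\<^sub>v Matrix.vec p x + P *\<^sub>v Matrix.vec p y"
        using mult_add_distrib_mat_vec[OF P(1)] by simp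
      then show ?thesis using P unfolding A_def by (auto simp: vec_coords_def fun_eq_iff)
    qed
    show "A (A' x) = x" if "x \<in> space (gauss ?K)" for x
    proof -
      have "P *\<^sub>v (inv_mat P *\<^sub>v Matrix.vec p x) = Matrix.vec p x"
        using assoc_mult_mat_vec[OF P(1) I(1), of "Matrix.vec p x"] I(2) by simp
      then have "A (A' x) = vec_coords p (Matrix.vec p x)"
        unfolding A_def A'_def using vc[of "inv_mat P *\<^sub>v Matrix.vec p x"] I by simp
      also have "\<dots> = x" using that by (auto simp: vec_coords_def space_gauss PiE_iff extensional_def fun_eq_iff)
      finally show ?thesis .
    qed
    show "distributed M (Pi\<^sub>M ?K (\<lambda>_. lborel)) (\<lambda>\<omega>. vec_coords p (V \<omega>)) (\<lambda>x. ennreal (mvn_density p \<mu> S (Matrix.vec p x)))"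
      using V by (simp add: has_vec_density_def)
    fix x :: "nat \<Rightarrow> real"
    let ?d = "Matrix.vec p x - \<mu>"
    have d: "?d \<in> carrier_vec p" using \<mu> by simp
    have vd: "Matrix.vec p (\<lambda>i\<in>?K. x i - \<mu> $ i) = ?d" using \<mu> by (intro eq_vecI) auto
    have "?d \<bullet> (inv_mat S *\<^sub>v ?d) = (P *\<^sub>v ?d) \<bullet> (P *\<^sub>v ?d)"
      by (rule scalar_prod_inv_whitened[OF P S PSP d d])
    also have "\<dots> = (\<Sum>i\<in>?K. (P *\<^sub>v ?d) $ i * (P *\<^sub>v ?d) $ i)"
      by (rule scalar_prod_eq_sum[OF mult_mat_vec_carrier[OF P(1) d]])
    also have "\<dots> = (\<Sum>i\<in>?K. (A (\<lambda>i\<in>?K. x i - \<mu> $ i) i)\<^sup>2)"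
      unfolding A_def vd by (intro sum.cong) (auto simp: vec_coords_def power2_eq_square)
    finally show "mvn_density p \<mu> S (Matrix.vec p x) = 1 / sqrt ((2 * pi) ^ p * Determinant.det S) *
        exp (- (\<Sum>i\<in>?K. (A (\<lambda>i\<in>?K. x i - \<mu> $ i) i)\<^sup>2) / 2)"
      by (simp add: mvn_density_def)
  qed (use M in auto)
  have eq: "A (\<lambda>i\<in>?K. vec_coords p (V \<omega>) i - \<mu> $ i) = vec_coords p (P *\<^sub>v (V \<omega> - \<mu>))" if "\<omega> \<in> space M" for \<omega>
  proof -
    have "Matrix.vec p (\<lambda>i\<in>?K. vec_coords p (V \<omega>) i - \<mu> $ i) = V \<omega> - \<mu>"
      using \<mu> Vc[OF that] by (intro eq_vecI) (auto simp: vec_coords_def)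
    then show ?thesis by (simp add: A_def)
  qed
  have "distr M (gauss ?K) (\<lambda>\<omega>. A (\<lambda>i\<in>?K. vec_coords p (V \<omega>) i - \<mu> $ i)) =
      distr M (gauss ?K) (\<lambda>\<omega>. vec_coords p (P *\<^sub>v (V \<omega> - \<mu>)))"
    by (rule distr_cong[OF refl refl]) (rule eq)
  with law show ?thesis by (simp only:)
qed

text \<open>Each whitened column is standard normal and the columns are independent, so the law
  agrees with the product measure on boxes; a box of matrix entries is an intersection of one box
  for each column.\<close>

lemma whitened_matrix:
  assumes M: "prob_space M" and P: "P \<in> carrier_mat p p" "Determinant.det P \<noteq> 0" and S: "S \<in> carrier_mat p p"
    and PSP: "P * S * transpose_mat P = 1\<^sub>m p" and \<mu>: "\<mu> \<in> carrier_vec p" and n: "0 < n"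
    and Y: "normal_columns M p n \<mu> S Y"
  shows "distr M (gauss ({..<p} \<times> {..<n})) (\<lambda>\<omega>. mat_coords p n (P * (Y \<omega> - repeat_col n \<mu>))) = gauss ({..<p} \<times> {..<n})"
    (is "distr M (gauss ?I) ?Z = _")
proof -
  interpret M: prob_space M by (rule M)
  have Yc: "Y \<omega> \<in> carrier_mat p n" if "\<omega> \<in> space M" for \<omega> using Y that by (auto simp: normal_columns_def)
  have rc: "repeat_col n \<mu> \<in> carrier_mat p n" using \<mu> by (simp add: repeat_col_def)
  \<comment> \<open>Rebuilding the column from its coordinates presents W j as a measurable function
    of the j-th member of the independent family, which is the form needed to inherit
    independence.\<close>
  define W where "W = (\<lambda>j \<omega>. vec_coords p (P *\<^sub>v (Matrix.vec p (vec_coords p (Matrix.col (Y \<omega>) j)) - \<mu>)))"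
  have W_eq: "W j \<omega> = vec_coords p (P *\<^sub>v (Matrix.col (Y \<omega>) j - \<mu>))" if "\<omega> \<in> space M" "j < n" for j \<omega>
  proof -
    have "Matrix.vec p (vec_coords p (Matrix.col (Y \<omega>) j)) = Matrix.col (Y \<omega>) j"
      using Yc[OF that(1)] that(2) by (intro eq_vecI) (auto simp: vec_coords_def)
    then show ?thesis by (simp add: W_def)
  qed
  have W: "distr M (gauss {..<p}) (W j) = gauss {..<p}" if "j < n" for j
  proof -
    have "distr M (gauss {..<p}) (W j) = distr M (gauss {..<p}) (\<lambda>\<omega>. vec_coords p (P *\<^sub>v (Matrix.col (Y \<omega>) j - \<mu>)))"
      using W_eq that by (intro distr_cong) auto
    also have "\<dots> = gauss {..<p}"
      by (rule whitened_column[OF M P S PSP \<mu>]) (use Y that in \<open>auto simp: normal_columns_def\<close>)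
    finally show ?thesis .
  qed
  have ZW: "?Z \<omega> (i, j) = W j \<omega> i" if "\<omega> \<in> space M" "i < p" "j < n" for \<omega> i j
  proof -
    have "Matrix.col (Y \<omega> - repeat_col n \<mu>) j = Matrix.col (Y \<omega>) j - \<mu>"
      using Yc[OF that(1)] rc \<mu> that by (intro eq_vecI) (auto simp: repeat_col_def)
    then show ?thesis
      using that P rc Yc[OF that(1)] by (simp add: mat_coords_def W_eq vec_coords_def)
  qed
  have ind: "M.indep_vars (\<lambda>_. gauss {..<p}) W {..<n}"
  proof -
    have "M.indep_vars (\<lambda>_. Pi\<^sub>M {..<p} (\<lambda>_. borel)) (\<lambda>j \<omega>. vec_coords p (Matrix.col (Y \<omega>) j)) {..<n}"
      using Y by (simp add: normal_columns_def)
    then show ?thesis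
      unfolding W_def
    proof (rule M.indep_vars_compose2)
      show "(\<lambda>x. vec_coords p (P *\<^sub>v (Matrix.vec p x - \<mu>))) \<in> Pi\<^sub>M {..<p} (\<lambda>_. borel) \<rightarrow>\<^sub>M gauss {..<p}"
        by (intro vec_coords_measurable mult_mat_vec_measurable[where p = p] mat_measurable_const P)
           (use \<mu> P(1) in \<open>auto intro!: measurable_component_singleton\<close>)
    qed
  qed
  have Wm: "W j \<in> M \<rightarrow>\<^sub>M gauss {..<p}" if "j < n" for j
    using ind that unfolding M.indep_vars_def by auto
  have Zm: "?Z \<in> M \<rightarrow>\<^sub>M gauss ?I"
  proof (rule mat_coords_measurable)
    show "mat_measurable p n M (\<lambda>\<omega>. P * (Y \<omega> - repeat_col n \<mu>))"
      unfolding mat_measurable_def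
    proof (intro conjI ballI allI impI)
      show "P * (Y \<omega> - repeat_col n \<mu>) \<in> carrier_mat p n" if "\<omega> \<in> space M" for \<omega>
        by (rule mult_carrier_mat[OF P(1)]) (use rc Yc[OF that] in auto)
      fix i j assume ij: "i < p" "j < n"
      have "(\<lambda>\<omega>. W j \<omega> i) \<in> borel_measurable M"
        using measurable_compose[OF Wm[OF ij(2)] gauss_component_measurable[of i]] ij by simp
      moreover have "(P * (Y \<omega> - repeat_col n \<mu>)) $$ (i, j) = W j \<omega> i" if "\<omega> \<in> space M" for \<omega>
        using ZW[OF that ij] ij by (simp add: mat_coords_def)
      ultimately show "(\<lambda>\<omega>. (P * (Y \<omega> - repeat_col n \<mu>)) $$ (i, j)) \<in> borel_measurable M"
        by (subst measurable_cong) auto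
    qed
  qed
  show ?thesis
    unfolding gauss_def[of ?I]
  proof (rule std_normal_prod.PiM_eqI)
    show "sets (distr M (Pi\<^sub>M ?I (\<lambda>_. std_normal_distribution)) ?Z) = sets (Pi\<^sub>M ?I (\<lambda>_. std_normal_distribution))" by simp
    fix E :: "nat \<times> nat \<Rightarrow> real set" assume "\<And>i. i \<in> ?I \<Longrightarrow> E i \<in> sets std_normal_distribution"
    then have E: "E i \<in> sets borel" if "i \<in> ?I" for i using that by simp
    define F where "F j = Pi\<^sub>E {..<p} (\<lambda>i. E (i, j))" for j
    have F: "F j \<in> sets (gauss {..<p})" if "j < n" for j
      unfolding F_def sets_gauss using that E by (intro sets_PiM_I_finite) auto
    have PE: "Pi\<^sub>E ?I E \<in> sets (gauss ?I)"
      unfolding sets_gauss using E by (intro sets_PiM_I_finite) auto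
    have pre: "?Z -` (Pi\<^sub>E ?I E) \<inter> space M = (\<Inter>j\<in>{..<n}. W j -` F j \<inter> space M)"
    proof (intro Set.set_eqI iffI)
      fix \<omega> assume *: "\<omega> \<in> ?Z -` (Pi\<^sub>E ?I E) \<inter> space M"
      then have "?Z \<omega> (i, j) \<in> E (i, j)" if "i < p" "j < n" for i j using that by (auto simp: PiE_iff)
      then show "\<omega> \<in> (\<Inter>j\<in>{..<n}. W j -` F j \<inter> space M)"
        using * ZW by (auto simp: F_def PiE_iff W_eq vec_coords_def)
    next
      fix \<omega> assume *: "\<omega> \<in> (\<Inter>j\<in>{..<n}. W j -` F j \<inter> space M)"
      moreover have "0 \<in> {..<n}" using n by simp
      ultimately have o: "\<omega> \<in> space M" by blast
      have "?Z \<omega> (i, j) \<in> E (i, j)" if "i < p" "j < n" for i j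
      proof -
        have "W j \<omega> \<in> F j" using * that by blast
        then show ?thesis using that ZW[OF o that] by (simp add: F_def PiE_iff)
      qed
      then show "\<omega> \<in> ?Z -` (Pi\<^sub>E ?I E) \<inter> space M" using o by (auto simp: PiE_iff mat_coords_def)
    qed
    have "emeasure (distr M (gauss ?I) ?Z) (Pi\<^sub>E ?I E) = emeasure M (\<Inter>j\<in>{..<n}. W j -` F j \<inter> space M)"
      using emeasure_distr[OF Zm PE] pre by simp
    also have "\<dots> = (\<Prod>j<n. emeasure M (W j -` F j \<inter> space M))"
    proof -
      have ne: "{..<n} \<noteq> {}" using n by (auto simp: lessThan_empty_iff)
      have F': "F j \<in> sets (gauss {..<p})" if "j \<in> {..<n}" for j using F that by simp
      have pr: "M.prob (\<Inter>j\<in>{..<n}. W j -` F j \<inter> space M) = (\<Prod>j<n. M.prob (W j -` F j \<inter> space M))"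
        by (rule M.indep_varsD_finite[OF ind ne finite_lessThan F'])
      show ?thesis
        unfolding M.emeasure_eq_measure pr by (rule prod_ennreal[symmetric]) simp
    qed
    also have "\<dots> = (\<Prod>j<n. emeasure (gauss {..<p}) (F j))"
    proof (rule prod.cong[OF refl])
      fix j assume "j \<in> {..<n}"
      then have j: "j < n" by simp
      show "emeasure M (W j -` F j \<inter> space M) = emeasure (gauss {..<p}) (F j)"
        using emeasure_distr[OF Wm[OF j] F[OF j]] W[OF j] by simp
    qed
    also have "\<dots> = (\<Prod>j<n. \<Prod>i<p. emeasure std_normal_distribution (E (i, j)))"
      unfolding F_def gauss_def using E by (intro prod.cong refl std_normal_prod.emeasure_PiM) auto
    also have "\<dots> = (\<Prod>i\<in>?I. emeasure std_normal_distribution (E i))"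
      by (subst prod.swap) (simp add: prod.cartesian_product')
    finally show "emeasure (distr M (Pi\<^sub>M ?I (\<lambda>_. std_normal_distribution)) ?Z) (Pi\<^sub>E ?I E) =
        (\<Prod>i\<in>?I. emeasure std_normal_distribution (E i))"
      unfolding gauss_def .
  qed simp
qed

section \<open>Uniform bounds for the statistic, averaging over the mixing vector, and the limit
  theorem\<close>

lemma repeat_col_carrier: "v \<in> carrier_vec p \<Longrightarrow> repeat_col n v \<in> carrier_mat p n"
  by (auto simp: repeat_col_def)

lemma standardised_measurable:
  assumes a: "a \<in> carrier_vec p"
    and v: "\<And>x. x \<in> space M \<Longrightarrow> v x \<in> carrier_vec p" "\<And>i. i < p \<Longrightarrow> (\<lambda>x. v x $ i) \<in> borel_measurable M"
    and y: "y \<in> borel_measurable M"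
  shows "(\<lambda>x. standardised \<kappa> n p a (v x) (y x)) \<in> borel_measurable M"
proof -
  have av: "(\<lambda>x. a \<bullet> v x) \<in> borel_measurable M" by (rule scalar_prod_measurable[where p = p]) (use a v in auto)
  have vv: "(\<lambda>x. v x \<bullet> v x) \<in> borel_measurable M" by (rule scalar_prod_measurable[where p = p]) (use v in auto)
  show ?thesis unfolding standardised_def using av vv y by measurable
qed

text \<open>K and \<delta> are fixed first, from \<epsilon> and t alone; only then is n taken large
  for the deterministic estimate and the chi-squared error. As neither choice involves a or v, the
  bound holds for all of them simultaneously.\<close>

lemma char_statistic_uniform:
  fixes p :: "nat \<Rightarrow> nat"
  assumes \<kappa>: "0 < \<kappa>" "\<kappa> \<le> 1" and p: "\<And>n. n \<ge> n0 \<Longrightarrow> 1 \<le> p n \<and> p n < n - 1"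
    and rate: "(\<lambda>n. sqrt (real n) * (real (p n) / real n - (1 - \<kappa>))) \<longlonglongrightarrow> 0" and e: "0 < \<epsilon>"
  shows "\<forall>\<^sub>F n in sequentially. \<forall>a v. a \<in> carrier_vec (p n) \<longrightarrow> v \<in> carrier_vec (p n) \<longrightarrow> a \<noteq> 0\<^sub>v (p n) \<longrightarrow>
    cmod ((CLINT z|gauss ({..<p n} \<times> {..<n}). iexp (t * standardised \<kappa> n (p n) a v (statistic a v (Matrix.mat (p n) n z))))
      - exp (- t\<^sup>2 / 2)) \<le> \<epsilon>"
proof -
  obtain C where C0: "0 \<le> C" and C: "\<And>(K :: (nat \<times> nat) set) t. finite K \<Longrightarrow> K \<noteq> {} \<Longrightarrow>
    cmod ((CLINT k|gauss K. iexp (t * chi_norm K k)) - exp (- t\<^sup>2 / 2)) \<le> C * \<bar>t\<bar> ^ 3 / sqrt (card K)"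
    using char_chi_norm by blast
  \<comment> \<open>Makes the tail term 16 / K^2 equal to a third of \<epsilon>.\<close>
  define K where "K = sqrt (48 / \<epsilon>)"
  have K: "0 < K" "16 / K\<^sup>2 = \<epsilon> / 3" using e by (simp_all add: K_def)
  \<comment> \<open>The summand 1 keeps the denominator positive at t = 0.\<close>
  define \<delta> where "\<delta> = \<epsilon> / (3 * (\<bar>t\<bar> + 1))"
  have d0: "0 < \<delta>" using e by (simp add: \<delta>_def add_nonneg_pos)
  have td: "\<bar>t\<bar> * \<delta> \<le> \<epsilon> / 3"
  proof -
    have "\<bar>t\<bar> * \<delta> \<le> (\<bar>t\<bar> + 1) * \<delta>" using d0 by (intro mult_right_mono) auto
    also have "\<dots> = \<epsilon> / 3" by (simp add: \<delta>_def field_simps)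
    finally show ?thesis .
  qed
  \<comment> \<open>(n - p) / n tends to \<kappa> > 0, so the degrees of freedom of \<xi> grow
    without bound and its standardisation becomes normal.\<close>
  have m_top: "filterlim (\<lambda>n. real (n - p n)) at_top sequentially"
  proof -
    have "(\<lambda>n. \<kappa> - (sqrt (real n) * (real (p n) / real n - (1 - \<kappa>))) * (1 / sqrt (real n))) \<longlonglongrightarrow> \<kappa> - 0 * 0"
      by (intro tendsto_intros rate inverse_sqrt_tendsto_zero)
    then have l: "(\<lambda>n. \<kappa> - (sqrt (real n) * (real (p n) / real n - (1 - \<kappa>))) * (1 / sqrt (real n))) \<longlonglongrightarrow> \<kappa>" by simp
    have "filterlim (\<lambda>n. (\<kappa> - (sqrt (real n) * (real (p n) / real n - (1 - \<kappa>))) * (1 / sqrt (real n))) * real n) at_top sequentially"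
      by (rule filterlim_tendsto_pos_mult_at_top[OF l \<kappa>(1) filterlim_real_sequentially])
    then show ?thesis
    proof (rule filterlim_mono_eventually[OF _ order_refl order_refl])
      show "\<forall>\<^sub>F n in sequentially. (\<kappa> - (sqrt (real n) * (real (p n) / real n - (1 - \<kappa>))) * (1 / sqrt (real n))) * real n = real (n - p n)"
        using eventually_ge_at_top[of n0] eventually_gt_at_top[of 0]
      proof eventually_elim
        case (elim n)
        have e: "(sqrt (real n) * (real (p n) / real n - (1 - \<kappa>))) * (1 / sqrt (real n)) = real (p n) / real n - (1 - \<kappa>)"
          using elim by simp
        have "p n \<le> n" using p[OF elim(1)] by linarith
        then show ?case unfolding e using elim by (simp add: of_nat_diff field_simps)
      qed
    qed
  qed
  have "(\<lambda>n. C * \<bar>t\<bar> ^ 3 / sqrt (real (n - p n))) \<longlonglongrightarrow> 0"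
    by (intro tendsto_divide_0[OF tendsto_const] filterlim_at_top_imp_at_infinity filterlim_compose[OF sqrt_at_top m_top])
  then have ev2: "\<forall>\<^sub>F n in sequentially. C * \<bar>t\<bar> ^ 3 / sqrt (real (n - p n)) < \<epsilon> / 3"
    using e by (intro order_tendstoD(2)) auto
  show ?thesis
    using stat_expr_limit[OF \<kappa> rate d0, of K] ev2 eventually_ge_at_top[of n0]
  proof eventually_elim
    case (elim n)
    show ?case
    proof (intro allI impI)
      fix a v :: "real Matrix.vec" assume a: "a \<in> carrier_vec (p n)" and v: "v \<in> carrier_vec (p n)" and a0: "a \<noteq> 0\<^sub>v (p n)"
      define N where "N = n - 1"
      define m where "m = n - p n"
      have pn: "1 \<le> p n" "p n \<le> N" "n = Suc N" and m: "m = Suc N - p n" and m1: "1 \<le> m"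
        using p[OF elim(3)] by (auto simp: N_def m_def)
      let ?I = "{..<p n} \<times> {..<Suc N}"
      have aa: "0 < a \<bullet> a" by (rule scalar_prod_self_pos[OF a a0])
      have th: "((a \<bullet> v) / sqrt (a \<bullet> a))\<^sup>2 \<le> v \<bullet> v"
        using scalar_prod_Cauchy_Schwarz[OF a v] aa by (simp add: power_divide pos_divide_le_eq mult.commute)
      let ?F = "\<lambda>y. iexp (t * standardised \<kappa> (Suc N) (p n) a v y)"
      have Fm: "?F \<in> borel_measurable borel" unfolding standardised_def by measurable
      have S: "(\<lambda>z. statistic a v (Matrix.mat (p n) (Suc N) z)) \<in> borel_measurable (gauss ?I)"
        by (rule statistic_measurable[where p = "p n" and n = "Suc N"]) (use a v in \<open>auto intro: mat_measurable_gauss\<close>)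
      have B: "(\<lambda>(w, r, k, s). real N * bilinear_value (Suc N - p n) a (shifted_mean (p n) N v w) r k s)
          \<in> borel_measurable (reference_space (p n) N)"
        using borel_measurable_times[OF borel_measurable_const bilinear_value_measurable[OF a v], of "real N" N]
        by (simp add: split_beta')
      have "(CLINT z|gauss ?I. ?F (statistic a v (Matrix.mat (p n) (Suc N) z))) =
          (CLINT y|distr (gauss ?I) borel (\<lambda>z. statistic a v (Matrix.mat (p n) (Suc N) z)). ?F y)"
        by (rule integral_distr[symmetric]) (use S Fm in auto)
      also have "\<dots> = (CLINT x|reference_space (p n) N. ?F (case x of (w, r, k, s) \<Rightarrow>
          real N * bilinear_value (Suc N - p n) a (shifted_mean (p n) N v w) r k s))"
        unfolding distr_statistic[OF pn(1,2) a v a0]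
        by (rule integral_distr) (use B Fm in auto)
      also have "\<dots> = (CLINT x|reference_space (p n) N. iexp (t * (case x of (w, r, k, s) \<Rightarrow>
          standardised \<kappa> (Suc N) (p n) a v (real N * bilinear_value m a (shifted_mean (p n) N v w) r k s))))"
        by (simp add: split_beta' m)
      finally have eq: "(CLINT z|gauss ?I. ?F (statistic a v (Matrix.mat (p n) (Suc N) z))) = \<dots>" .
      have "cmod ((CLINT x|reference_space (p n) N. iexp (t * (case x of (w, r, k, s) \<Rightarrow>
          standardised \<kappa> (Suc N) (p n) a v (real N * bilinear_value m a (shifted_mean (p n) N v w) r k s)))) - exp (- t\<^sup>2 / 2))
        \<le> 16 / K\<^sup>2 + \<bar>t\<bar> * \<delta> + C * \<bar>t\<bar> ^ 3 / sqrt m"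
      proof (rule char_standardised_bound[OF \<kappa> pn(1,2) m a v a0 K(1) _ _ C0])
        show "\<bar>stat_expr \<kappa> (p n) (Suc N) ((a \<bullet> v) / sqrt (a \<bullet> a), v \<bullet> v, z1, z2, Q, g, h, s) -
            limit_expr \<kappa> ((a \<bullet> v) / sqrt (a \<bullet> a), v \<bullet> v, z1, z2, Q, g, h, s)\<bar> \<le> \<delta>"
          if "\<bar>z1\<bar> \<le> K" "\<bar>z2\<bar> \<le> K" "\<bar>Q\<bar> \<le> K" "\<bar>g\<bar> \<le> K" "\<bar>h\<bar> \<le> K" "\<bar>s\<bar> \<le> K" for z1 z2 Q g h s
          using elim(1)[rule_format, OF th that] unfolding pn(3)[symmetric] by simp
        have ne: "{0 :: nat} \<times> {..<m} \<noteq> {}" using m1 by (auto simp: lessThan_empty_iff)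
        show "cmod ((CLINT k|gauss ({0 :: nat} \<times> {..<m}). iexp (t * chi_norm ({0} \<times> {..<m}) k)) - exp (- t\<^sup>2 / 2)) \<le> C * \<bar>t\<bar> ^ 3 / sqrt m" for t
          using C[OF _ ne, of t] by (simp add: card_cartesian_product)
      qed
      also have "\<dots> \<le> \<epsilon>" using K(2) td elim(2) unfolding m_def by linarith
      finally show "cmod ((CLINT z|gauss ({..<p n} \<times> {..<n}). iexp (t * standardised \<kappa> n (p n) a v (statistic a v (Matrix.mat (p n) n z))))
          - exp (- t\<^sup>2 / 2)) \<le> \<epsilon>"
        unfolding eq[symmetric] unfolding pn(3)[symmetric] .
    qed
  qed
qed

text \<open>The model is given from n0 on only, whereas Levy's theorem asks for probability laws at
  every index; it is applied to the shifted sequence.\<close>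

lemma weak_conv_m_offset:
  assumes "weak_conv_m (\<lambda>n. M (n + k)) M'"
  shows "weak_conv_m M M'"
  unfolding weak_conv_m_def weak_conv_def
proof (intro allI impI)
  fix x assume "isCont (cdf M') x"
  then have "(\<lambda>n. cdf (M (n + k)) x) \<longlonglongrightarrow> cdf M' x"
    using assms unfolding weak_conv_m_def weak_conv_def by blast
  then show "(\<lambda>n. cdf (M n) x) \<longlonglongrightarrow> cdf M' x" by (rule LIMSEQ_offset[where f = "\<lambda>n. cdf (M n) x"])
qed

text \<open>The noise is centred at \<mu> and whitened, while \<nu> keeps its own law D.
  Independence makes the joint law a product, which is what turns conditioning on \<nu> into an
  application of Fubini's theorem.\<close>

lemma LMN_law:
  assumes M: "prob_space M" and P: "P \<in> carrier_mat p p" "Determinant.det P \<noteq> 0" and S: "S \<in> carrier_mat p p"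
    and PSP: "P * S * transpose_mat P = 1\<^sub>m p" and \<mu>: "\<mu> \<in> carrier_vec p" and n: "0 < n"
    and Y: "normal_columns M p n \<mu> S Y"
    and \<nu>: "(\<lambda>\<omega>. vec_coords q (\<nu> \<omega>)) \<in> M \<rightarrow>\<^sub>M Pi\<^sub>M {..<q} (\<lambda>_. borel)"
    and ind: "prob_space.indep_set M
          (sets (vimage_algebra (space M) (\<lambda>\<omega>. mat_coords p n (Y \<omega>)) (Pi\<^sub>M ({..<p} \<times> {..<n}) (\<lambda>_. borel))))
          (sets (vimage_algebra (space M) (\<lambda>\<omega>. vec_coords q (\<nu> \<omega>)) (Pi\<^sub>M {..<q} (\<lambda>_. borel))))"
  defines "D \<equiv> distr M (Pi\<^sub>M {..<q} (\<lambda>_. borel)) (\<lambda>\<omega>. vec_coords q (\<nu> \<omega>))"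
    and "Z \<equiv> \<lambda>\<omega>. mat_coords p n (P * (Y \<omega> - repeat_col n \<mu>))"
  shows "Z \<in> M \<rightarrow>\<^sub>M gauss ({..<p} \<times> {..<n})"
    and "distr M (D \<Otimes>\<^sub>M gauss ({..<p} \<times> {..<n})) (\<lambda>\<omega>. (vec_coords q (\<nu> \<omega>), Z \<omega>)) = D \<Otimes>\<^sub>M gauss ({..<p} \<times> {..<n})"
proof -
  interpret M: prob_space M by (rule M)
  let ?I = "{..<p} \<times> {..<n}" and ?B = "Pi\<^sub>M {..<q} (\<lambda>_. borel :: real measure)" and ?V = "\<lambda>\<omega>. vec_coords q (\<nu> \<omega>)"
  let ?BI = "Pi\<^sub>M ?I (\<lambda>_. borel :: real measure)" and ?Yc = "\<lambda>\<omega>. mat_coords p n (Y \<omega>)"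
  have Yc: "Y \<omega> \<in> carrier_mat p n" if "\<omega> \<in> space M" for \<omega> using Y that by (auto simp: normal_columns_def)
  have rc: "repeat_col n \<mu> \<in> carrier_mat p n" using \<mu> by (simp add: repeat_col_def)
  \<comment> \<open>Z is a measurable function of the coordinates of Y, so its events lie in the
    sigma-algebra generated by Y, and the assumed independence carries over to Z.\<close>
  define F where "F = (\<lambda>y. mat_coords p n (P * (Matrix.mat p n y - repeat_col n \<mu>)))"
  have ZF: "Z \<omega> = F (?Yc \<omega>)" if "\<omega> \<in> space M" for \<omega>
    by (simp add: Z_def F_def mat_of_mat_coords[OF Yc[OF that]])
  have Fm: "F \<in> ?BI \<rightarrow>\<^sub>M gauss ?I"
    unfolding F_def
  proof (intro mat_coords_measurable mat_measurable_mult[of p p _ _ n] mat_measurable_const P)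
    show "mat_measurable p n ?BI (\<lambda>y. Matrix.mat p n y - repeat_col n \<mu>)"
      unfolding mat_measurable_def
    proof (intro conjI ballI allI impI)
      show "Matrix.mat p n y - repeat_col n \<mu> \<in> carrier_mat p n" for y using rc by auto
      fix i j assume ij: "i < p" "j < n"
      then have "(\<lambda>y. y (i, j) - \<mu> $ i) \<in> borel_measurable ?BI"
        by (intro borel_measurable_diff measurable_component_singleton) auto
      then show "(\<lambda>y. (Matrix.mat p n y - repeat_col n \<mu>) $$ (i, j)) \<in> borel_measurable ?BI"
        using ij \<mu> by (simp add: repeat_col_def)
    qed
  qed
  have Ycm: "?Yc \<in> M \<rightarrow>\<^sub>M ?BI"
  proof -
    have "M.random_variable (Pi\<^sub>M {..<p} (\<lambda>_. borel)) (\<lambda>\<omega>. vec_coords p (Matrix.col (Y \<omega>) j))" if "j < n" for j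
      using Y that unfolding normal_columns_def M.indep_vars_def by auto
    then have "(\<lambda>\<omega>. vec_coords p (Matrix.col (Y \<omega>) j) i) \<in> borel_measurable M" if "i < p" "j < n" for i j
      using that measurable_compose[OF _ measurable_component_singleton[of i "{..<p}" "\<lambda>_. borel"]] by auto
    moreover have "vec_coords p (Matrix.col (Y \<omega>) j) i = Y \<omega> $$ (i, j)" if "\<omega> \<in> space M" "i < p" "j < n" for \<omega> i j
      using that Yc[OF that(1)] by (simp add: vec_coords_def)
    ultimately have "(\<lambda>\<omega>. Y \<omega> $$ (i, j)) \<in> borel_measurable M" if "i < p" "j < n" for i j
      using that by (subst measurable_cong[where g = "\<lambda>\<omega>. vec_coords p (Matrix.col (Y \<omega>) j) i"]) auto
    then show ?thesis unfolding mat_coords_def by (intro measurable_restrict) auto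
  qed
  show Zm: "Z \<in> M \<rightarrow>\<^sub>M gauss ?I"
    using measurable_compose[OF Ycm Fm] by (subst measurable_cong[OF ZF]) auto
  have law: "distr M (gauss ?I) Z = gauss ?I"
    unfolding Z_def by (rule whitened_matrix[OF M P S PSP \<mu> n Y])
  have setsD: "sets D = sets ?B" by (simp add: D_def)
  have Vm: "?V \<in> M \<rightarrow>\<^sub>M D" using \<nu> by (simp add: measurable_cong_sets[OF refl setsD])
  have pD: "prob_space D" unfolding D_def by (rule M.prob_space_distr[OF \<nu>])
  have VZ: "(\<lambda>\<omega>. (?V \<omega>, Z \<omega>)) \<in> M \<rightarrow>\<^sub>M D \<Otimes>\<^sub>M gauss ?I" using Vm Zm by measurable
  show "distr M (D \<Otimes>\<^sub>M gauss ?I) (\<lambda>\<omega>. (?V \<omega>, Z \<omega>)) = D \<Otimes>\<^sub>M gauss ?I"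
  proof (rule pair_measure_eqI[symmetric])
    show "sigma_finite_measure D" "sigma_finite_measure (gauss ?I)"
      using pD prob_space_gauss by (auto intro: prob_space_imp_sigma_finite)
    fix A E assume A: "A \<in> sets D" and E: "E \<in> sets (gauss ?I)"
    have a: "?V -` A \<inter> space M \<in> sets (vimage_algebra (space M) ?V ?B)"
      using A setsD by (intro in_vimage_algebra) simp
    have "F -` E \<inter> space ?BI \<in> sets ?BI" using measurable_sets[OF Fm E] .
    then have "?Yc -` (F -` E \<inter> space ?BI) \<inter> space M \<in> sets (vimage_algebra (space M) ?Yc ?BI)"
      by (rule in_vimage_algebra)
    also have "?Yc -` (F -` E \<inter> space ?BI) \<inter> space M = Z -` E \<inter> space M"
      using ZF measurable_space[OF Ycm] by auto
    finally have e: "Z -` E \<inter> space M \<in> sets (vimage_algebra (space M) ?Yc ?BI)" .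
    have "emeasure (distr M (D \<Otimes>\<^sub>M gauss ?I) (\<lambda>\<omega>. (?V \<omega>, Z \<omega>))) (A \<times> E) =
        emeasure M ((Z -` E \<inter> space M) \<inter> (?V -` A \<inter> space M))"
      using A E by (subst emeasure_distr[OF VZ]) (auto intro!: arg_cong[where f = "emeasure M"])
    also have "\<dots> = emeasure M (Z -` E \<inter> space M) * emeasure M (?V -` A \<inter> space M)"
      unfolding M.emeasure_eq_measure M.indep_setD[OF ind e a] by (simp add: ennreal_mult)
    also have "emeasure M (Z -` E \<inter> space M) = emeasure (gauss ?I) E"
      using emeasure_distr[OF Zm E] law by simp
    also have "emeasure M (?V -` A \<inter> space M) = emeasure D A"
      using emeasure_distr[OF \<nu>] A setsD by (simp add: D_def)
    finally show "emeasure D A * emeasure (gauss ?I) E =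
        emeasure (distr M (D \<Otimes>\<^sub>M gauss ?I) (\<lambda>\<omega>. (?V \<omega>, Z \<omega>))) (A \<times> E)" by (simp add: mult.commute)
  qed simp
qed

text \<open>
  Conditioning on \<open>\<nu>\<close>: a bound on the characteristic function that is uniform in the
  conditional mean survives integration over the law of \<open>\<nu>\<close>.
\<close>

lemma
  fixes \<kappa> \<epsilon> t :: real
  assumes model: "LMN M p n q \<mu> S B f \<nu> X" and n: "0 < n" and P: "P \<in> carrier_mat p p" "Determinant.det P \<noteq> 0"
    and PSP: "P * S * transpose_mat P = 1\<^sub>m p" and l: "l \<in> carrier_vec p"
  defines "T \<equiv> \<lambda>\<omega>. standardised \<kappa> n p (P *\<^sub>v l) (P *\<^sub>v (\<mu> + B *\<^sub>v \<nu> \<omega>))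
    (l \<bullet> (inv_mat (sample_cov (X \<omega>)) *\<^sub>v sample_mean (X \<omega>)))"
  shows LMN_measurable: "T \<in> borel_measurable M"
    and LMN_char_bound: "(\<And>v. v \<in> carrier_vec p \<Longrightarrow>
      cmod ((CLINT z|gauss ({..<p} \<times> {..<n}). iexp (t * standardised \<kappa> n p (P *\<^sub>v l) v (statistic (P *\<^sub>v l) v (Matrix.mat p n z))))
        - exp (- t\<^sup>2 / 2)) \<le> \<epsilon>) \<Longrightarrow>
      cmod ((CLINT \<omega>|M. iexp (t * T \<omega>)) - exp (- t\<^sup>2 / 2)) \<le> \<epsilon>"
proof -
  let ?I = "{..<p} \<times> {..<n}" and ?V = "\<lambda>\<omega>. vec_coords q (\<nu> \<omega>)"
  have M: "prob_space M" and \<mu>: "\<mu> \<in> carrier_vec p" and S: "S \<in> carrier_mat p p" and B: "B \<in> carrier_mat p q"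
    and nu: "has_vec_density M q \<nu> f" using model by (auto simp: LMN_def)
  obtain Y where Y: "normal_columns M p n \<mu> S Y"
    and ind: "prob_space.indep_set M
          (sets (vimage_algebra (space M) (\<lambda>\<omega>. mat_coords p n (Y \<omega>)) (Pi\<^sub>M ({..<p} \<times> {..<n}) (\<lambda>_. borel))))
          (sets (vimage_algebra (space M) ?V (Pi\<^sub>M {..<q} (\<lambda>_. borel))))"
    and X: "\<And>\<omega>. \<omega> \<in> space M \<Longrightarrow> X \<omega> = Y \<omega> + repeat_col n (B *\<^sub>v \<nu> \<omega>)"
    using model by (auto simp: LMN_def)
  interpret M: prob_space M by (rule M)
  have nc: "\<nu> \<omega> \<in> carrier_vec q" if "\<omega> \<in> space M" for \<omega> using nu that by (auto simp: has_vec_density_def)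
  have Yc: "Y \<omega> \<in> carrier_mat p n" if "\<omega> \<in> space M" for \<omega> using Y that by (auto simp: normal_columns_def)
  have Vm: "?V \<in> M \<rightarrow>\<^sub>M Pi\<^sub>M {..<q} (\<lambda>_. borel)"
    using nu distributed_measurable unfolding has_vec_density_def
    by (metis measurable_cong_sets[OF refl sets_lborel_prod])
  define D where "D = distr M (Pi\<^sub>M {..<q} (\<lambda>_. borel)) ?V"
  define Z where "Z = (\<lambda>\<omega>. mat_coords p n (P * (Y \<omega> - repeat_col n \<mu>)))"
  have Zm: "Z \<in> M \<rightarrow>\<^sub>M gauss ?I"
    and law: "distr M (D \<Otimes>\<^sub>M gauss ?I) (\<lambda>\<omega>. (?V \<omega>, Z \<omega>)) = D \<Otimes>\<^sub>M gauss ?I"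
    unfolding Z_def D_def by (rule LMN_law[OF M P S PSP \<mu> n Y Vm ind])+
  interpret D: prob_space D unfolding D_def by (rule M.prob_space_distr[OF Vm])
  interpret G: prob_space "gauss ?I" by (rule prob_space_gauss)
  interpret DG: pair_prob_space D "gauss ?I" ..
  define a where "a = P *\<^sub>v l"
  have a: "a \<in> carrier_vec p" using P l by (simp add: a_def)
  define v where "v = (\<lambda>y. P *\<^sub>v (\<mu> + B *\<^sub>v Matrix.vec q y))"
  have v: "v y \<in> carrier_vec p" for y using P(1) \<mu> B by (simp add: v_def)
  have DG_V: "(\<lambda>x. fst x i) \<in> borel_measurable (D \<Otimes>\<^sub>M gauss ?I)" if "i < q" for i
    using that by (intro measurable_compose[OF measurable_fst])
      (auto simp: D_def intro!: measurable_component_singleton)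
  have vm: "(\<lambda>x. v (fst x) $ i) \<in> borel_measurable (D \<Otimes>\<^sub>M gauss ?I)" if i: "i < p" for i
    unfolding v_def
  proof (rule mult_mat_vec_measurable[where p = p, OF mat_measurable_const[OF P(1)] i])
    show "\<mu> + B *\<^sub>v Matrix.vec q (fst x) \<in> carrier_vec p" for x :: "(nat \<Rightarrow> real) \<times> (nat \<times> nat \<Rightarrow> real)" using \<mu> B by simp
    fix j assume j: "j < p"
    have "(\<lambda>x. (B *\<^sub>v Matrix.vec q (fst x)) $ j) \<in> borel_measurable (D \<Otimes>\<^sub>M gauss ?I)"
      by (rule mult_mat_vec_measurable[where p = q, OF mat_measurable_const[OF B] j]) (auto intro: DG_V)
    then have "(\<lambda>x. \<mu> $ j + (B *\<^sub>v Matrix.vec q (fst x)) $ j) \<in> borel_measurable (D \<Otimes>\<^sub>M gauss ?I)" by measurable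
    then show "(\<lambda>x. (\<mu> + B *\<^sub>v Matrix.vec q (fst x)) $ j) \<in> borel_measurable (D \<Otimes>\<^sub>M gauss ?I)"
      using j B \<mu> by simp
  qed
  have Zmat: "mat_measurable p n (D \<Otimes>\<^sub>M gauss ?I) (\<lambda>x. Matrix.mat p n (snd x))"
    by (intro mat_measurable_mat measurable_compose[OF measurable_snd] gauss_component_measurable) auto
  define \<Psi> where "\<Psi> = (\<lambda>x. standardised \<kappa> n p a (v (fst x)) (statistic a (v (fst x)) (Matrix.mat p n (snd x))))"
  have \<Psi>m: "\<Psi> \<in> borel_measurable (D \<Otimes>\<^sub>M gauss ?I)"
    unfolding \<Psi>_def
    by (intro standardised_measurable[where p = p] statistic_measurable[where p = p and n = n] a v vm Zmat)
  have VZ: "(\<lambda>\<omega>. (?V \<omega>, Z \<omega>)) \<in> M \<rightarrow>\<^sub>M D \<Otimes>\<^sub>M gauss ?I"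
    using Vm Zm unfolding D_def by measurable
  have T: "T \<omega> = \<Psi> (?V \<omega>, Z \<omega>)" if o: "\<omega> \<in> space M" for \<omega>
  proof -
    have vq: "Matrix.vec q (?V \<omega>) = \<nu> \<omega>" using nc[OF o] by (intro eq_vecI) (auto simp: vec_coords_def)
    have rc: "repeat_col n \<mu> \<in> carrier_mat p n" using \<mu> by (simp add: repeat_col_def)
    let ?b = "B *\<^sub>v \<nu> \<omega>"
    have b: "?b \<in> carrier_vec p" "\<mu> + ?b \<in> carrier_vec p" using B nc[OF o] \<mu> by auto
    have rb: "repeat_col n (\<mu> + ?b) \<in> carrier_mat p n" by (rule repeat_col_carrier[OF b(2)])
    let ?Z = "P * (Y \<omega> - repeat_col n \<mu>)"
    have YZ: "Y \<omega> - repeat_col n \<mu> \<in> carrier_mat p n" using Yc[OF o] rc by auto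
    have Zc: "?Z \<in> carrier_mat p n" by (rule mult_carrier_mat[OF P(1) YZ])
    have Xc: "X \<omega> \<in> carrier_mat p n"
      unfolding X[OF o] by (rule add_carrier_mat[OF repeat_col_carrier[OF b(1)]])
    \<comment> \<open>\<mu> is moved from the noise to the mean, so that P X is the whitened noise
      plus n copies of P (\<mu> + B \<nu>).\<close>
    have "X \<omega> = (Y \<omega> - repeat_col n \<mu>) + repeat_col n (\<mu> + ?b)"
      unfolding X[OF o] using Yc[OF o] \<mu> b B by (intro eq_matI) (auto simp: repeat_col_def)
    then have "P * X \<omega> = ?Z + P * repeat_col n (\<mu> + ?b)"
      using mult_add_distrib_mat[OF P(1) YZ rb] by simp
    also have "P * repeat_col n (\<mu> + ?b) = repeat_col n (P *\<^sub>v (\<mu> + ?b))"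
    proof (rule eq_matI)
      fix i j assume "i < dim_row (repeat_col n (P *\<^sub>v (\<mu> + ?b)))" "j < dim_col (repeat_col n (P *\<^sub>v (\<mu> + ?b)))"
      then have ij: "i < p" "j < n" using P(1) by (auto simp: repeat_col_def)
      have "Matrix.col (repeat_col n (\<mu> + ?b)) j = \<mu> + ?b"
        using ij b by (intro eq_vecI) (auto simp: repeat_col_def)
      then show "(P * repeat_col n (\<mu> + ?b)) $$ (i, j) = repeat_col n (P *\<^sub>v (\<mu> + ?b)) $$ (i, j)"
        using ij P(1) rb by (simp add: repeat_col_def[of n "P *\<^sub>v (\<mu> + ?b)"])
    qed (use P(1) in \<open>auto simp: repeat_col_def\<close>)
    finally have PX: "P * X \<omega> = ?Z + repeat_col n (P *\<^sub>v (\<mu> + ?b))" .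
    have "l \<bullet> (inv_mat (sample_cov (X \<omega>)) *\<^sub>v sample_mean (X \<omega>)) = statistic a (P *\<^sub>v (\<mu> + ?b)) ?Z"
      unfolding a_def by (rule statistic_whitened[OF P Xc n Zc mult_mat_vec_carrier[OF P(1) b(2)] PX l])
    then show ?thesis
      unfolding T_def \<Psi>_def a_def[symmetric] fst_conv snd_conv v_def vq Z_def mat_of_mat_coords[OF Zc] by simp
  qed
  show Tm: "T \<in> borel_measurable M"
    using measurable_compose[OF VZ \<Psi>m] by (subst measurable_cong[OF T]) auto
  assume bound: "\<And>v. v \<in> carrier_vec p \<Longrightarrow>
      cmod ((CLINT z|gauss ({..<p} \<times> {..<n}). iexp (t * standardised \<kappa> n p (P *\<^sub>v l) v (statistic (P *\<^sub>v l) v (Matrix.mat p n z))))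
        - exp (- t\<^sup>2 / 2)) \<le> \<epsilon>"
  have int: "integrable (D \<Otimes>\<^sub>M gauss ?I) (\<lambda>x. iexp (t * \<Psi> x))"
    using \<Psi>m by (intro DG.P.integrable_iexp) auto
  have "(CLINT \<omega>|M. iexp (t * T \<omega>)) = (CLINT \<omega>|M. iexp (t * \<Psi> (?V \<omega>, Z \<omega>)))"
    by (intro Bochner_Integration.integral_cong) (simp_all add: T)
  also have "\<dots> = (CLINT x|distr M (D \<Otimes>\<^sub>M gauss ?I) (\<lambda>\<omega>. (?V \<omega>, Z \<omega>)). iexp (t * \<Psi> x))"
    by (rule integral_distr[OF VZ borel_measurable_integrable[OF int], symmetric])
  also have "\<dots> = (CLINT y|D. (CLINT z|gauss ?I. iexp (t * \<Psi> (y, z))))"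
    unfolding law by (rule DG.integral_fst'[OF int, symmetric])
  finally have eq: "(CLINT \<omega>|M. iexp (t * T \<omega>)) = (CLINT y|D. (CLINT z|gauss ?I. iexp (t * \<Psi> (y, z))))" .
  have iD: "integrable D (\<lambda>y. (CLINT z|gauss ?I. iexp (t * \<Psi> (y, z))))"
    by (rule DG.integrable_fst'[OF int])
  have "(CLINT \<omega>|M. iexp (t * T \<omega>)) - exp (- t\<^sup>2 / 2) =
      (CLINT y|D. (CLINT z|gauss ?I. iexp (t * \<Psi> (y, z))) - complex_of_real (exp (- t\<^sup>2 / 2)))"
    unfolding eq using iD D.prob_space by simp
  also have "cmod \<dots> \<le> (LINT y|D. cmod ((CLINT z|gauss ?I. iexp (t * \<Psi> (y, z))) - complex_of_real (exp (- t\<^sup>2 / 2))))"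
    by (rule integral_norm_bound)
  also have "\<dots> \<le> (LINT y|D. \<epsilon>)"
  proof (rule integral_mono)
    show "integrable D (\<lambda>y. cmod ((CLINT z|gauss ?I. iexp (t * \<Psi> (y, z))) - complex_of_real (exp (- t\<^sup>2 / 2))))"
      using iD by (intro integrable_norm Bochner_Integration.integrable_diff) auto
    show "cmod ((CLINT z|gauss ?I. iexp (t * \<Psi> (y, z))) - complex_of_real (exp (- t\<^sup>2 / 2))) \<le> \<epsilon>" for y
      using bound[OF v[of y]] unfolding \<Psi>_def a_def by simp
  qed simp
  also have "\<dots> = \<epsilon>" using D.prob_space by simp
  finally show "cmod ((CLINT \<omega>|M. iexp (t * T \<omega>)) - exp (- t\<^sup>2 / 2)) \<le> \<epsilon>" .
qed

theorem theorem2: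
  fixes q n0 :: nat and p :: "nat \<Rightarrow> nat" and c m1 M1 M2 :: real
    and f :: "real Matrix.vec \<Rightarrow> real"
    and \<mu> l :: "nat \<Rightarrow> real Matrix.vec"
    and \<Sigma> B :: "nat \<Rightarrow> real Matrix.mat"
    and lam :: "nat \<Rightarrow> nat \<Rightarrow> real" and u :: "nat \<Rightarrow> nat \<Rightarrow> real Matrix.vec"
    and M :: "nat \<Rightarrow> 'w measure"
    and \<nu> :: "nat \<Rightarrow> 'w \<Rightarrow> real Matrix.vec"
    and X :: "nat \<Rightarrow> 'w \<Rightarrow> real Matrix.mat"
  assumes q: "0 < q"
    and p: "\<And>n. n \<ge> n0 \<Longrightarrow> 1 \<le> p n \<and> p n < n - 1"
    and c: "0 \<le> c" "c < 1"
    and rate: "(\<lambda>n. real (p n) / real n - c) \<in> o(\<lambda>n. real n powr (- 1 / 2))"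
    and model: "\<And>n. n \<ge> n0 \<Longrightarrow>
      LMN (M n) (p n) n q (\<mu> (p n)) (\<Sigma> (p n)) (B (p n)) f (\<nu> n) (X n)"
    and pos_def: "\<And>n. n \<ge> n0 \<Longrightarrow> pos_def_mat (p n) (\<Sigma> (p n))"
    and l: "\<And>n. n \<ge> n0 \<Longrightarrow> l (p n) \<in> carrier_vec (p n) \<and> l (p n) \<noteq> 0\<^sub>v (p n)"
    and eigen: "\<And>n. n \<ge> n0 \<Longrightarrow>
      sorted_eigensystem (p n) (\<Sigma> (p n)) (lam (p n)) (u (p n))"
    and m1: "0 < m1"
    and bound_lam: "\<And>n i. n \<ge> n0 \<Longrightarrow> i < p n \<Longrightarrow> m1 \<le> lam (p n) i \<and> lam (p n) i \<le> M1"
    and bound_mu: "\<And>n i. n \<ge> n0 \<Longrightarrow> i < p n \<Longrightarrow> \<bar>u (p n) i \<bullet> \<mu> (p n)\<bar> \<le> M2"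
    and bound_B: "\<And>n i j. n \<ge> n0 \<Longrightarrow> i < p n \<Longrightarrow> j < q \<Longrightarrow>
      \<bar>u (p n) i \<bullet> col (B (p n)) j\<bar> \<le> M2"
    and bound_l: "\<And>n i. n \<ge> n0 \<Longrightarrow> i < p n \<Longrightarrow> \<bar>u (p n) i \<bullet> l (p n)\<bar> \<le> M2"
  shows "weak_conv_m
    (\<lambda>n. distr (M n) borel (\<lambda>\<omega>.
       let \<mu>\<^sub>\<nu> = \<mu> (p n) + B (p n) *\<^sub>v \<nu> n \<omega> in
       sqrt (real n) * inverse (sigma_tilde c (\<Sigma> (p n)) (l (p n)) \<mu>\<^sub>\<nu>) *
       (l (p n) \<bullet> (inv_mat (sample_cov (X n \<omega>)) *\<^sub>v sample_mean (X n \<omega>))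
          - 1 / (1 - c) * (l (p n) \<bullet> (inv_mat (\<Sigma> (p n)) *\<^sub>v \<mu>\<^sub>\<nu>)))))
    std_normal_distribution"
proof -
  define \<kappa> where "\<kappa> = 1 - c"
  have \<kappa>: "0 < \<kappa>" "\<kappa> \<le> 1" using c by (auto simp: \<kappa>_def)
  have rate': "(\<lambda>n. sqrt (real n) * (real (p n) / real n - (1 - \<kappa>))) \<longlonglongrightarrow> 0"
  proof (rule Lim_transform_eventually[OF smalloD_tendsto[OF rate]])
    show "\<forall>\<^sub>F n in sequentially. (real (p n) / real n - c) / real n powr (- 1 / 2) =
        sqrt (real n) * (real (p n) / real n - (1 - \<kappa>))"
      using eventually_gt_at_top[of 0]
    proof eventually_elim
      case (elim n)
      have "real n powr (- 1 / 2) = inverse (sqrt (real n))"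
        using powr_minus[of "real n" "1 / 2"] powr_half_sqrt[of "real n"] by simp
      then have "(real (p n) / real n - c) / real n powr (- 1 / 2) = (real (p n) / real n - c) * sqrt (real n)"
        by (simp only: divide_inverse[of "real (p n) / real n - c"] inverse_inverse_eq)
      then show ?case by (simp add: \<kappa>_def mult.commute)
    qed
  qed
  define T where "T = (\<lambda>n \<omega>.
       let \<mu>\<^sub>\<nu> = \<mu> (p n) + B (p n) *\<^sub>v \<nu> n \<omega> in
       sqrt (real n) * inverse (sigma_tilde c (\<Sigma> (p n)) (l (p n)) \<mu>\<^sub>\<nu>) *
       (l (p n) \<bullet> (inv_mat (sample_cov (X n \<omega>)) *\<^sub>v sample_mean (X n \<omega>))
          - 1 / (1 - c) * (l (p n) \<bullet> (inv_mat (\<Sigma> (p n)) *\<^sub>v \<mu>\<^sub>\<nu>))))"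
  have reduce: "\<exists>P \<in> carrier_mat (p n) (p n). Determinant.det P \<noteq> 0 \<and> P *\<^sub>v l (p n) \<noteq> 0\<^sub>v (p n) \<and>
      P * \<Sigma> (p n) * transpose_mat P = 1\<^sub>m (p n) \<and>
      (\<forall>\<omega> \<in> space (M n). T n \<omega> = standardised \<kappa> n (p n) (P *\<^sub>v l (p n)) (P *\<^sub>v (\<mu> (p n) + B (p n) *\<^sub>v \<nu> n \<omega>))
        (l (p n) \<bullet> (inv_mat (sample_cov (X n \<omega>)) *\<^sub>v sample_mean (X n \<omega>))))"
    if n: "n \<ge> n0" for n
  proof -
    have S: "\<Sigma> (p n) \<in> carrier_mat (p n) (p n)" using pos_def[OF n] by (simp add: pos_def_mat_def)
    have lc: "l (p n) \<in> carrier_vec (p n)" "l (p n) \<noteq> 0\<^sub>v (p n)" using l[OF n] by auto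
    have lam_pos: "0 < lam (p n) i" if "i < p n" for i
      using bound_lam[OF n that] m1 by linarith
    obtain P where P: "P \<in> carrier_mat (p n) (p n)" "Determinant.det P \<noteq> 0"
      and PSP: "P * \<Sigma> (p n) * transpose_mat P = 1\<^sub>m (p n)"
      using eigen_whitening[OF S eigen[OF n] lam_pos] by blast
    \<comment> \<open>Invertibility of P carries l \<noteq> 0 over to a = P l, by whose norm
      \<theta> and z1 are divided.\<close>
    have "P *\<^sub>v l (p n) \<noteq> 0\<^sub>v (p n)"
      using det_0_iff_vec_prod_zero_field[OF P(1)] P(2) lc by blast
    moreover have "T n \<omega> = standardised \<kappa> n (p n) (P *\<^sub>v l (p n)) (P *\<^sub>v (\<mu> (p n) + B (p n) *\<^sub>v \<nu> n \<omega>))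
        (l (p n) \<bullet> (inv_mat (sample_cov (X n \<omega>)) *\<^sub>v sample_mean (X n \<omega>)))" if o: "\<omega> \<in> space (M n)" for \<omega>
    proof -
      have "\<mu> (p n) + B (p n) *\<^sub>v \<nu> n \<omega> \<in> carrier_vec (p n)"
        using model[OF n] o by (auto simp: LMN_def has_vec_density_def)
      from target_eq_standardised[OF P S PSP lc(1) this] show ?thesis
        unfolding T_def Let_def \<kappa>_def .
    qed
    ultimately show ?thesis using P PSP by blast
  qed
  have n_pos: "0 < n" if "n \<ge> n0" for n using p[OF that] by linarith
  have meas: "T n \<in> borel_measurable (M n)" if n: "n \<ge> n0" for n
  proof -
    obtain P where P: "P \<in> carrier_mat (p n) (p n)" "Determinant.det P \<noteq> 0"
      and PSP: "P * \<Sigma> (p n) * transpose_mat P = 1\<^sub>m (p n)"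
      and T: "\<And>\<omega>. \<omega> \<in> space (M n) \<Longrightarrow> T n \<omega> = standardised \<kappa> n (p n) (P *\<^sub>v l (p n)) (P *\<^sub>v (\<mu> (p n) + B (p n) *\<^sub>v \<nu> n \<omega>))
        (l (p n) \<bullet> (inv_mat (sample_cov (X n \<omega>)) *\<^sub>v sample_mean (X n \<omega>)))"
      using reduce[OF n] by blast
    show ?thesis
      using LMN_measurable[OF model[OF n] n_pos[OF n] P PSP conjunct1[OF l[OF n]]]
      by (subst measurable_cong[OF T]) auto
  qed
  have char_lim: "(\<lambda>n. (CLINT \<omega>|M n. iexp (t * T n \<omega>))) \<longlonglongrightarrow> complex_of_real (exp (- t\<^sup>2 / 2))" for t
  proof (rule tendstoI)
    fix e :: real assume e: "0 < e"
    \<comment> \<open>The threshold on n is the same for all a and v, so the whitening matrix P, and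
      with it a = P l, may be chosen afterwards for each n.\<close>
    have "\<forall>\<^sub>F n in sequentially. \<forall>a v. a \<in> carrier_vec (p n) \<longrightarrow> v \<in> carrier_vec (p n) \<longrightarrow> a \<noteq> 0\<^sub>v (p n) \<longrightarrow>
      cmod ((CLINT z|gauss ({..<p n} \<times> {..<n}). iexp (t * standardised \<kappa> n (p n) a v (statistic a v (Matrix.mat (p n) n z))))
        - exp (- t\<^sup>2 / 2)) \<le> e / 2"
      by (rule char_statistic_uniform[OF \<kappa> _ rate', of n0]) (use p e in auto)
    then show "\<forall>\<^sub>F n in sequentially. dist (CLINT \<omega>|M n. iexp (t * T n \<omega>)) (complex_of_real (exp (- t\<^sup>2 / 2))) < e"
      using eventually_ge_at_top[of n0]
    proof eventually_elim
      case (elim n)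
      obtain P where P: "P \<in> carrier_mat (p n) (p n)" "Determinant.det P \<noteq> 0" and Pl: "P *\<^sub>v l (p n) \<noteq> 0\<^sub>v (p n)"
        and PSP: "P * \<Sigma> (p n) * transpose_mat P = 1\<^sub>m (p n)"
        and T: "\<And>\<omega>. \<omega> \<in> space (M n) \<Longrightarrow> T n \<omega> = standardised \<kappa> n (p n) (P *\<^sub>v l (p n)) (P *\<^sub>v (\<mu> (p n) + B (p n) *\<^sub>v \<nu> n \<omega>))
          (l (p n) \<bullet> (inv_mat (sample_cov (X n \<omega>)) *\<^sub>v sample_mean (X n \<omega>)))"
        using reduce[OF elim(2)] by blast
      have lc: "l (p n) \<in> carrier_vec (p n)" using l[OF elim(2)] by simp
      have Plc: "P *\<^sub>v l (p n) \<in> carrier_vec (p n)" using P lc by simp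
      have "cmod ((CLINT \<omega>|M n. iexp (t * T n \<omega>)) - exp (- t\<^sup>2 / 2)) \<le> e / 2"
      proof -
        have "(CLINT \<omega>|M n. iexp (t * T n \<omega>)) = (CLINT \<omega>|M n. iexp (t * standardised \<kappa> n (p n) (P *\<^sub>v l (p n))
            (P *\<^sub>v (\<mu> (p n) + B (p n) *\<^sub>v \<nu> n \<omega>)) (l (p n) \<bullet> (inv_mat (sample_cov (X n \<omega>)) *\<^sub>v sample_mean (X n \<omega>)))))"
          by (intro Bochner_Integration.integral_cong refl) (simp only: T)
        then show ?thesis
          using LMN_char_bound[OF model[OF elim(2)] n_pos[OF elim(2)] P PSP lc, where t = t and \<kappa> = \<kappa> and \<epsilon> = "e / 2"] elim(1) Plc Pl
          by simp
      qed
      then show ?case using e by (simp add: dist_norm)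
    qed
  qed
  have "weak_conv_m (\<lambda>n. distr (M (n + n0)) borel (T (n + n0))) std_normal_distribution"
  proof (rule levy_continuity)
    show "real_distribution (distr (M (n + n0)) borel (T (n + n0)))" for n
      using model[of "n + n0"] meas[of "n + n0"]
      by (intro prob_space.real_distribution_distr) (auto simp: LMN_def)
    show "real_distribution std_normal_distribution" by (rule real_dist_normal_dist)
    fix t
    have "char (distr (M (n + n0)) borel (T (n + n0))) t = (CLINT \<omega>|M (n + n0). iexp (t * T (n + n0) \<omega>))" for n
      unfolding char_def using meas[of "n + n0"] by (subst integral_distr) auto
    then show "(\<lambda>n. char (distr (M (n + n0)) borel (T (n + n0))) t) \<longlonglongrightarrow> char std_normal_distribution t"
      using LIMSEQ_ignore_initial_segment[OF char_lim[of t], of n0] by (simp add: char_std_normal_distribution)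
  qed
  then have "weak_conv_m (\<lambda>n. distr (M n) borel (T n)) std_normal_distribution"
    by (rule weak_conv_m_offset)
  then show ?thesis unfolding T_def .
qed

end
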